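(* There exist a set $X\subset\mathbb{R}$ of Lebesgue measure zero which contains all rational numbers and whose complement $\mathbb{R}\setminus X$ contains all generic irrational numbers, and a function $u_0\in C^\infty(\mathbb{R}^3)$, such that $$\begin{cases} W(t)u_0\in C^\infty(\mathbb{R}^3), & t>0,\ t\in\mathbb{R}\setminus X,\\ W(t)u_0\notin C^1(\mathbb{R}^3), & t>0,\ t\in X.\end{cases}$$
   Context: Points of $\mathbb{R}^3$ are written $(x,y)$ with $x\in\mathbb{R}$, $y=(y_1,y_2)\in\mathbb{R}^2$, and $\Delta=\partial_x^2+\partial_{y_1}^2+\partial_{y_2}^2$. Linear propagator: $W(t)=e^{-t\partial_x\Delta}$, i.e. $\widehat{W(t)f}(\xi,\eta)=e^{it\xi(\xi^2+|\eta|^2)}\hat f(\xi,\eta)$, so that $v=W(t)f$ solves $\partial_t v+\partial_x\Delta v=0$, $v(0)=f$. Generic irrational: an irrational number $\gamma$ is called generic if there is a constant $c=c(\gamma)>0$ such that $$|k_1+k_2\gamma|\ge \frac{c}{(|k_1|+|k_2|)\ln(|k_1|+|k_2|)}$$ for all $k_1,k_2\in\mathbb{Z}$ with $|k_1|+|k_2|\ge 2$. *)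

theory Defs
  imports "HOL-Analysis.Analysis"
begin

text \<open>
  The point \<open>(x, y\<^sub>1, y\<^sub>2)\<close> stands for \<open>(x, y)\<close> with \<open>y = (y\<^sub>1, y\<^sub>2)\<close>; the product norm is the
  Euclidean one.
\<close>

type_synonym R3 = "real \<times> real \<times> real"

text \<open>
  A function is \<open>C\<^sup>k\<^sup>+\<^sup>1\<close> iff it is (Frechet) differentiable everywhere and all its directional
  derivatives are \<open>C\<^sup>k\<close>.
\<close>

primrec C_k :: "nat \<Rightarrow> ('a::euclidean_space \<Rightarrow> 'b::real_normed_vector) \<Rightarrow> bool" where
  "C_k 0 f \<longleftrightarrow> continuous_on UNIV f"
| "C_k (Suc k) f \<longleftrightarrow> f differentiable_on UNIV \<and>
     (\<forall>v. C_k k (\<lambda>x. frechet_derivative f (at x) v))"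

definition C_infinity :: "('a::euclidean_space \<Rightarrow> 'b::real_normed_vector) \<Rightarrow> bool" where
  "C_infinity f \<longleftrightarrow> (\<forall>k. C_k k f)"

text \<open>
  With the list ranging over lists of basis vectors, these are the iterated partial derivatives.
\<close>

primrec dir_derivs :: "'a list \<Rightarrow> ('a::euclidean_space \<Rightarrow> 'b::real_normed_vector) \<Rightarrow> 'a \<Rightarrow> 'b" where
  "dir_derivs [] f = f"
| "dir_derivs (v # vs) f = dir_derivs vs (\<lambda>x. frechet_derivative f (at x) v)"

definition schwartz :: "('a::euclidean_space \<Rightarrow> complex) \<Rightarrow> bool" where
  "schwartz \<phi> \<longleftrightarrow> C_infinity \<phi> \<and>
     (\<forall>n. \<forall>vs\<in>lists Basis. bounded (range (\<lambda>x. norm x ^ n *\<^sub>R dir_derivs vs \<phi> x)))"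

definition test_function :: "('a::euclidean_space \<Rightarrow> complex) \<Rightarrow> bool" where
  "test_function \<phi> \<longleftrightarrow> C_infinity \<phi> \<and> compact (closure {x. \<phi> x \<noteq> 0})"

definition schwartz_norm :: "nat \<Rightarrow> ('a::euclidean_space \<Rightarrow> complex) \<Rightarrow> real" where
  "schwartz_norm N \<phi> =
     (SUP (vs, x) \<in> {vs \<in> lists Basis. length vs \<le> N} \<times> UNIV.
        (1 + norm x) ^ N * norm (dir_derivs vs \<phi> x))"

text \<open>
  Distributions are functionals on all functions, but only their values on Schwartz functions are
  meaningful.
\<close>

definition tempered_distribution :: "(('a::euclidean_space \<Rightarrow> complex) \<Rightarrow> complex) \<Rightarrow> bool" where
  "tempered_distribution T \<longleftrightarrow>
     (\<forall>a b \<phi> \<psi>. schwartz \<phi> \<longrightarrow> schwartz \<psi> \<longrightarrow>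
        T (\<lambda>x. a * \<phi> x + b * \<psi> x) = a * T \<phi> + b * T \<psi>) \<and>
     (\<exists>C N. \<forall>\<phi>. schwartz \<phi> \<longrightarrow> norm (T \<phi>) \<le> C * schwartz_norm N \<phi>)"

text \<open>
  Testing against compactly supported functions only does not presuppose any growth bound on \<open>f\<close>.
  Since test functions are dense in the Schwartz space, a tempered distribution is determined by
  the function representing it.
\<close>

definition represented_by ::
    "(('a::euclidean_space \<Rightarrow> complex) \<Rightarrow> complex) \<Rightarrow> ('a \<Rightarrow> complex) \<Rightarrow> bool" where
  "represented_by T f \<longleftrightarrow>
     (\<forall>\<phi>. test_function \<phi> \<longrightarrow>
        integrable lborel (\<lambda>x. f x * \<phi> x) \<and> T \<phi> = (\<integral>x. f x * \<phi> x \<partial>lborel))"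

definition fourier :: "('a::euclidean_space \<Rightarrow> complex) \<Rightarrow> 'a \<Rightarrow> complex" where
  "fourier \<phi> \<zeta> = (\<integral>x. cis (- (x \<bullet> \<zeta>)) * \<phi> x \<partial>lborel)"

definition inverse_fourier :: "('a::euclidean_space \<Rightarrow> complex) \<Rightarrow> 'a \<Rightarrow> complex" where
  "inverse_fourier \<phi> x =
     complex_of_real (1 / (2 * pi) ^ DIM('a)) * (\<integral>\<zeta>. cis (x \<bullet> \<zeta>) * \<phi> \<zeta> \<partial>lborel)"

text \<open>
  The transposes of the operations on Schwartz functions: the Fourier transform, its inverse and
  multiplication are all symmetric for the pairing \<open>\<integral>f \<phi>\<close>.
\<close>

definition dist_fourier ::
    "(('a::euclidean_space \<Rightarrow> complex) \<Rightarrow> complex) \<Rightarrow> ('a \<Rightarrow> complex) \<Rightarrow> complex" where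
  "dist_fourier T \<phi> = T (fourier \<phi>)"

definition dist_inverse_fourier ::
    "(('a::euclidean_space \<Rightarrow> complex) \<Rightarrow> complex) \<Rightarrow> ('a \<Rightarrow> complex) \<Rightarrow> complex" where
  "dist_inverse_fourier T \<phi> = T (inverse_fourier \<phi>)"

definition dist_mult ::
    "('a \<Rightarrow> complex) \<Rightarrow> (('a::euclidean_space \<Rightarrow> complex) \<Rightarrow> complex) \<Rightarrow> ('a \<Rightarrow> complex) \<Rightarrow> complex" where
  "dist_mult m T \<phi> = T (\<lambda>\<zeta>. m \<zeta> * \<phi> \<zeta>)"

definition symbol :: "real \<Rightarrow> R3 \<Rightarrow> complex" where
  "symbol t = (\<lambda>(\<xi>, \<eta>). cis (t * \<xi> * (\<xi>\<^sup>2 + (norm \<eta>)\<^sup>2)))"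

definition W :: "real \<Rightarrow> ((R3 \<Rightarrow> complex) \<Rightarrow> complex) \<Rightarrow> (R3 \<Rightarrow> complex) \<Rightarrow> complex" where
  "W t T = dist_inverse_fourier (dist_mult (symbol t) (dist_fourier T))"

definition generic_irrational :: "real \<Rightarrow> bool" where
  "generic_irrational \<gamma> \<longleftrightarrow> \<gamma> \<notin> \<rat> \<and>
     (\<exists>c>0. \<forall>k1 k2 :: int. \<bar>k1\<bar> + \<bar>k2\<bar> \<ge> 2 \<longrightarrow>
        \<bar>real_of_int k1 + real_of_int k2 * \<gamma>\<bar> \<ge>
          c / (real_of_int (\<bar>k1\<bar> + \<bar>k2\<bar>) * ln (real_of_int (\<bar>k1\<bar> + \<bar>k2\<bar>))))"

end

theory Submission
  imports Defs "HOL-Probability.Probability" "HOL-Complex_Analysis.Complex_Analysis" "HOL-Real_Asymp.Real_Asymp"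
begin

text \<open>
  One can take \<open>X = \<rat>\<close>. The datum is a sum of Gaussian wave packets of very high frequency in \<open>y\<^sub>1\<close> and
  almost vanishing frequency in \<open>x\<close>. Such a packet runs through space in the direction of \<open>x\<close> with enormous
  speed, while it hardly moves or spreads in \<open>y\<close>. The \<open>n\<close>-th positive rational \<open>r\<^sub>n\<close> gets infinitely many
  packets, with frequencies tending to infinity, all of which pass the point \<open>(0, n, 0)\<close> at time \<open>r\<^sub>n\<close>; there
  their \<open>y\<^sub>1\<close>-derivatives blow up. On a compact set only the finitely many rationals \<open>r\<^sub>n\<close> with small \<open>n\<close>
  matter, since the other packets stay away in \<open>y\<^sub>1\<close>, and at a time different from these the packets
  concerned have not arrived or have already gone in \<open>x\<close>. Hence even at times that are extremely well
  approximated by rationals the solution is smooth. Shifting the contour of the \<open>\<xi>\<close>- or \<open>\<eta>\<^sub>1\<close>-integral by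
  \<open>\<plusminus>\<i>\<close> (in rescaled variables) gives the decay away from the packets.
\<close>

section \<open>Functions of class \<open>C\<^sup>k\<close>\<close>

text \<open>The exponents come from a balance. With the frequencies of \<open>packet_freq\<close>
  the phase t a (a^2 + b^2 + c^2) is t \<xi> M^3, which is pure transport, plus terms of size t/M
  such as 2 t \<xi> \<eta> / M: a packet stays almost rigid once M is large. The amplitude M^-4 lies
  between two demands. The y1-derivative at the focus, of size M^5 M^-4 = M, must blow up; the L^1
  norm, of size M^7 M^-1 M^-3 M^-4 = 1/M, must be summable, which is what the width M^-3 in y2 is
  for. The datum is then integrable and \<open>W t\<close> can be computed packet by packet.

  Infinitely many packets focus at the same point, and their large derivatives might cancel.
  Therefore each M is the square of its predecessor. Tested against the derivative of a bump of
  width about M^-5, one packet then outweighs the earlier ones, whose derivatives add up to O(sqrt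
  M), and the later ones, whose amplitude is at most of order M^-8 while the derivative of the bump
  costs only M^5.

  Only positive rationals are focusing times, so smoothness of the datum is the case t = 0 of
  smoothness at non-focusing times.\<close>

lemma C_k_if_derivative_family:
  fixes F :: "'a list \<Rightarrow> 'a::euclidean_space \<Rightarrow> 'b::real_normed_vector"
  assumes "\<And>vs p. (F vs has_derivative (\<lambda>h. F (h # vs) p)) (at p)"
  shows "C_k k (F vs)"
proof (induction k arbitrary: vs)
  case 0
  then show ?case
    using assms by (auto intro!: continuous_at_imp_continuous_on has_derivative_continuous)
next
  case (Suc k)
  have "frechet_derivative (F vs) (at x) v = F (v # vs) x" for x v
    using frechet_derivative_at[OF assms] by metis
  moreover have "F vs differentiable_on UNIV"
    using assms by (auto simp: differentiable_on_def differentiable_def)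
  ultimately show ?case using Suc by simp
qed

lemma C_k_Suc_imp_C_k: "C_k (Suc k) f \<Longrightarrow> C_k k f"
proof (induction k arbitrary: f)
  case 0
  then show ?case by (auto intro: differentiable_imp_continuous_on)
next
  case (Suc k)
  then show ?case by (metis C_k.simps(2))
qed

lemma C_k_antimono: "C_k n f \<Longrightarrow> k \<le> n \<Longrightarrow> C_k k f"
  by (induction n) (auto simp: le_Suc_eq C_k_Suc_imp_C_k simp del: C_k.simps(2))

lemma C_k_imp_continuous_on: "C_k k f \<Longrightarrow> continuous_on S f"
  using C_k_antimono[of k f 0] by (auto intro: continuous_on_subset)

lemma C_k_Suc_imp_has_derivative:
  "C_k (Suc k) f \<Longrightarrow> (f has_derivative frechet_derivative f (at x)) (at x)"
  by (simp add: differentiable_on_def frechet_derivative_works[symmetric])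

lemma C_k_SucI:
  assumes "\<And>x. (f has_derivative (\<lambda>v. f' v x)) (at x)" and "\<And>v. C_k k (f' v)"
  shows "C_k (Suc k) f"
proof -
  have "frechet_derivative f (at x) v = f' v x" for x v
    using frechet_derivative_at[OF assms(1)] by metis
  moreover have "f differentiable_on UNIV"
    using assms(1) by (auto simp: differentiable_on_def differentiable_def)
  ultimately show ?thesis using assms(2) by simp
qed

lemma C_k_const: "C_k k (\<lambda>x. c)"
proof (induction k arbitrary: c)
  case (Suc k)
  show ?case by (rule C_k_SucI[where f' = "\<lambda>v x. 0"]) (use Suc in auto)
qed simp

lemma C_k_bounded_linear: "bounded_linear f \<Longrightarrow> C_k k f"
proof (cases k)
  case 0
  then show "bounded_linear f \<Longrightarrow> ?thesis" by (simp add: linear_continuous_on)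
next
  case (Suc m)
  assume "bounded_linear f"
  then show ?thesis unfolding Suc
    by (intro C_k_SucI[where f' = "\<lambda>v x. f v"] C_k_const)
       (auto intro: bounded_linear.has_derivative[OF _ has_derivative_ident])
qed

lemma C_k_compose_bounded_linear:
  assumes "bounded_linear h" "C_k k f"
  shows "C_k k (\<lambda>x. h (f x))"
  using assms(2)
proof (induction k arbitrary: f)
  case 0
  then show ?case
    using assms(1) by (auto intro: bounded_linear.continuous_on)
next
  case (Suc k)
  show ?case
  proof (rule C_k_SucI)
    show "((\<lambda>x. h (f x)) has_derivative (\<lambda>v. h (frechet_derivative f (at x) v))) (at x)" for x
      by (rule bounded_linear.has_derivative[OF assms(1) C_k_Suc_imp_has_derivative[OF Suc.prems]])
    show "C_k k (\<lambda>x. h (frechet_derivative f (at x) v))" for v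
      using Suc by simp
  qed
qed

lemma C_k_add: "C_k k f \<Longrightarrow> C_k k g \<Longrightarrow> C_k k (\<lambda>x. f x + g x)"
proof (induction k arbitrary: f g)
  case (Suc k)
  show ?case
    by (rule C_k_SucI[OF has_derivative_add[OF C_k_Suc_imp_has_derivative C_k_Suc_imp_has_derivative]])
       (use Suc in auto)
qed (auto intro: continuous_on_add)

lemma C_k_mult:
  fixes f g :: "'a::euclidean_space \<Rightarrow> 'b::real_normed_algebra"
  shows "C_k k f \<Longrightarrow> C_k k g \<Longrightarrow> C_k k (\<lambda>x. f x * g x)"
proof (induction k arbitrary: f g)
  case (Suc k)
  show ?case
  proof (rule C_k_SucI)
    show "((\<lambda>x. f x * g x) has_derivative
        (\<lambda>v. f x * frechet_derivative g (at x) v + frechet_derivative f (at x) v * g x)) (at x)" for x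
      by (rule has_derivative_mult) (use Suc.prems C_k_Suc_imp_has_derivative in auto)
    show "C_k k (\<lambda>x. f x * frechet_derivative g (at x) v + frechet_derivative f (at x) v * g x)" for v
      using Suc C_k_Suc_imp_C_k by (intro C_k_add Suc.IH) (auto simp del: C_k.simps(2) dest: C_k_Suc_imp_C_k, auto)
  qed
qed (auto intro: continuous_on_mult)

lemma C_k_affine_compose:
  fixes f :: "'a::euclidean_space \<Rightarrow> 'b::real_normed_vector"
  shows "C_k k f \<Longrightarrow> C_k k (\<lambda>x. f (s *\<^sub>R (x - c)))"
proof (induction k arbitrary: f)
  case 0
  then show ?case by (auto intro!: continuous_intros continuous_on_compose2[of UNIV f])
next
  case (Suc k)
  show ?case
  proof (rule C_k_SucI)
    show "((\<lambda>x. f (s *\<^sub>R (x - c))) has_derivative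
        (\<lambda>v. s *\<^sub>R frechet_derivative f (at (s *\<^sub>R (x - c))) v)) (at x)" for x
    proof -
      note D = C_k_Suc_imp_has_derivative[OF Suc.prems, of "s *\<^sub>R (x - c)"]
      have "((\<lambda>x. s *\<^sub>R (x - c)) has_derivative (\<lambda>v. s *\<^sub>R v)) (at x)"
        by (auto intro!: derivative_eq_intros)
      from has_derivative_compose[OF this D] show ?thesis
        by (simp add: linear_cmul[OF has_derivative_linear[OF D]])
    qed
    show "C_k k (\<lambda>x. s *\<^sub>R frechet_derivative f (at (s *\<^sub>R (x - c))) v)" for v
      using Suc by (intro C_k_compose_bounded_linear[OF bounded_linear_scaleR_right] Suc.IH) auto
  qed
qed

section \<open>A smooth bump function\<close>

text \<open>The classical flat function e^(-1/x), divided by powers of x so that the family is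
  closed under differentiation up to linear combinations.\<close>

definition flat_exp :: "nat \<Rightarrow> real \<Rightarrow> real" where
  "flat_exp m x = (if x > 0 then exp (- 1 / x) / x ^ m else 0)"

lemma flat_exp_has_derivative:
  "(flat_exp m has_real_derivative (flat_exp (m + 2) x - m * flat_exp (m + 1) x)) (at x)"
proof -
  consider "x > 0" | "x < 0" | "x = 0" by linarith
  then show ?thesis
  proof cases
    case 1
    have "((\<lambda>x. exp (- 1 / x) / x ^ m) has_real_derivative
        (flat_exp (m + 2) x - m * flat_exp (m + 1) x)) (at x)"
      using 1 by (auto intro!: derivative_eq_intros simp: flat_exp_def divide_simps power2_eq_square)
                 (cases m; simp add: algebra_simps)
    then show ?thesis
      by (rule has_field_derivative_transform_within_open[where S = "{0<..}"])
         (use 1 in \<open>auto simp: flat_exp_def\<close>)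
  next
    case 2
    have "((\<lambda>x. 0) has_real_derivative (flat_exp (m + 2) x - m * flat_exp (m + 1) x)) (at x)"
      using 2 by (simp add: flat_exp_def)
    then show ?thesis
      by (rule has_field_derivative_transform_within_open[where S = "{..<0}"])
         (use 2 in \<open>auto simp: flat_exp_def\<close>)
  next
    case 3
    have "((\<lambda>h::real. exp (- 1 / h) / h ^ (m + 1)) \<longlongrightarrow> 0) (at_right 0)"
    proof -
      \<comment> \<open>The substitution u = 1/h turns flatness at 0 into the decay of u^(m+1) / e^u
        at infinity.\<close>
      have "((\<lambda>u::real. u ^ (m + 1) / exp u) \<longlongrightarrow> 0) at_top"
        by (rule tendsto_power_div_exp_0)
      then have "((\<lambda>h::real. inverse h ^ (m + 1) / exp (inverse h)) \<longlongrightarrow> 0) (at_right 0)"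
        by (rule filterlim_compose) (rule filterlim_inverse_at_top_right)
      then show ?thesis by (simp add: exp_minus divide_simps field_simps)
    qed
    then have "((\<lambda>h. flat_exp m h / h) \<longlongrightarrow> 0) (at_right 0)"
      by (rule Lim_transform_eventually) (auto simp: flat_exp_def eventually_at_filter field_simps)
    moreover have "((\<lambda>h. flat_exp m h / h) \<longlongrightarrow> 0) (at_left 0)"
      by (rule Lim_transform_eventually[OF tendsto_const])
         (auto simp: flat_exp_def eventually_at_filter)
    ultimately have "((\<lambda>h. flat_exp m h / h) \<longlongrightarrow> 0) (at 0)"
      by (simp add: filterlim_split_at)
    then show ?thesis
      using 3 by (simp add: DERIV_def flat_exp_def)
  qed
qed

text \<open>Induction on \<open>k\<close> with \<open>m\<close> arbitrary, because each derivative
  raises \<open>m\<close> by one or two.\<close>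

lemma C_k_flat_exp_compose:
  fixes q :: "'a::euclidean_space \<Rightarrow> real"
  assumes q: "\<And>x. (q has_derivative (\<lambda>v. q' v x)) (at x)" and q': "\<And>k v. C_k k (q' v)"
  shows "C_k k (\<lambda>x. flat_exp m (q x))"
proof (induction k arbitrary: m)
  case 0
  have "((\<lambda>x. flat_exp m (q x)) has_derivative
    (\<lambda>v. (flat_exp (m + 2) (q x) - m * flat_exp (m + 1) (q x)) * q' v x)) (at x)" for x
    using has_derivative_compose[OF q flat_exp_has_derivative[unfolded has_field_derivative_def]] by simp
  then show ?case
    by (auto intro!: continuous_at_imp_continuous_on has_derivative_continuous)
next
  case (Suc k)
  have D: "((\<lambda>x. flat_exp m (q x)) has_derivative
    (\<lambda>v. (flat_exp (m + 2) (q x) + (- m) * flat_exp (m + 1) (q x)) * q' v x)) (at x)" for x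
    using has_derivative_compose[OF q flat_exp_has_derivative[unfolded has_field_derivative_def]] by simp
  show ?case
    by (rule C_k_SucI[OF D]) (intro C_k_mult C_k_add C_k_const Suc q')
qed

lemma bump_function_exists:
  obtains b :: "'a::euclidean_space \<Rightarrow> real"
  where "\<And>k. C_k k b" "\<And>x. b x \<ge> 0" "\<And>x. norm x \<ge> 1 \<Longrightarrow> b x = 0" "integral\<^sup>L lborel b > 0"
proof
  \<comment> \<open>The polynomial \<open>1 - x \<bullet> x\<close> is smooth also at the origin,
    unlike the norm, and it is positive exactly on the open unit ball.\<close>
  let ?b = "\<lambda>x::'a. flat_exp 0 (1 - x \<bullet> x)"
  show C: "C_k k ?b" for k
  proof (rule C_k_flat_exp_compose[where q' = "\<lambda>v x. - 2 * (v \<bullet> x)"])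
    show "((\<lambda>x::'a. 1 - x \<bullet> x) has_derivative (\<lambda>v. - 2 * (v \<bullet> x))) (at x)" for x
      by (auto intro!: derivative_eq_intros simp: inner_commute)
    show "C_k k (\<lambda>x::'a. - 2 * (v \<bullet> x))" for k v
      by (intro C_k_bounded_linear bounded_linear_const_mult bounded_linear_inner_right)
  qed
  show nn: "?b x \<ge> 0" for x by (simp add: flat_exp_def)
  show supp: "?b x = 0" if "norm x \<ge> 1" for x
    using one_le_power[OF that, of 2] by (simp add: flat_exp_def dot_square_norm)
  have cont: "continuous_on S ?b" for S
    using C_k_imp_continuous_on[OF C[of 0]] .
  have int: "integrable lborel ?b"
  proof -
    have "integrable lborel (\<lambda>x. indicator (cball 0 1) x *\<^sub>R ?b x)"
      by (rule borel_integrable_compact) (use cont in auto)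
    moreover have "(\<lambda>x. indicator (cball 0 1) x *\<^sub>R ?b x) = ?b"
      using supp by (auto simp: indicator_def fun_eq_iff)
    ultimately show ?thesis by simp
  qed
  show "integral\<^sup>L lborel ?b > 0"
  proof -
    have pos: "integral\<^sup>L lborel ?b \<ge> 0" using nn by (intro integral_nonneg_AE) auto
    moreover have "integral\<^sup>L lborel ?b \<noteq> 0"
    proof
      \<comment> \<open>A vanishing integral would make the open unit ball, on which the bump is
        positive, a null set.\<close>
      assume "integral\<^sup>L lborel ?b = 0"
      then have "AE x in lborel. ?b x = 0"
        using integral_nonneg_eq_0_iff_AE[OF int] nn by auto
      then have "AE x::'a in lborel. x \<notin> ball 0 1"
        by (rule AE_mp) (auto simp: flat_exp_def dot_square_norm power_less_one_iff abs_square_less_1 intro!: AE_I2)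
      then have "emeasure lborel (ball 0 1 :: 'a set) = 0"
        by (subst (asm) AE_iff_measurable[of "ball 0 1"]) auto
      then show False
        using emeasure_lborel_ball_finite[of "0::'a" 1] content_ball_pos[of 1 "0::'a"]
        by (simp add: measure_def)
    qed
    ultimately show ?thesis by simp
  qed
qed

section \<open>Integration by parts against test functions\<close>

lemma integrable_continuous_compact_support:
  fixes f :: "'a::euclidean_space \<Rightarrow> 'b::{banach, second_countable_topology}"
  assumes "continuous_on UNIV f" "compact K" "\<And>x. x \<notin> K \<Longrightarrow> f x = 0"
  shows "integrable lborel f"
proof -
  have "integrable lborel (\<lambda>x. indicator K x *\<^sub>R f x)"
    by (rule borel_integrable_compact) (use assms in \<open>auto intro: continuous_on_subset\<close>)
  moreover have "(\<lambda>x. indicator K x *\<^sub>R f x) = f"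
    using assms by (auto simp: indicator_def fun_eq_iff)
  ultimately show ?thesis by simp
qed

lemma bounded_continuous_compact_support:
  fixes f :: "'a::euclidean_space \<Rightarrow> 'b::real_normed_vector"
  assumes "continuous_on UNIV f" "compact K" "\<And>x. x \<notin> K \<Longrightarrow> f x = 0"
  obtains B where "B > 0" "\<And>x. norm (f x) \<le> B"
proof -
  have "bounded (f ` K)"
    using assms by (intro compact_imp_bounded compact_continuous_image) (auto intro: continuous_on_subset)
  then obtain B where "B > 0" "\<And>x. x \<in> K \<Longrightarrow> norm (f x) \<le> B"
    unfolding bounded_pos by auto
  then show ?thesis
    using that[of B] assms(3) by (metis less_eq_real_def norm_zero)
qed

lemma frechet_derivative_eq_0_if_zero_on_open:
  assumes "open S" "x \<in> S" "\<And>y. y \<in> S \<Longrightarrow> f y = 0"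
  shows "frechet_derivative f (at x) v = 0"
proof -
  have "(f has_derivative (\<lambda>v. 0)) (at x)"
    by (rule has_derivative_transform_within_open[of "\<lambda>_. 0" _ _ _ S]) (use assms in auto)
  then show ?thesis using frechet_derivative_at by metis
qed

lemma frechet_derivative_eqI:
  "(f has_derivative f') (at x) \<Longrightarrow> frechet_derivative f (at x) v = f' v"
  by (metis frechet_derivative_at)

lemma has_derivative_along_line:
  assumes "(f has_derivative f') (at (x + s *\<^sub>R v))"
  shows "((\<lambda>s. f (x + s *\<^sub>R v)) has_vector_derivative f' v) (at s)"
proof -
  have "((\<lambda>s. x + s *\<^sub>R v) has_derivative (\<lambda>h. h *\<^sub>R v)) (at s)"
    by (auto intro!: derivative_eq_intros)
  from has_derivative_compose[OF this assms] show ?thesis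
    by (simp add: has_vector_derivative_def linear_cmul[OF has_derivative_linear[OF assms]])
qed

lemma has_vector_derivative_tendsto:
  assumes "(f has_vector_derivative D) (at (0::real))"
  shows "((\<lambda>h. (f h - f 0) /\<^sub>R h) \<longlongrightarrow> D) (at 0)"
proof -
  have "((\<lambda>h. norm (((f h - f 0) - h *\<^sub>R D) /\<^sub>R norm h)) \<longlongrightarrow> 0) (at 0)"
    using assms by (intro tendsto_norm_zero) (simp add: has_vector_derivative_def has_derivative_def)
  moreover have "norm (((f h - f 0) - h *\<^sub>R D) /\<^sub>R norm h) = norm ((f h - f 0) /\<^sub>R h - D)"
    if "h \<noteq> 0" for h
  proof -
    have "((f h - f 0) - h *\<^sub>R D) = h *\<^sub>R ((f h - f 0) /\<^sub>R h - D)"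
      using that by (simp add: scaleR_diff_right)
    then show ?thesis using that by (simp add: abs_mult)
  qed
  ultimately have "((\<lambda>h. norm ((f h - f 0) /\<^sub>R h - D)) \<longlongrightarrow> 0) (at 0)"
    by (elim Lim_transform_eventually) (auto simp: eventually_at_filter)
  then show ?thesis by (simp add: tendsto_norm_zero_iff LIM_zero_iff)
qed

lemma integral_lborel_translate:
  fixes f :: "'a::euclidean_space \<Rightarrow> 'b::{banach, second_countable_topology}"
  assumes "f \<in> borel_measurable borel"
  shows "(\<integral>x. f (x + c) \<partial>lborel) = (\<integral>x. f x \<partial>lborel)"
    and "integrable lborel f \<Longrightarrow> integrable lborel (\<lambda>x. f (x + c))"
proof -
  have "(\<integral>x. f x \<partial>lborel) = (\<integral>x. f x \<partial>distr lborel borel ((+) c))"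
    by (simp add: lborel_distr_plus)
  also have "\<dots> = (\<integral>x. f (x + c) \<partial>lborel)"
    using assms by (subst integral_distr) (auto simp: add.commute)
  finally show "(\<integral>x. f (x + c) \<partial>lborel) = (\<integral>x. f x \<partial>lborel)" by simp
  assume "integrable lborel f"
  then have "integrable (distr lborel borel ((+) c)) f" by (simp add: lborel_distr_plus)
  then show "integrable lborel (\<lambda>x. f (x + c))"
    using assms by (subst (asm) integrable_distr_eq) (auto simp: add.commute)
qed

text \<open>
  The integral of the difference quotients of \<open>f\<close> vanishes by translation invariance; they converge
  boundedly to the derivative.
\<close>

lemma integral_directional_derivative_eq_0:
  fixes f :: "'a::euclidean_space \<Rightarrow> complex"
  assumes f: "C_k (Suc 0) f" and K: "compact K" "\<And>x. x \<notin> K \<Longrightarrow> f x = 0"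
  shows "(\<integral>x. frechet_derivative f (at x) v \<partial>lborel) = 0"
proof -
  define D where "D x = frechet_derivative f (at x) v" for x
  have contD: "continuous_on UNIV D" and contf: "continuous_on UNIV f"
    using f C_k_imp_continuous_on[OF f] by (auto simp: D_def)
  have [measurable]: "D \<in> borel_measurable borel" "f \<in> borel_measurable borel"
    using contD contf by (auto intro: borel_measurable_continuous_onI)
  have derf: "(f has_derivative frechet_derivative f (at x)) (at x)" for x
    by (rule C_k_Suc_imp_has_derivative[OF f])
  have D0: "D x = 0" if "x \<notin> K" for x
    unfolding D_def by (rule frechet_derivative_eq_0_if_zero_on_open[of "- K"])
      (use that K compact_imp_closed in auto)
  obtain B where B: "B > 0" "\<And>x. norm (D x) \<le> B"
    using bounded_continuous_compact_support[OF contD K(1) D0] by metis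
  \<comment> \<open>The increments \<open>(1 / Suc n) *\<^sub>R v\<close> are no longer than
    \<open>v\<close>, so one compact set contains the supports of all difference quotients;
    \<open>B\<close> times its indicator is the dominating function.\<close>
  define K' where "K' = {x + y |x y. x \<in> K \<and> y \<in> cball 0 (norm v)}"
  have K': "compact K'" unfolding K'_def by (rule compact_sums) (use K in auto)
  define g where "g n x = (f (x + (1 / Suc n) *\<^sub>R v) - f x) /\<^sub>R (1 / Suc n)" for n x
  have int_f: "integrable lborel f"
    by (rule integrable_continuous_compact_support[OF contf K])
  have g0: "(\<integral>x. g n x \<partial>lborel) = 0" for n
    unfolding g_def using integral_lborel_translate[of f "(1 / Suc n) *\<^sub>R v"] int_f by simp
  have "(\<lambda>n. \<integral>x. g n x \<partial>lborel) \<longlonglongrightarrow> (\<integral>x. D x \<partial>lborel)"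
  proof (rule integral_dominated_convergence)
    show "integrable lborel (\<lambda>x. B * indicator K' x :: real)"
      using K' by (intro integrable_mult_right integrable_real_indicator) 
        (auto intro: borel_compact emeasure_compact_finite simp flip: infinity_ennreal_def)
    show "D \<in> borel_measurable lborel" "\<And>n. g n \<in> borel_measurable lborel"
      unfolding g_def by measurable
    show "AE x in lborel. (\<lambda>n. g n x) \<longlonglongrightarrow> D x"
    proof (rule AE_I2)
      fix x
      have "((\<lambda>s. f (x + s *\<^sub>R v)) has_vector_derivative D x) (at 0)"
        unfolding D_def by (rule has_derivative_along_line) (use derf in simp)
      from has_vector_derivative_tendsto[OF this]
      have "((\<lambda>h. (f (x + h *\<^sub>R v) - f x) /\<^sub>R h) \<longlongrightarrow> D x) (at 0)" by simp
      moreover have "filterlim (\<lambda>n. 1 / real (Suc n)) (at 0) sequentially"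
        using LIMSEQ_Suc[OF lim_1_over_n[where 'a=real]] by (auto simp: filterlim_at)
      ultimately show "(\<lambda>n. g n x) \<longlonglongrightarrow> D x"
        unfolding g_def by (rule filterlim_compose)
    qed
    show "AE x in lborel. norm (g n x) \<le> B * indicator K' x" for n
    proof (rule AE_I2)
      fix x
      show "norm (g n x) \<le> B * indicator K' x"
      proof (cases "x \<in> K'")
        case True
        \<comment> \<open>Mean value inequality on the segment: the difference quotients inherit the
          bound \<open>B\<close> of the derivative.\<close>
        have "norm (f (x + (1 / Suc n) *\<^sub>R v) - f (x + 0 *\<^sub>R v)) \<le> B * norm (1 / real (Suc n) - 0)"
        proof (rule differentiable_bound[OF convex_UNIV, where f = "\<lambda>s. f (x + s *\<^sub>R v)"])
          show "((\<lambda>s. f (x + s *\<^sub>R v)) has_derivative (\<lambda>h. h *\<^sub>R D (x + s *\<^sub>R v))) (at s within UNIV)" for s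
            using has_derivative_along_line[where f = f and x = x and s = s and v = v, OF derf]
            by (simp add: has_vector_derivative_def D_def)
          show "onorm (\<lambda>h. h *\<^sub>R D (x + s *\<^sub>R v)) \<le> B" for s
            by (rule onorm_le) (simp add: mult.commute[of B] mult_left_mono B)
        qed auto
        then have "real (Suc n) * norm (f (x + (1 / Suc n) *\<^sub>R v) - f x) \<le> B"
          by (simp add: pos_le_divide_eq mult.commute del: of_nat_Suc)
        then show ?thesis using True by (simp add: g_def del: of_nat_Suc)
      next
        case False
        have "x \<notin> K"
        proof
          assume "x \<in> K"
          then have "x + 0 \<in> K'" unfolding K'_def by fastforce
          then show False using False by simp
        qed
        moreover have "x + (1 / Suc n) *\<^sub>R v \<notin> K"
        proof
          assume *: "x + (1 / Suc n) *\<^sub>R v \<in> K"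
          have "norm (- (1 / Suc n) *\<^sub>R v) \<le> norm v"
            by (simp add: divide_le_eq mult_le_cancel_left1 mult_left_le_one_le)
          then have "(x + (1 / Suc n) *\<^sub>R v) + (- (1 / Suc n) *\<^sub>R v) \<in> K'"
            unfolding K'_def using *
            by (intro CollectI exI[of _ "x + (1 / Suc n) *\<^sub>R v"] exI[of _ "- (1 / Suc n) *\<^sub>R v"] conjI refl) auto
          then show False using False by simp
        qed
        ultimately show ?thesis using K False by (simp add: g_def)
      qed
    qed
  qed
  then have "(\<integral>x. D x \<partial>lborel) = 0" using g0 by (simp add: LIMSEQ_const_iff)
  then show ?thesis by (simp add: D_def)
qed

lemma test_functionE:
  assumes "test_function \<phi>"
  obtains K where "compact K" "\<And>x. x \<notin> K \<Longrightarrow> \<phi> x = 0"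
proof
  show "compact (closure {x. \<phi> x \<noteq> 0})" using assms by (simp add: test_function_def)
  show "\<phi> x = 0" if "x \<notin> closure {x. \<phi> x \<noteq> 0}" for x
  proof (rule ccontr)
    assume "\<phi> x \<noteq> 0"
    then have "x \<in> closure {x. \<phi> x \<noteq> 0}" by (intro subsetD[OF closure_subset]) simp
    with that show False by contradiction
  qed
qed

lemma test_functionD:
  assumes "test_function \<phi>"
  shows "C_k k \<phi>" "continuous_on UNIV \<phi>" "(\<phi> has_derivative frechet_derivative \<phi> (at x)) (at x)"
    "integrable lborel \<phi>" "\<phi> \<in> borel_measurable borel"
proof -
  show C: "C_k k \<phi>" for k using assms by (simp add: test_function_def C_infinity_def)
  show c: "continuous_on UNIV \<phi>" by (rule C_k_imp_continuous_on[OF C[of 0]])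
  show "(\<phi> has_derivative frechet_derivative \<phi> (at x)) (at x)"
    by (rule C_k_Suc_imp_has_derivative[OF C])
  obtain K where "compact K" "\<And>x. x \<notin> K \<Longrightarrow> \<phi> x = 0" using test_functionE[OF assms] by metis
  then show "integrable lborel \<phi>"
    by (rule integrable_continuous_compact_support[OF c])
  show "\<phi> \<in> borel_measurable borel" using c by (rule borel_measurable_continuous_onI)
qed

lemma test_functionI:
  assumes "\<And>k. C_k k \<phi>" "compact K" "\<And>x. x \<notin> K \<Longrightarrow> \<phi> x = 0"
  shows "test_function \<phi>"
proof -
  have "bounded {x. \<phi> x \<noteq> 0}"
    using assms by (intro bounded_subset[OF compact_imp_bounded[OF assms(2)]]) auto
  then show ?thesis
    using assms(1) by (auto simp: test_function_def C_infinity_def)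
qed

lemma test_function_frechet_derivative:
  assumes "test_function \<phi>"
  shows "test_function (\<lambda>x. frechet_derivative \<phi> (at x) v)"
proof -
  obtain K where K: "compact K" "\<And>x. x \<notin> K \<Longrightarrow> \<phi> x = 0" using test_functionE[OF assms] by metis
  show ?thesis
  proof (rule test_functionI[OF _ K(1)])
    show "C_k k (\<lambda>x. frechet_derivative \<phi> (at x) v)" for k
      using test_functionD(1)[OF assms, of "Suc k"] by simp
    show "frechet_derivative \<phi> (at x) v = 0" if "x \<notin> K" for x
      by (rule frechet_derivative_eq_0_if_zero_on_open[of "- K"])
         (use that K compact_imp_closed in auto)
  qed
qed

lemma integrable_continuous_times_test_function:
  fixes f \<phi> :: "'a::euclidean_space \<Rightarrow> complex"
  assumes "continuous_on UNIV f" "test_function \<phi>"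
  shows "integrable lborel (\<lambda>x. f x * \<phi> x)"
proof -
  obtain K where K: "compact K" "\<And>x. x \<notin> K \<Longrightarrow> \<phi> x = 0" using test_functionE[OF assms(2)] by metis
  show ?thesis
    by (rule integrable_continuous_compact_support[OF continuous_on_mult[OF assms(1) test_functionD(2)[OF assms(2)]] K(1)])
       (simp add: K(2))
qed

text \<open>Only the product has to be compactly supported. So \<open>f\<close> may be a plane wave,
  a packet, or a supposed C^1 representative of the solution.\<close>

lemma integral_by_parts_test_function:
  fixes f \<phi> :: "'a::euclidean_space \<Rightarrow> complex"
  assumes f: "C_k (Suc 0) f" and \<phi>: "test_function \<phi>"
  shows "(\<integral>x. f x * frechet_derivative \<phi> (at x) v \<partial>lborel) =
    - (\<integral>x. frechet_derivative f (at x) v * \<phi> x \<partial>lborel)"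
proof -
  obtain K where K: "compact K" "\<And>x. x \<notin> K \<Longrightarrow> \<phi> x = 0" using test_functionE[OF \<phi>] by metis
  have D: "frechet_derivative (\<lambda>x. f x * \<phi> x) (at x) v =
      f x * frechet_derivative \<phi> (at x) v + frechet_derivative f (at x) v * \<phi> x" for x
    by (rule frechet_derivative_eqI[OF has_derivative_mult[OF C_k_Suc_imp_has_derivative[OF f]
          test_functionD(3)[OF \<phi>]]])
  have "(\<integral>x. frechet_derivative (\<lambda>x. f x * \<phi> x) (at x) v \<partial>lborel) = 0"
    by (rule integral_directional_derivative_eq_0[OF C_k_mult[OF f test_functionD(1)[OF \<phi>]] K(1)])
       (simp add: K(2))
  moreover have "integrable lborel (\<lambda>x. f x * frechet_derivative \<phi> (at x) v)"
    by (rule integrable_continuous_times_test_function[OF C_k_imp_continuous_on[OF f]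
          test_function_frechet_derivative[OF \<phi>]])
  moreover have "integrable lborel (\<lambda>x. frechet_derivative f (at x) v * \<phi> x)"
    using f by (intro integrable_continuous_times_test_function \<phi>) simp
  ultimately show ?thesis unfolding D by (simp add: eq_neg_iff_add_eq_0)
qed

section \<open>The Fourier transform of a test function is integrable\<close>

lemma cis_has_derivative:
  fixes \<zeta> :: "'a::euclidean_space"
  shows "((\<lambda>x. cis (x \<bullet> \<zeta>)) has_derivative (\<lambda>v. \<i> * (v \<bullet> \<zeta>) * cis (x \<bullet> \<zeta>))) (at x)"
proof -
  have eq: "cis = iexp" by (simp add: fun_eq_iff cis_conv_exp)
  have "(cis has_vector_derivative (\<i> * cis s)) (at s)" for s
    unfolding eq by (rule has_vector_derivative_iexp)
  then have 1: "(cis has_derivative (\<lambda>h. h *\<^sub>R (\<i> * cis s))) (at s)" for s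
    by (simp add: has_vector_derivative_def)
  have 2: "((\<lambda>x. x \<bullet> \<zeta>) has_derivative (\<lambda>v. v \<bullet> \<zeta>)) (at x)"
    by (auto intro!: derivative_eq_intros)
  from has_derivative_compose[OF 2 1] show ?thesis
    by (simp add: scaleR_conv_of_real mult.assoc mult.left_commute)
qed

lemma C_k_cis: "C_k k (\<lambda>x. cis (x \<bullet> \<zeta>))"
proof -
  \<comment> \<open>The constant is carried along because every derivative multiplies it by i (v .
    \<zeta>).\<close>
  have "C_k k (\<lambda>x. c * cis (x \<bullet> \<zeta>))" for c
  proof (induction k arbitrary: c)
    case 0
    then show ?case by (auto intro!: continuous_intros)
  next
    case (Suc k)
    show ?case
    proof (rule C_k_SucI)
      show "((\<lambda>x. c * cis (x \<bullet> \<zeta>)) has_derivative (\<lambda>v. (c * (\<i> * (v \<bullet> \<zeta>))) * cis (x \<bullet> \<zeta>))) (at x)" for x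
        using has_derivative_mult_right[OF cis_has_derivative[of \<zeta> x], of c] by (simp add: mult_ac)
    qed (rule Suc)
  qed
  from this[of 1] show ?thesis by simp
qed

lemma fourier_frechet_derivative:
  assumes "test_function \<phi>"
  shows "(\<integral>x. cis (x \<bullet> \<zeta>) * frechet_derivative \<phi> (at x) v \<partial>lborel) =
    - (\<i> * (v \<bullet> \<zeta>)) * (\<integral>x. cis (x \<bullet> \<zeta>) * \<phi> x \<partial>lborel)"
proof -
  have "frechet_derivative (\<lambda>x. cis (x \<bullet> \<zeta>)) (at x) v = \<i> * (v \<bullet> \<zeta>) * cis (x \<bullet> \<zeta>)" for x
    by (rule frechet_derivative_eqI[OF cis_has_derivative])
  then show ?thesis
    using integral_by_parts_test_function[OF C_k_cis assms] by (simp add: mult.assoc)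
qed

text \<open>The witness is \<open>\<phi>\<close> minus its second derivative in direction
  \<open>v\<close>: two integrations by parts turn that derivative into the factor -(v . \<zeta>)^2.
  Used once per coordinate direction, this yields the decay of the transform.\<close>

lemma fourier_one_plus_square:
  fixes \<phi> :: "'a::euclidean_space \<Rightarrow> complex"
  assumes "test_function \<phi>"
  obtains \<psi> where "test_function \<psi>"
    "\<And>\<zeta>. inverse_fourier \<psi> \<zeta> = complex_of_real (1 + (v \<bullet> \<zeta>)\<^sup>2) * inverse_fourier \<phi> \<zeta>"
proof
  let ?D = "\<lambda>\<phi> x. frechet_derivative \<phi> (at x) v"
  have T: "test_function (?D \<phi>)" "test_function (?D (?D \<phi>))"
    using test_function_frechet_derivative[OF assms]
      test_function_frechet_derivative[OF test_function_frechet_derivative[OF assms]] by auto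
  obtain K1 where K1: "compact K1" "\<And>x. x \<notin> K1 \<Longrightarrow> \<phi> x = 0"
    using test_functionE[OF assms] by metis
  obtain K2 where K2: "compact K2" "\<And>x. x \<notin> K2 \<Longrightarrow> ?D (?D \<phi>) x = 0"
    using test_functionE[OF T(2)] by metis
  show "test_function (\<lambda>x. \<phi> x + (- 1) * ?D (?D \<phi>) x)"
  proof (rule test_functionI[OF _ compact_Un[OF K1(1) K2(1)]])
    show "C_k k (\<lambda>x. \<phi> x + (- 1) * ?D (?D \<phi>) x)" for k
      by (rule C_k_add[OF test_functionD(1)[OF assms] C_k_mult[OF C_k_const test_functionD(1)[OF T(2)]]])
    show "\<phi> x + (- 1) * ?D (?D \<phi>) x = 0" if "x \<notin> K1 \<union> K2" for x
      using that K1(2) K2(2) by simp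
  qed
  fix \<zeta> :: 'a
  have "continuous_on UNIV (\<lambda>x. cis (x \<bullet> \<zeta>))" by (rule C_k_imp_continuous_on[OF C_k_cis[where k = 0]])
  then have I: "integrable lborel (\<lambda>x. cis (x \<bullet> \<zeta>) * \<phi> x)" "integrable lborel (\<lambda>x. cis (x \<bullet> \<zeta>) * ?D (?D \<phi>) x)"
    using integrable_continuous_times_test_function[OF _ assms] integrable_continuous_times_test_function[OF _ T(2)]
    by blast+
  have "(\<integral>x. cis (x \<bullet> \<zeta>) * (\<phi> x + (- 1) * ?D (?D \<phi>) x) \<partial>lborel) =
      complex_of_real (1 + (v \<bullet> \<zeta>)\<^sup>2) * (\<integral>x. cis (x \<bullet> \<zeta>) * \<phi> x \<partial>lborel)"
    using I by (simp add: fourier_frechet_derivative[OF T(1)] fourier_frechet_derivative[OF assms]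
        ring_distribs power2_eq_square Bochner_Integration.integral_diff) (simp add: algebra_simps)
  then show "inverse_fourier (\<lambda>x. \<phi> x + (- 1) * ?D (?D \<phi>) x) \<zeta> =
      complex_of_real (1 + (v \<bullet> \<zeta>)\<^sup>2) * inverse_fourier \<phi> \<zeta>"
    by (simp only: inverse_fourier_def inner_commute[of \<zeta>] mult.left_commute)
qed

lemma norm_integral_cis_le:
  "norm (\<integral>x. cis (h x) * f x \<partial>M) \<le> (\<integral>x. norm (f x) \<partial>M)"
  using integral_norm_bound[of M "\<lambda>x. cis (h x) * f x"] by (simp add: norm_mult)

lemma lborel_integral_prod2:
  fixes f :: "'a::euclidean_space \<Rightarrow> 'c::{real_normed_field, banach, second_countable_topology}"
    and g :: "'b::euclidean_space \<Rightarrow> 'c"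
  assumes f: "integrable lborel f" and g: "integrable lborel g"
  shows "integrable lborel (\<lambda>p. f (fst p) * g (snd p))"
    and "(\<integral>p. f (fst p) * g (snd p) \<partial>lborel) = integral\<^sup>L lborel f * integral\<^sup>L lborel g"
proof -
  have [measurable]: "f \<in> borel_measurable borel" "g \<in> borel_measurable borel"
    using assms by (auto dest: borel_measurable_integrable)
  have I: "integrable (lborel \<Otimes>\<^sub>M lborel) (\<lambda>(x, y). f x * g y)"
    by (rule lborel_pair.Fubini_integrable) (use assms in \<open>auto simp: norm_mult\<close>)
  with lborel_pair.integral_fst[OF I]
  show "integrable lborel (\<lambda>p. f (fst p) * g (snd p))"
    "(\<integral>p. f (fst p) * g (snd p) \<partial>lborel) = integral\<^sup>L lborel f * integral\<^sup>L lborel g"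
    by (simp_all add: lborel_prod case_prod_unfold)
qed

lemma lborel_integral_prod3:
  fixes f g h :: "real \<Rightarrow> 'b::{real_normed_field, banach, second_countable_topology}"
  assumes f: "integrable lborel f" and g: "integrable lborel g" and h: "integrable lborel h"
  shows "integrable lborel (\<lambda>(x, y, z). f x * (g y * h z))"
    and "(\<integral>(x, y, z). f x * (g y * h z) \<partial>lborel) =
      integral\<^sup>L lborel f * (integral\<^sup>L lborel g * integral\<^sup>L lborel h)"
  using lborel_integral_prod2[OF f lborel_integral_prod2(1)[OF g h]] lborel_integral_prod2(2)[OF g h]
  by (simp_all add: case_prod_unfold)

lemma integrable_inverse_one_plus_square: "integrable lborel (\<lambda>x::real. 1 / (1 + x\<^sup>2))"
proof -
  have "set_integrable lborel (einterval 0 \<infinity>) (\<lambda>x::real. 1 / (1 + x\<^sup>2))"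
    using integrable_I0i_1_div_plus_square by (simp add: interval_lebesgue_integrable_def)
  then have 1: "integrable lborel (\<lambda>x::real. indicator {0<..} x * (1 / (1 + x\<^sup>2)))"
    by (simp add: set_integrable_def einterval_eq(3) zero_ereal_def)
  then have 2: "integrable lborel (\<lambda>x::real. indicator {0<..} (- x) * (1 / (1 + x\<^sup>2)))"
    using lborel_integrable_real_affine[OF 1, of "-1" 0] by simp
  have "AE x in lborel. x \<noteq> (0::real)"
    by (rule AE_lborel_singleton)
  then have AE: "AE x::real in lborel. indicator {0<..} x * (1 / (1 + x\<^sup>2)) + indicator {0<..} (- x) * (1 / (1 + x\<^sup>2)) = 1 / (1 + x\<^sup>2)"
    by eventually_elim (auto simp: indicator_def)
  show ?thesis
    by (rule integrable_cong_AE_imp[OF Bochner_Integration.integrable_add[OF 1 2] _ AE]) simp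
qed

lemma norm_inverse_fourier_le:
  fixes \<phi> :: "'a::euclidean_space \<Rightarrow> complex"
  shows "norm (inverse_fourier \<phi> \<zeta>) \<le> (\<integral>x. norm (\<phi> x) \<partial>lborel)"
proof -
  have "1 / (2 * pi) ^ DIM('a) \<le> 1"
    using pi_gt3 one_le_power[of "2 * pi" "DIM('a)"] by (simp add: divide_le_eq)
  then have "norm (inverse_fourier \<phi> \<zeta>) \<le> norm (\<integral>x. cis (\<zeta> \<bullet> x) * \<phi> x \<partial>lborel)"
    unfolding inverse_fourier_def norm_mult norm_of_real by (intro mult_left_le_one_le) auto
  also have "\<dots> \<le> (\<integral>x. norm (\<phi> x) \<partial>lborel)" by (rule norm_integral_cis_le)
  finally show ?thesis .
qed

text \<open>The transform times (1 + a^2) (1 + b^2) (1 + c^2) is again the transform of a test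
  function, hence bounded by an L^1 norm, and the reciprocal of this weight is a product of three
  integrable functions. Integrability is what Fubini needs on the test function side of the
  duality.\<close>

lemma integrable_inverse_fourier_test_function:
  fixes \<phi> :: "R3 \<Rightarrow> complex"
  assumes "test_function \<phi>"
  shows "integrable lborel (inverse_fourier \<phi>)"
proof -
  obtain \<psi>1 :: "R3 \<Rightarrow> complex" where 1: "test_function \<psi>1"
    "\<And>\<zeta>. inverse_fourier \<psi>1 \<zeta> = complex_of_real (1 + ((1, 0, 0) \<bullet> \<zeta>)\<^sup>2) * inverse_fourier \<phi> \<zeta>"
    using fourier_one_plus_square[OF assms, where v = "(1, 0, 0)"] by metis
  obtain \<psi>2 :: "R3 \<Rightarrow> complex" where 2: "test_function \<psi>2"
    "\<And>\<zeta>. inverse_fourier \<psi>2 \<zeta> = complex_of_real (1 + ((0, 1, 0) \<bullet> \<zeta>)\<^sup>2) * inverse_fourier \<psi>1 \<zeta>"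
    using fourier_one_plus_square[OF 1(1), where v = "(0, 1, 0)"] by metis
  obtain \<psi>3 :: "R3 \<Rightarrow> complex" where 3: "test_function \<psi>3"
    "\<And>\<zeta>. inverse_fourier \<psi>3 \<zeta> = complex_of_real (1 + ((0, 0, 1) \<bullet> \<zeta>)\<^sup>2) * inverse_fourier \<psi>2 \<zeta>"
    using fourier_one_plus_square[OF 2(1), where v = "(0, 0, 1)"] by metis
  define C where "C = (\<integral>x. norm (\<psi>3 x) \<partial>lborel)"
  have bound: "norm (inverse_fourier \<phi> (a, b, c)) \<le> C * (1 / (1 + a\<^sup>2) * (1 / (1 + b\<^sup>2) * (1 / (1 + c\<^sup>2))))"
    (is "norm ?F \<le> _") for a b c
  proof -
    have pos: "(1 + c\<^sup>2) * ((1 + b\<^sup>2) * (1 + a\<^sup>2)) > 0"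
      by (intro mult_pos_pos) (auto intro: add_pos_nonneg)
    have "inverse_fourier \<psi>3 (a, b, c) = complex_of_real ((1 + c\<^sup>2) * ((1 + b\<^sup>2) * (1 + a\<^sup>2))) * ?F"
      by (simp add: 1(2) 2(2) 3(2) mult.assoc)
    then have "norm (complex_of_real ((1 + c\<^sup>2) * ((1 + b\<^sup>2) * (1 + a\<^sup>2))) * ?F) \<le> C"
      using norm_inverse_fourier_le[of \<psi>3 "(a, b, c)"] by (simp add: C_def)
    then have "(1 + c\<^sup>2) * ((1 + b\<^sup>2) * (1 + a\<^sup>2)) * norm ?F \<le> C"
      unfolding norm_mult norm_of_real using pos by simp
    then have "norm ?F \<le> C / ((1 + c\<^sup>2) * ((1 + b\<^sup>2) * (1 + a\<^sup>2)))"
      using pos by (simp only: pos_le_divide_eq mult.commute[of "norm _"])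
    then show ?thesis by (simp add: mult_ac)
  qed
  have "integrable lborel (\<lambda>(a, b, c). 1 / (1 + a\<^sup>2) * (1 / (1 + b\<^sup>2) * (1 / (1 + c\<^sup>2))) :: real)"
    by (rule lborel_integral_prod3(1)[OF integrable_inverse_one_plus_square integrable_inverse_one_plus_square
          integrable_inverse_one_plus_square])
  from integrable_mult_right[OF this, of C]
  have I: "integrable lborel (\<lambda>(a, b, c). C * (1 / (1 + a\<^sup>2) * (1 / (1 + b\<^sup>2) * (1 / (1 + c\<^sup>2)))))"
    by (simp add: case_prod_unfold)
  have [measurable]: "\<phi> \<in> borel_measurable borel" "\<phi> \<in> borel_measurable lborel"
    using test_functionD(5)[OF assms] by auto
  have [measurable]: "cis \<in> borel_measurable borel"
    by (intro borel_measurable_continuous_onI continuous_intros)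
  have "inverse_fourier \<phi> \<in> borel_measurable lborel"
    unfolding inverse_fourier_def by measurable
  with I show ?thesis
  proof (rule Bochner_Integration.integrable_bound)
    show "AE \<zeta> in lborel. norm (inverse_fourier \<phi> \<zeta>)
        \<le> norm (case \<zeta> of (a, b, c) \<Rightarrow> C * (1 / (1 + a\<^sup>2) * (1 / (1 + b\<^sup>2) * (1 / (1 + c\<^sup>2)))))"
    proof (rule AE_I2)
      fix \<zeta> :: R3
      obtain a b c where "\<zeta> = (a, b, c)" by (cases \<zeta>) auto
      then show "norm (inverse_fourier \<phi> \<zeta>)
        \<le> norm (case \<zeta> of (a, b, c) \<Rightarrow> C * (1 / (1 + a\<^sup>2) * (1 / (1 + b\<^sup>2) * (1 / (1 + c\<^sup>2)))))"
        using order_trans[OF bound abs_ge_self] by simp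
    qed
  qed
qed

section \<open>Oscillatory integrals\<close>

lemma borel_measurable_cis [measurable]: "cis \<in> borel_measurable borel"
  by (intro borel_measurable_continuous_onI continuous_intros)

text \<open>What the derivatives in the directions \<open>vs\<close> bring down from the plane wave
  \<open>cis (p \<bullet> \<zeta>)\<close>.\<close>

definition freq_factor :: "'a list \<Rightarrow> 'a::real_inner \<Rightarrow> complex" where
  "freq_factor vs \<zeta> = (\<Prod>v\<leftarrow>vs. \<i> * of_real (v \<bullet> \<zeta>))"

lemma freq_factor_Nil [simp]: "freq_factor [] \<zeta> = 1"
  and freq_factor_Cons [simp]: "freq_factor (v # vs) \<zeta> = \<i> * of_real (v \<bullet> \<zeta>) * freq_factor vs \<zeta>"
  by (simp_all add: freq_factor_def)

lemma norm_freq_factor_le: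
  "norm (freq_factor vs \<zeta>) \<le> norm \<zeta> ^ length vs * (\<Prod>v\<leftarrow>vs. norm v)"
proof (induction vs)
  case (Cons v vs)
  have "norm (freq_factor (v # vs) \<zeta>) = \<bar>v \<bullet> \<zeta>\<bar> * norm (freq_factor vs \<zeta>)"
    by (simp add: norm_mult)
  also have "\<dots> \<le> (norm v * norm \<zeta>) * (norm \<zeta> ^ length vs * (\<Prod>v\<leftarrow>vs. norm v))"
    by (intro mult_mono Cons.IH Cauchy_Schwarz_ineq2) auto
  finally show ?case by (simp add: mult_ac)
qed simp

lemma borel_measurable_freq_factor [measurable]:
  "freq_factor vs \<in> borel_measurable (borel :: 'a::euclidean_space measure)"
  by (induction vs) (auto simp: fun_eq_iff[symmetric])

text \<open>A superposition of plane waves, already differentiated in the directions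
  \<open>vs\<close>; one more derivative just prepends a direction, which is the shape that
  \<open>C_k_if_derivative_family\<close> consumes. The integration variable is kept apart from the
  frequency \<open>Z \<omega>\<close> so that packets can be integrated in rescaled
  variables.\<close>

definition osc_integral ::
    "'w measure \<Rightarrow> ('w \<Rightarrow> 'a::euclidean_space) \<Rightarrow> ('w \<Rightarrow> complex) \<Rightarrow> 'a list \<Rightarrow> 'a \<Rightarrow> complex" where
  "osc_integral M Z w vs p = (\<integral>\<omega>. cis (p \<bullet> Z \<omega>) * freq_factor vs (Z \<omega>) * w \<omega> \<partial>M)"

lemma norm_cis_minus_linear_le: "norm (cis \<theta> - 1 - \<i> * of_real \<theta>) \<le> \<theta>\<^sup>2"
proof -
  have "norm (cis \<theta> - (\<Sum>k\<le>1. (\<i> * complex_of_real \<theta>)^k / fact k)) \<le> \<bar>\<theta>\<bar>^(Suc 1) / fact (Suc 1)"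
    using iexp_approx1[of \<theta> 1] by (simp add: cis_conv_exp)
  also have "\<dots> \<le> \<theta>\<^sup>2" by (simp add: fact_numeral power2_eq_square)
  finally show ?thesis by (simp add: algebra_simps)
qed

context
  fixes M :: "'w measure" and Z :: "'w \<Rightarrow> 'a::euclidean_space" and w :: "'w \<Rightarrow> complex"
  assumes Z [measurable]: "Z \<in> borel_measurable M" and w [measurable]: "w \<in> borel_measurable M"
    and moments: "\<And>k. integrable M (\<lambda>\<omega>. norm (Z \<omega>) ^ k * norm (w \<omega>))"
begin

lemma integrable_osc: 
  "integrable M (\<lambda>\<omega>. cis (p \<bullet> Z \<omega>) * freq_factor vs (Z \<omega>) * w \<omega>)"
proof (rule Bochner_Integration.integrable_bound)
  show "integrable M (\<lambda>\<omega>. (\<Prod>v\<leftarrow>vs. norm v) * (norm (Z \<omega>) ^ length vs * norm (w \<omega>)))"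
    by (intro integrable_mult_right moments)
  have nn: "0 \<le> (\<Prod>v\<leftarrow>vs. norm v)" by (induction vs) auto
  show "AE \<omega> in M. norm (cis (p \<bullet> Z \<omega>) * freq_factor vs (Z \<omega>) * w \<omega>)
      \<le> norm ((\<Prod>v\<leftarrow>vs. norm v) * (norm (Z \<omega>) ^ length vs * norm (w \<omega>)))"
  proof (rule AE_I2)
    fix \<omega>
    have "norm (freq_factor vs (Z \<omega>)) * norm (w \<omega>) \<le> (norm (Z \<omega>) ^ length vs * (\<Prod>v\<leftarrow>vs. norm v)) * norm (w \<omega>)"
      by (intro mult_right_mono norm_freq_factor_le) auto
    then show "norm (cis (p \<bullet> Z \<omega>) * freq_factor vs (Z \<omega>) * w \<omega>)
      \<le> norm ((\<Prod>v\<leftarrow>vs. norm v) * (norm (Z \<omega>) ^ length vs * norm (w \<omega>)))"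
      using nn by (simp add: norm_mult mult_ac)
  qed
qed measurable

text \<open>Taylor remainder under the integral: since |e^(i \<theta>) - 1 - i \<theta>| \<le>
  \<theta>^2, the error of linearization is at most |h|^2 times the second moment
  \<open>C 2\<close>. The first moment \<open>C 1\<close> bounds the derivative as an
  operator.\<close>

lemma osc_integral_has_derivative:
  "(osc_integral M Z w vs has_derivative (\<lambda>h. osc_integral M Z w (h # vs) p)) (at p)"
proof -
  define C where "C k = (\<integral>\<omega>. norm (Z \<omega>) ^ k * norm (freq_factor vs (Z \<omega>)) * norm (w \<omega>) \<partial>M)" for k
  have I: "integrable M (\<lambda>\<omega>. norm (Z \<omega>) ^ k * norm (freq_factor vs (Z \<omega>)) * norm (w \<omega>))" for k
  proof (rule Bochner_Integration.integrable_bound)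
    show "integrable M (\<lambda>\<omega>. (\<Prod>v\<leftarrow>vs. norm v) * (norm (Z \<omega>) ^ (k + length vs) * norm (w \<omega>)))"
      by (intro integrable_mult_right moments)
    have nn: "0 \<le> (\<Prod>v\<leftarrow>vs. norm v)" by (induction vs) auto
    show "AE \<omega> in M. norm (norm (Z \<omega>) ^ k * norm (freq_factor vs (Z \<omega>)) * norm (w \<omega>))
        \<le> norm ((\<Prod>v\<leftarrow>vs. norm v) * (norm (Z \<omega>) ^ (k + length vs) * norm (w \<omega>)))"
    proof (rule AE_I2)
      fix \<omega>
      have "norm (Z \<omega>) ^ k * norm (freq_factor vs (Z \<omega>)) * norm (w \<omega>) \<le>
          norm (Z \<omega>) ^ k * (norm (Z \<omega>) ^ length vs * (\<Prod>v\<leftarrow>vs. norm v)) * norm (w \<omega>)"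
        by (intro mult_right_mono mult_left_mono norm_freq_factor_le) auto
      then show "norm (norm (Z \<omega>) ^ k * norm (freq_factor vs (Z \<omega>)) * norm (w \<omega>))
        \<le> norm ((\<Prod>v\<leftarrow>vs. norm v) * (norm (Z \<omega>) ^ (k + length vs) * norm (w \<omega>)))"
        using nn by (simp add: norm_mult mult_ac power_add)
    qed
  qed measurable
  have bl: "bounded_linear (\<lambda>h. osc_integral M Z w (h # vs) p)"
  proof (rule bounded_linear_intro[where K = "C 1"])
    show "osc_integral M Z w ((x + y) # vs) p = osc_integral M Z w (x # vs) p + osc_integral M Z w (y # vs) p" for x y
      unfolding osc_integral_def
      by (subst Bochner_Integration.integral_add[symmetric])
         (use integrable_osc[of p "x # vs"] integrable_osc[of p "y # vs"] in \<open>auto simp: algebra_simps inner_add_left\<close>)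
    show "osc_integral M Z w ((r *\<^sub>R x) # vs) p = r *\<^sub>R osc_integral M Z w (x # vs) p" for r x
      unfolding osc_integral_def
      by (subst integral_scaleR_right[symmetric]) (auto simp: scaleR_conv_of_real mult_ac)
    show "norm (osc_integral M Z w (x # vs) p) \<le> norm x * C 1" for x
    proof -
      have "norm (osc_integral M Z w (x # vs) p) \<le>
          (\<integral>\<omega>. norm x * (norm (Z \<omega>) ^ 1 * norm (freq_factor vs (Z \<omega>)) * norm (w \<omega>)) \<partial>M)"
        unfolding osc_integral_def
      proof (rule order_trans[OF integral_norm_bound integral_mono])
        show "integrable M (\<lambda>\<omega>. norm (cis (p \<bullet> Z \<omega>) * freq_factor (x # vs) (Z \<omega>) * w \<omega>))"
          by (rule integrable_norm[OF integrable_osc])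
        show "integrable M (\<lambda>\<omega>. norm x * (norm (Z \<omega>) ^ 1 * norm (freq_factor vs (Z \<omega>)) * norm (w \<omega>)))"
          by (intro integrable_mult_right I)
        fix \<omega>
        have "\<bar>x \<bullet> Z \<omega>\<bar> * (norm (freq_factor vs (Z \<omega>)) * norm (w \<omega>)) \<le>
            (norm x * norm (Z \<omega>)) * (norm (freq_factor vs (Z \<omega>)) * norm (w \<omega>))"
          by (intro mult_right_mono Cauchy_Schwarz_ineq2) auto
        then show "norm (cis (p \<bullet> Z \<omega>) * freq_factor (x # vs) (Z \<omega>) * w \<omega>) \<le>
            norm x * (norm (Z \<omega>) ^ 1 * norm (freq_factor vs (Z \<omega>)) * norm (w \<omega>))"
          by (simp add: norm_mult mult_ac)
      qed
      then show ?thesis by (simp add: C_def)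
    qed
  qed
  show ?thesis
  proof (rule has_derivativeI_sandwich[where e = 1 and H = "\<lambda>q. C 2 * norm (q - p)"])
    show "((\<lambda>q. C 2 * norm (q - p)) \<longlongrightarrow> 0) (at p)"
      by (auto intro!: tendsto_eq_intros)
    fix q :: 'a assume "q \<noteq> p"
    define h where "h = q - p"
    have "osc_integral M Z w vs q - osc_integral M Z w vs p - osc_integral M Z w (h # vs) p =
        (\<integral>\<omega>. cis (p \<bullet> Z \<omega>) * (cis (h \<bullet> Z \<omega>) - 1 - \<i> * of_real (h \<bullet> Z \<omega>)) * freq_factor vs (Z \<omega>) * w \<omega> \<partial>M)"
    proof -
      have "q = p + h" by (simp add: h_def)
      then have "cis (q \<bullet> Z \<omega>) * freq_factor vs (Z \<omega>) * w \<omega> - cis (p \<bullet> Z \<omega>) * freq_factor vs (Z \<omega>) * w \<omega> 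
          - cis (p \<bullet> Z \<omega>) * freq_factor (h # vs) (Z \<omega>) * w \<omega> =
          cis (p \<bullet> Z \<omega>) * (cis (h \<bullet> Z \<omega>) - 1 - \<i> * of_real (h \<bullet> Z \<omega>)) * freq_factor vs (Z \<omega>) * w \<omega>" for \<omega>
        by (simp add: inner_add_left cis_mult[symmetric] algebra_simps)
      then show ?thesis
        unfolding osc_integral_def
        by (simp only: Bochner_Integration.integral_diff[OF Bochner_Integration.integrable_diff[OF integrable_osc integrable_osc] integrable_osc, symmetric]
             Bochner_Integration.integral_diff[OF integrable_osc integrable_osc, symmetric])
    qed
    also have "norm \<dots> \<le> (\<integral>\<omega>. (norm h)\<^sup>2 * (norm (Z \<omega>) ^ 2 * norm (freq_factor vs (Z \<omega>)) * norm (w \<omega>)) \<partial>M)"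
    proof (rule order_trans[OF integral_norm_bound integral_mono])
      have b: "norm (cis (p \<bullet> Z \<omega>) * (cis (h \<bullet> Z \<omega>) - 1 - \<i> * of_real (h \<bullet> Z \<omega>)) * freq_factor vs (Z \<omega>) * w \<omega>) \<le>
          (norm h)\<^sup>2 * (norm (Z \<omega>) ^ 2 * norm (freq_factor vs (Z \<omega>)) * norm (w \<omega>))" for \<omega>
      proof -
        have "norm (cis (h \<bullet> Z \<omega>) - 1 - \<i> * of_real (h \<bullet> Z \<omega>)) \<le> (h \<bullet> Z \<omega>)\<^sup>2"
          by (rule norm_cis_minus_linear_le)
        also have "\<dots> \<le> (norm h * norm (Z \<omega>))\<^sup>2"
          by (rule abs_le_square_iff[THEN iffD1]) (simp add: Cauchy_Schwarz_ineq2)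
        finally have "norm (cis (h \<bullet> Z \<omega>) - 1 - \<i> * of_real (h \<bullet> Z \<omega>)) * (norm (freq_factor vs (Z \<omega>)) * norm (w \<omega>)) \<le>
          (norm h * norm (Z \<omega>))\<^sup>2 * (norm (freq_factor vs (Z \<omega>)) * norm (w \<omega>))"
          by (intro mult_right_mono) auto
        then show ?thesis by (simp add: norm_mult power_mult_distrib mult_ac)
      qed
      then show "norm (cis (p \<bullet> Z \<omega>) * (cis (h \<bullet> Z \<omega>) - 1 - \<i> * of_real (h \<bullet> Z \<omega>)) * freq_factor vs (Z \<omega>) * w \<omega>) \<le>
          (norm h)\<^sup>2 * (norm (Z \<omega>) ^ 2 * norm (freq_factor vs (Z \<omega>)) * norm (w \<omega>))" for \<omega> .
      show I2: "integrable M (\<lambda>\<omega>. (norm h)\<^sup>2 * (norm (Z \<omega>) ^ 2 * norm (freq_factor vs (Z \<omega>)) * norm (w \<omega>)))"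
        by (intro integrable_mult_right I)
      show "integrable M (\<lambda>\<omega>. norm (cis (p \<bullet> Z \<omega>) * (cis (h \<bullet> Z \<omega>) - 1 - \<i> * of_real (h \<bullet> Z \<omega>)) * freq_factor vs (Z \<omega>) * w \<omega>))"
      proof (rule integrable_norm, rule Bochner_Integration.integrable_bound[OF I2])
        show "AE \<omega> in M. norm (cis (p \<bullet> Z \<omega>) * (cis (h \<bullet> Z \<omega>) - 1 - \<i> * of_real (h \<bullet> Z \<omega>)) * freq_factor vs (Z \<omega>) * w \<omega>) \<le>
            norm ((norm h)\<^sup>2 * (norm (Z \<omega>) ^ 2 * norm (freq_factor vs (Z \<omega>)) * norm (w \<omega>)))"
          unfolding real_norm_def by (intro AE_I2 order_trans[OF b abs_ge_self])
      qed measurable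
    qed
    also have "\<dots> = (norm h)\<^sup>2 * C 2" by (simp add: C_def)
    finally have "norm (osc_integral M Z w vs q - osc_integral M Z w vs p - osc_integral M Z w (h # vs) p) \<le> (norm h)\<^sup>2 * C 2" .
    moreover have "norm h > 0" using \<open>q \<noteq> p\<close> by (simp add: h_def)
    ultimately show "norm ((osc_integral M Z w vs q - osc_integral M Z w vs p) - osc_integral M Z w ((q - p) # vs) p) / norm (q - p)
        \<le> C 2 * norm (q - p)"
      by (simp add: h_def[symmetric] pos_divide_le_eq power2_eq_square mult_ac)
  qed (use bl in auto)
qed

end

text \<open>Termwise differentiation on a ball around \<open>p\<close>: the majorant for one more
  direction controls the derivatives uniformly, the one for \<open>vs\<close> itself the convergence
  at \<open>p\<close>. The factor \<open>norm v\<close> for each direction supplies the homogeneity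
  in \<open>h\<close> that convergence in operator norm requires. Majorants depend on the radius
  because the packets decay only locally uniformly.\<close>

lemma series_has_derivative:
  fixes F :: "nat \<Rightarrow> 'a list \<Rightarrow> 'a::euclidean_space \<Rightarrow> complex"
  assumes F: "\<And>j vs p. (F j vs has_derivative (\<lambda>h. F j (h # vs) p)) (at p)"
    and B: "\<And>k R. \<exists>B. summable B \<and> (\<forall>j vs p. length vs = k \<longrightarrow> norm p \<le> R \<longrightarrow>
      norm (F j vs p) \<le> B j * (\<Prod>v\<leftarrow>vs. norm v))"
  shows "((\<lambda>p. \<Sum>j. F j vs p) has_derivative (\<lambda>h. \<Sum>j. F j (h # vs) p)) (at p)"
proof -
  define R where "R = norm p + 1"
  obtain B0 where B0: "summable B0" "\<And>j ws p. length ws = length vs \<Longrightarrow> norm p \<le> R \<Longrightarrow> norm (F j ws p) \<le> B0 j * (\<Prod>v\<leftarrow>ws. norm v)"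
    using B[of "length vs" R] by metis
  obtain B1 where B1: "summable B1" "\<And>j ws p. length ws = Suc (length vs) \<Longrightarrow> norm p \<le> R \<Longrightarrow> norm (F j ws p) \<le> B1 j * (\<Prod>v\<leftarrow>ws. norm v)"
    using B[of "Suc (length vs)" R] by metis
  define P where "P = (\<Prod>v\<leftarrow>vs. norm v)"
  have P: "P \<ge> 0" unfolding P_def by (induction vs) auto
  have "\<exists>g. \<forall>x\<in>ball 0 R. (\<lambda>j. F j vs x) sums g x \<and> (g has_derivative (\<lambda>h. \<Sum>j. F j (h # vs) x)) (at x within ball 0 R)"
  proof (rule has_derivative_series[where f' = "\<lambda>j x h. F j (h # vs) x"])
    show "(F n vs has_derivative (\<lambda>h. F n (h # vs) x)) (at x within ball 0 R)" for n x
      by (rule has_derivative_at_withinI[OF F])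
    have s1: "summable (\<lambda>j. F j (h # vs) x)" if "norm x \<le> R" for x h
    proof (rule summable_comparison_test')
      show "summable (\<lambda>j. B1 j * (norm h * P))" by (intro summable_mult2 B1)
      show "norm (F n (h # vs) x) \<le> B1 n * (norm h * P)" if "n \<ge> 0" for n
        using B1(2)[of "h # vs" x n] \<open>norm x \<le> R\<close> by (simp add: P_def)
    qed
    show "\<forall>\<^sub>F n in sequentially. \<forall>x\<in>ball 0 R. \<forall>h. norm ((\<Sum>i<n. F i (h # vs) x) - (\<Sum>j. F j (h # vs) x)) \<le> e * norm h"
      if "e > 0" for e
    proof -
      \<comment> \<open>The tails of the majorant give the uniform error of the partial sums of
        derivatives.\<close>
      have "(\<lambda>n. \<Sum>i. B1 (i + n)) \<longlonglongrightarrow> 0" by (rule suminf_exist_split2[OF B1(1)])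
      then have "(\<lambda>n. (\<Sum>i. B1 (i + n)) * P) \<longlonglongrightarrow> 0" by (rule tendsto_mult_left_zero)
      then have "\<forall>\<^sub>F n in sequentially. (\<Sum>i. B1 (i + n)) * P < e"
        using that by (rule order_tendstoD)
      then show ?thesis
      proof eventually_elim
        case (elim n)
        show ?case
        proof (intro ballI allI)
          fix x :: 'a and h :: 'a assume "x \<in> ball 0 R"
          then have x: "norm x \<le> R" by simp
          have "(\<Sum>i<n. F i (h # vs) x) - (\<Sum>j. F j (h # vs) x) = - (\<Sum>i. F (i + n) (h # vs) x)"
            using suminf_split_initial_segment[OF s1[OF x], of h n] by simp
          then have "norm ((\<Sum>i<n. F i (h # vs) x) - (\<Sum>j. F j (h # vs) x)) = norm (\<Sum>i. F (i + n) (h # vs) x)"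
            by simp
          also have "\<dots> \<le> (\<Sum>i. B1 (i + n) * (norm h * P))"
          proof (rule norm_suminf_le)
            show "norm (F (i + n) (h # vs) x) \<le> B1 (i + n) * (norm h * P)" for i
              using B1(2)[of "h # vs" x "i + n"] x by (simp add: P_def)
            show "summable (\<lambda>i. B1 (i + n) * (norm h * P))"
              using B1(1) by (intro summable_mult2) (simp add: summable_iff_shift)
          qed
          also have "\<dots> = (\<Sum>i. B1 (i + n)) * (norm h * P)"
            using B1(1) by (intro suminf_mult2[symmetric]) (simp add: summable_iff_shift)
          also have "\<dots> = ((\<Sum>i. B1 (i + n)) * P) * norm h" by simp
          also have "\<dots> \<le> e * norm h" using elim by (intro mult_right_mono) auto
          finally show "norm ((\<Sum>i<n. F i (h # vs) x) - (\<Sum>j. F j (h # vs) x)) \<le> e * norm h" .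
        qed
      qed
    qed
    show "p \<in> ball 0 R" by (simp add: R_def)
    show "(\<lambda>j. F j vs p) sums (\<Sum>j. F j vs p)"
    proof (rule summable_sums, rule summable_comparison_test')
      show "summable (\<lambda>j. B0 j * P)" by (intro summable_mult2 B0)
      show "norm (F n vs p) \<le> B0 n * P" if "n \<ge> 0" for n
        using B0(2)[of vs p n] by (simp add: P_def R_def)
    qed
  qed auto
  then obtain g where g: "\<And>x. x \<in> ball 0 R \<Longrightarrow> (\<lambda>j. F j vs x) sums g x"
    "\<And>x. x \<in> ball 0 R \<Longrightarrow> (g has_derivative (\<lambda>h. \<Sum>j. F j (h # vs) x)) (at x within ball 0 R)"
    by blast
  have p: "p \<in> ball 0 R" by (simp add: R_def)
  have "(g has_derivative (\<lambda>h. \<Sum>j. F j (h # vs) p)) (at p)"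
    using g(2)[OF p] p by (simp add: at_within_open[OF p open_ball])
  then show ?thesis
    by (rule has_derivative_transform_within_open[OF _ open_ball p]) (use g(1) sums_unique in blast)
qed

section \<open>Duality\<close>

text \<open>Symmetry of integral operators with a bounded kernel, dominated by |f(x)| |g(y)|;
  applied to the kernels of the Fourier transform and of its inverse.\<close>

lemma Fubini_kernel:
  fixes K :: "'a::euclidean_space \<Rightarrow> 'b::euclidean_space \<Rightarrow> complex"
  assumes f: "integrable lborel f" and g: "integrable lborel g"
    and K: "continuous_on UNIV (\<lambda>(x, y). K x y)" "\<And>x y. norm (K x y) \<le> 1"
  shows "(\<integral>x. f x * (\<integral>y. K x y * g y \<partial>lborel) \<partial>lborel) =
    (\<integral>y. g y * (\<integral>x. K x y * f x \<partial>lborel) \<partial>lborel)"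
proof -
  have [measurable]: "f \<in> borel_measurable borel" "g \<in> borel_measurable borel"
    using assms by (auto dest: borel_measurable_integrable)
  have [measurable]: "(\<lambda>(x, y). K x y) \<in> borel_measurable (borel \<Otimes>\<^sub>M borel)"
    using borel_measurable_continuous_onI[OF K(1)] by (simp add: borel_prod)
  have "integrable (lborel \<Otimes>\<^sub>M lborel) (\<lambda>p. f (fst p) * g (snd p))"
    using lborel_integral_prod2(1)[OF f g] by (simp add: lborel_prod)
  then have I: "integrable (lborel \<Otimes>\<^sub>M lborel) (\<lambda>(x, y). f x * (K x y * g y))"
  proof (rule Bochner_Integration.integrable_bound)
    show "AE p in lborel \<Otimes>\<^sub>M lborel. norm (case p of (x, y) \<Rightarrow> f x * (K x y * g y)) \<le> norm (f (fst p) * g (snd p))"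
      using K(2) by (intro AE_I2) (auto simp: norm_mult intro!: mult_left_mono mult_left_le_one_le)
  qed measurable
  have "(\<integral>x. f x * (\<integral>y. K x y * g y \<partial>lborel) \<partial>lborel) = (\<integral>x. (\<integral>y. f x * (K x y * g y) \<partial>lborel) \<partial>lborel)"
    by simp
  also have "\<dots> = (\<integral>y. (\<integral>x. f x * (K x y * g y) \<partial>lborel) \<partial>lborel)"
    by (rule lborel_pair.Fubini_integral[OF I, symmetric])
  also have "\<dots> = (\<integral>y. g y * (\<integral>x. K x y * f x \<partial>lborel) \<partial>lborel)"
    by (simp add: integral_mult_right_zero[symmetric] mult_ac del: integral_mult_right_zero)
  finally show ?thesis .
qed

lemma symbol_eq: "symbol t (a, b, c) = cis (t * a * (a\<^sup>2 + (b\<^sup>2 + c\<^sup>2)))"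
  by (simp add: symbol_def norm_Pair)

text \<open>The phase is odd in \<zeta>, so the propagator commutes with complex conjugation and
  preserves real functions.\<close>

lemma symbol_minus: "symbol t (- \<zeta>) = cnj (symbol t \<zeta>)"
  by (cases \<zeta>) (auto simp: symbol_eq cis_cnj)

lemma norm_symbol [simp]: "norm (symbol t \<zeta>) = 1"
  by (simp add: symbol_def split: prod.split)

lemma continuous_on_symbol: "continuous_on S (symbol t)"
  unfolding symbol_def case_prod_unfold by (intro continuous_intros)

lemma borel_measurable_symbol [measurable]: "symbol t \<in> borel_measurable borel"
  by (rule borel_measurable_continuous_onI[OF continuous_on_symbol])

lemma W_eq: "W t T \<phi> = T (fourier (\<lambda>\<zeta>. symbol t \<zeta> * inverse_fourier \<phi> \<zeta>))"
  by (simp add: W_def dist_inverse_fourier_def dist_mult_def dist_fourier_def)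

lemma integral_lborel_reflect:
  fixes f :: "'a::euclidean_space \<Rightarrow> complex"
  assumes [measurable]: "f \<in> borel_measurable borel"
  shows "(\<integral>x. f (- x) \<partial>lborel) = (\<integral>x. f x \<partial>lborel)"
    and "integrable lborel f \<Longrightarrow> integrable lborel (\<lambda>x. f (- x))"
proof -
  have eq: "lborel = distr lborel borel (\<lambda>x::'a. - x)"
    using lborel_affine[of "-1" "0::'a"] by (simp add: density_1)
  show "(\<integral>x. f (- x) \<partial>lborel) = (\<integral>x. f x \<partial>lborel)"
    by (subst (2) eq) (simp add: integral_distr)
  assume "integrable lborel f"
  then have "integrable (distr lborel borel (\<lambda>x::'a. - x)) f" using eq by simp
  then show "integrable lborel (\<lambda>x. f (- x))" by (simp add: integrable_distr_eq)
qed

text \<open>Here \<open>\<alpha>\<close> is the Fourier transform of \<open>v\<close> divided by (2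
  pi)^3. Fubini is applied twice: once to move the transform from the test function side to
  \<open>v\<close>, once to move the inverse transform from \<open>\<phi>\<close> to
  \<open>symbol t\<close> times \<open>\<alpha>\<close>. The inner integral on the right is thus the
  function representing the evolution of \<open>v\<close>.\<close>

lemma integral_times_fourier_symbol:
  fixes v \<alpha> \<phi> :: "R3 \<Rightarrow> complex"
  assumes v: "integrable lborel v" and \<alpha>: "integrable lborel \<alpha>"
    and va: "\<And>\<zeta>. (\<integral>p. cis (- (p \<bullet> \<zeta>)) * v p \<partial>lborel) = complex_of_real ((2 * pi) ^ 3) * \<alpha> \<zeta>"
    and \<phi>: "test_function \<phi>"
  shows "(\<integral>p. v p * fourier (\<lambda>\<zeta>. symbol t \<zeta> * inverse_fourier \<phi> \<zeta>) p \<partial>lborel) =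
    (\<integral>p. \<phi> p * (\<integral>\<zeta>. cis (p \<bullet> \<zeta>) * (symbol t \<zeta> * \<alpha> \<zeta>) \<partial>lborel) \<partial>lborel)"
proof -
  define \<psi> where "\<psi> = (\<lambda>\<zeta>. symbol t \<zeta> * inverse_fourier \<phi> \<zeta>)"
  have bd: "integrable lborel (\<lambda>\<zeta>. symbol t \<zeta> * f \<zeta>)" if "integrable lborel f" for f
  proof (rule Bochner_Integration.integrable_bound[OF that])
    show "(\<lambda>\<zeta>. symbol t \<zeta> * f \<zeta>) \<in> borel_measurable lborel"
      using borel_measurable_integrable[OF that] by measurable
  qed (auto simp: norm_mult)
  have \<psi>: "integrable lborel \<psi>"
    unfolding \<psi>_def by (intro bd integrable_inverse_fourier_test_function \<phi>)
  have fourier: "fourier \<psi> p = (\<integral>\<zeta>. cis (- (p \<bullet> \<zeta>)) * \<psi> \<zeta> \<partial>lborel)" for p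
    by (simp add: fourier_def inner_commute)
  have "(\<integral>p. v p * fourier \<psi> p \<partial>lborel) = (\<integral>\<zeta>. \<psi> \<zeta> * (\<integral>p. cis (- (p \<bullet> \<zeta>)) * v p \<partial>lborel) \<partial>lborel)"
    unfolding fourier
    by (rule Fubini_kernel[OF v \<psi>]) (auto simp: case_prod_unfold intro!: continuous_intros)
  also have "\<dots> = (\<integral>\<zeta>. (symbol t \<zeta> * \<alpha> \<zeta>) * (\<integral>p. cis (\<zeta> \<bullet> p) * \<phi> p \<partial>lborel) \<partial>lborel)"
  proof (rule Bochner_Integration.integral_cong[OF refl])
    fix \<zeta>
    define c1 c2 where "c1 = complex_of_real (1 / (2 * pi) ^ DIM(R3))" and "c2 = complex_of_real ((2 * pi) ^ 3)"
    have "c1 * c2 = 1" by (simp add: c1_def c2_def power3_eq_cube flip: of_real_mult)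
    moreover have "\<psi> \<zeta> * (c2 * \<alpha> \<zeta>) = (c1 * c2) * ((symbol t \<zeta> * \<alpha> \<zeta>) * (\<integral>p. cis (\<zeta> \<bullet> p) * \<phi> p \<partial>lborel))"
      unfolding \<psi>_def inverse_fourier_def c1_def[symmetric] by (simp only: mult_ac)
    ultimately show "\<psi> \<zeta> * (\<integral>p. cis (- (p \<bullet> \<zeta>)) * v p \<partial>lborel) =
        (symbol t \<zeta> * \<alpha> \<zeta>) * (\<integral>p. cis (\<zeta> \<bullet> p) * \<phi> p \<partial>lborel)"
      unfolding va c2_def[symmetric] by simp
  qed
  also have "\<dots> = (\<integral>p. \<phi> p * (\<integral>\<zeta>. cis (\<zeta> \<bullet> p) * (symbol t \<zeta> * \<alpha> \<zeta>) \<partial>lborel) \<partial>lborel)"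
    by (rule Fubini_kernel[OF bd[OF \<alpha>] test_functionD(4)[OF \<phi>]])
       (auto simp: case_prod_unfold intro!: continuous_intros)
  finally show ?thesis by (simp add: \<psi>_def inner_commute)
qed

text \<open>The datum has to be real-valued. The complex identity is averaged with the one for the
  conjugate of \<open>v\<close>, whose transform is \<open>cnj (\<alpha> (- \<zeta>))\<close>; by
  \<open>symbol_minus\<close> the evolution of the conjugate is the conjugate of
  \<open>u\<close>.\<close>

lemma integral_Re_times_fourier_symbol:
  fixes v \<alpha> \<phi> :: "R3 \<Rightarrow> complex"
  assumes v: "integrable lborel v" and \<alpha>: "integrable lborel \<alpha>"
    and va: "\<And>\<zeta>. (\<integral>p. cis (- (p \<bullet> \<zeta>)) * v p \<partial>lborel) = complex_of_real ((2 * pi) ^ 3) * \<alpha> \<zeta>"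
    and \<phi>: "test_function \<phi>"
    and bounded: "\<And>p. norm (fourier (\<lambda>\<zeta>. symbol t \<zeta> * inverse_fourier \<phi> \<zeta>) p) \<le> B"
    and meas: "fourier (\<lambda>\<zeta>. symbol t \<zeta> * inverse_fourier \<phi> \<zeta>) \<in> borel_measurable borel"
    and cont: "continuous_on UNIV u" and u: "\<And>p. u p = (\<integral>\<zeta>. cis (p \<bullet> \<zeta>) * (symbol t \<zeta> * \<alpha> \<zeta>) \<partial>lborel)"
  shows "(\<integral>p. of_real (Re (v p)) * fourier (\<lambda>\<zeta>. symbol t \<zeta> * inverse_fourier \<phi> \<zeta>) p \<partial>lborel) =
    (\<integral>p. of_real (Re (u p)) * \<phi> p \<partial>lborel)"
proof -
  let ?f = "fourier (\<lambda>\<zeta>. symbol t \<zeta> * inverse_fourier \<phi> \<zeta>)"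
  have [measurable]: "v \<in> borel_measurable borel" "\<alpha> \<in> borel_measurable borel"
    using v \<alpha> by (auto dest: borel_measurable_integrable)
  have \<alpha>': "integrable lborel (\<lambda>\<zeta>. cnj (\<alpha> (- \<zeta>)))"
    using integral_lborel_reflect(2)[of \<alpha>] \<alpha> by simp
  have "(\<integral>p. cis (- (p \<bullet> \<zeta>)) * cnj (v p) \<partial>lborel) = complex_of_real ((2 * pi) ^ 3) * cnj (\<alpha> (- \<zeta>))" for \<zeta>
  proof -
    have "(\<integral>p. cis (- (p \<bullet> \<zeta>)) * cnj (v p) \<partial>lborel) = (\<integral>p. cnj (cis (- (p \<bullet> - \<zeta>)) * v p) \<partial>lborel)"
      by (rule Bochner_Integration.integral_cong) (auto simp: cis_cnj)
    also have "\<dots> = cnj (\<integral>p. cis (- (p \<bullet> - \<zeta>)) * v p \<partial>lborel)"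
      by (rule Bochner_Integration.integral_cnj)
    finally show ?thesis unfolding va by simp
  qed
  note 2 = integral_times_fourier_symbol[OF integrable_cnj[OF v] \<alpha>' this \<phi>, of t]
  note 1 = integral_times_fourier_symbol[OF v \<alpha> va \<phi>, of t]
  have u': "(\<integral>\<zeta>. cis (p \<bullet> \<zeta>) * (symbol t \<zeta> * cnj (\<alpha> (- \<zeta>))) \<partial>lborel) = cnj (u p)" for p
  proof -
    have "(\<integral>\<zeta>. cis (p \<bullet> \<zeta>) * (symbol t \<zeta> * cnj (\<alpha> (- \<zeta>))) \<partial>lborel) =
        (\<integral>\<zeta>. cis (p \<bullet> (- \<zeta>)) * (symbol t (- \<zeta>) * cnj (\<alpha> \<zeta>)) \<partial>lborel)"
    proof -
      have "(\<lambda>\<zeta>. cis (p \<bullet> \<zeta>) * (symbol t \<zeta> * cnj (\<alpha> (- \<zeta>)))) \<in> borel_measurable borel"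
        using borel_measurable_integrable[OF \<alpha>'] by measurable
      from integral_lborel_reflect(1)[OF this] show ?thesis by simp
    qed
    also have "\<dots> = (\<integral>\<zeta>. cnj (cis (p \<bullet> \<zeta>) * (symbol t \<zeta> * \<alpha> \<zeta>)) \<partial>lborel)"
      by (rule Bochner_Integration.integral_cong) (auto simp: cis_cnj symbol_minus)
    also have "\<dots> = cnj (u p)"
      unfolding u by (rule Bochner_Integration.integral_cnj)
    finally show ?thesis .
  qed
  have I: "integrable lborel (\<lambda>p. g p * ?f p)" if "integrable lborel g" for g
  proof (rule Bochner_Integration.integrable_bound)
    show "integrable lborel (\<lambda>p. B * norm (g p))" using that by simp
    show "(\<lambda>p. g p * ?f p) \<in> borel_measurable lborel"
      using borel_measurable_integrable[OF that] meas by measurable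
    have "norm (g p) * norm (?f p) \<le> norm (g p) * \<bar>B\<bar>" for p
      using bounded[of p] by (intro mult_left_mono) auto
    then show "AE p in lborel. norm (g p * ?f p) \<le> norm (B * norm (g p))"
      by (intro AE_I2) (simp add: norm_mult abs_mult mult.commute)
  qed
  have I': "integrable lborel (\<lambda>p. \<phi> p * u p)" "integrable lborel (\<lambda>p. \<phi> p * cnj (u p))"
    using integrable_continuous_times_test_function[OF cont \<phi>]
      integrable_continuous_times_test_function[OF continuous_on_cnj[OF cont] \<phi>]
    by (simp_all add: mult.commute)
  have Re: "complex_of_real (Re z) = (z + cnj z) / 2" for z
    by (simp add: complex_add_cnj)
  have "(\<integral>p. of_real (Re (v p)) * ?f p \<partial>lborel) = (\<integral>p. (v p * ?f p + cnj (v p) * ?f p) / 2 \<partial>lborel)"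
    by (simp add: Re ring_distribs)
  also have "\<dots> = (\<integral>p. (\<phi> p * u p + \<phi> p * cnj (u p)) / 2 \<partial>lborel)"
    using I[OF v] I[OF integrable_cnj[OF v]] I' 1 2 unfolding u' u[symmetric] by simp
  also have "\<dots> = (\<integral>p. of_real (Re (u p)) * \<phi> p \<partial>lborel)"
    by (simp add: Re ring_distribs mult.commute)
  finally show ?thesis .
qed

section \<open>Gaussian integrals and contour shifts\<close>

lemma power_le_fact_exp: "(x::real) \<ge> 0 \<Longrightarrow> x ^ k \<le> fact k * exp x"
  using sum_le_suminf[OF sums_summable[OF exp_converges[of x]], of "{k}"] sums_unique[OF exp_converges[of x]]
  by (simp add: inverse_eq_divide pos_divide_le_eq mult.commute)

text \<open>The exponent 1/4 instead of 1/2 leaves half of the Gaussian for absorbing error terms.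
  The summand 2 makes room for an imaginary part up to 1, and it makes every factor at least 1, so
  that a product of such factors dominates each one of them.\<close>

definition gauss_wt :: "nat \<Rightarrow> real \<Rightarrow> real" where
  "gauss_wt k x = (2 + \<bar>x\<bar>) ^ k * exp (- x\<^sup>2 / 4)"

lemma gauss_wt_nonneg [simp]: "gauss_wt k x \<ge> 0"
  by (simp add: gauss_wt_def)

lemma gauss_wt_le: "gauss_wt k x \<le> (fact k * exp 4) * exp (- x\<^sup>2 / 8)"
proof -
  have "(2 + \<bar>x\<bar>) ^ k \<le> fact k * exp (2 + \<bar>x\<bar>)"
    by (rule power_le_fact_exp) simp
  then have "gauss_wt k x \<le> (fact k * exp (2 + \<bar>x\<bar>)) * exp (- x\<^sup>2 / 4)"
    unfolding gauss_wt_def by (intro mult_right_mono) auto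
  also have "\<dots> = fact k * exp (2 + \<bar>x\<bar> - x\<^sup>2 / 4)"
    by (simp add: mult.assoc flip: exp_add)
  also have "\<dots> \<le> fact k * exp (4 - x\<^sup>2 / 8)"
  proof -
    have "(\<bar>x\<bar> - 4)\<^sup>2 \<ge> 0" by simp
    then have "\<bar>x\<bar> \<le> 2 + x\<^sup>2 / 8" by (simp add: power2_diff)
    then show ?thesis by simp
  qed
  also have "\<dots> = (fact k * exp 4) * exp (- x\<^sup>2 / 8)"
    by (simp add: mult.assoc flip: exp_add)
  finally show ?thesis .
qed

lemma integrable_exp_minus_square:
  assumes "c > 0"
  shows "integrable lborel (\<lambda>x::real. exp (- c * x\<^sup>2))"
proof -
  have "integrable lborel (normal_density 0 (1 / sqrt (2 * c)))"
    using assms by (intro integrable_normal_density) simp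
  then have "integrable lborel (\<lambda>x. sqrt (pi / c) * normal_density 0 (1 / sqrt (2 * c)) x)"
    by (rule integrable_mult_right)
  moreover have "sqrt (pi / c) * normal_density 0 (1 / sqrt (2 * c)) x = exp (- c * x\<^sup>2)" for x
    using assms by (simp add: normal_density_def power_divide real_sqrt_divide field_simps real_sqrt_mult)
  ultimately show ?thesis by simp
qed

lemma integrable_gauss_wt: "integrable lborel (gauss_wt k)"
proof (rule Bochner_Integration.integrable_bound)
  show "integrable lborel (\<lambda>x. (fact k * exp 4) * exp (- (1 / 8) * x\<^sup>2) :: real)"
    by (intro integrable_mult_right integrable_exp_minus_square) simp
  show "AE x in lborel. norm (gauss_wt k x) \<le> norm ((fact k * exp 4) * exp (- (1 / 8) * x\<^sup>2) :: real)"
    using gauss_wt_le[of k] by (intro AE_I2) simp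
qed (simp add: gauss_wt_def[abs_def])

lemma gauss_wt_tendsto_0: "(gauss_wt k \<longlongrightarrow> 0) at_top"
proof (rule tendsto_sandwich[where f = "\<lambda>_. 0" and h = "\<lambda>x. (fact k * exp 4) * exp (- x\<^sup>2 / 8)"])
  show "((\<lambda>x::real. (fact k * exp 4) * exp (- x\<^sup>2 / 8)) \<longlongrightarrow> 0) at_top" by real_asymp
  show "\<forall>\<^sub>F x in at_top. gauss_wt k x \<le> (fact k * exp 4) * exp (- x\<^sup>2 / 8)"
    by (intro always_eventually allI gauss_wt_le)
qed auto

lemma gauss_wt_minus [simp]: "gauss_wt k (- x) = gauss_wt k x"
  by (simp add: gauss_wt_def)

lemma integral_tendsto_at_top_symmetric:
  fixes f :: "real \<Rightarrow> complex"
  assumes f: "integrable lborel f"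
  shows "((\<lambda>a. \<integral>x. indicator {-a..a} x *\<^sub>R f x \<partial>lborel) \<longlongrightarrow> integral\<^sup>L lborel f) at_top"
proof (rule integral_dominated_convergence_at_top[where w = "\<lambda>x. norm (f x)"])
  have [measurable]: "f \<in> borel_measurable borel" using f by (auto dest: borel_measurable_integrable)
  show "\<And>a. (\<lambda>x. indicator {-a..a} x *\<^sub>R f x) \<in> borel_measurable lborel" "f \<in> borel_measurable lborel"
    by measurable
  show "\<forall>\<^sub>F a in at_top. AE x in lborel. norm (indicator {-a..a} x *\<^sub>R f x) \<le> norm (f x)"
    by (auto simp: indicator_def)
  show "AE x in lborel. ((\<lambda>a. indicator {-a..a} x *\<^sub>R f x) \<longlongrightarrow> f x) at_top"
  proof (rule AE_I2)
    fix x :: real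
    have "\<forall>\<^sub>F a in at_top. indicator {-a..a} x *\<^sub>R f x = f x"
      using eventually_ge_at_top[of "\<bar>x\<bar>"] by eventually_elim (auto simp: indicator_def)
    then show "((\<lambda>a. indicator {-a..a} x *\<^sub>R f x) \<longlongrightarrow> f x) at_top"
      by (rule tendsto_eventually)
  qed
qed (use f in auto)

text \<open>
  Both integrals are limits of increments of a primitive of \<open>h\<close>, which differ by its increments
  along the short vertical sides.
\<close>

lemma contour_shift:
  fixes h :: "complex \<Rightarrow> complex"
  assumes h: "h holomorphic_on UNIV"
    and bound: "\<And>x s. \<bar>s\<bar> \<le> 1 \<Longrightarrow> norm (h (Complex x s)) \<le> C * gauss_wt k x"
    and \<kappa>: "\<bar>\<kappa>\<bar> \<le> 1"
  shows "(\<integral>x. h (Complex x \<kappa>) \<partial>lborel) = (\<integral>x. h (Complex x 0) \<partial>lborel)"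
proof -
  have conth: "continuous_on UNIV h" using h by (rule holomorphic_on_imp_continuous_on)
  have contC: "continuous_on UNIV (\<lambda>x. h (Complex x s))" for s
    by (rule continuous_on_compose2[OF conth]) (auto simp: Complex_eq intro!: continuous_intros)
  have int: "integrable lborel (\<lambda>x. h (Complex x s))" if "\<bar>s\<bar> \<le> 1" for s
  proof (rule Bochner_Integration.integrable_bound)
    show "integrable lborel (\<lambda>x. C * gauss_wt k x)" by (intro integrable_mult_right integrable_gauss_wt)
    show "(\<lambda>x. h (Complex x s)) \<in> borel_measurable lborel"
      using borel_measurable_continuous_onI[OF contC] by simp
    show "AE x in lborel. norm (h (Complex x s)) \<le> norm (C * gauss_wt k x)"
      unfolding real_norm_def by (intro AE_I2 order_trans[OF bound[OF that] abs_ge_self])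
  qed
  obtain P where P: "\<And>z. (P has_field_derivative h z) (at z)"
    using holomorphic_convex_primitive'[OF convex_UNIV open_UNIV h] by auto
  have FTC: "(\<integral>x. indicator {-a..a} x *\<^sub>R h (Complex x s) \<partial>lborel) = P (Complex a s) - P (Complex (- a) s)"
    if "a \<ge> 0" for a s
  proof (rule integral_FTC_atLeastAtMost)
    show "((\<lambda>x. P (Complex x s)) has_vector_derivative h (Complex x s)) (at x within {-a..a})" for x
    proof -
      have "((\<lambda>x. Complex x s) has_vector_derivative 1) (at x within {-a..a})"
        unfolding Complex_eq by (auto intro!: derivative_eq_intros)
      from field_vector_diff_chain_within[OF this has_field_derivative_at_within[OF P]]
      show ?thesis by (simp add: o_def)
    qed
    show "continuous_on {-a..a} (\<lambda>x. h (Complex x s))" using contC continuous_on_subset by blast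
  qed (use that in auto)
  have side: "norm (P (Complex a \<kappa>) - P (Complex a 0)) \<le> C * gauss_wt k a" for a
  proof -
    have "norm (P (Complex a \<kappa>) - P (Complex a 0)) \<le> (C * gauss_wt k a) * norm (\<kappa> - 0)"
    proof (rule differentiable_bound[where f = "\<lambda>s. P (Complex a s)" and S = "{-1..1}"])
      fix s :: real assume s: "s \<in> {-1..1}"
      have "((\<lambda>s. Complex a s) has_vector_derivative \<i>) (at s within {-1..1})"
        unfolding Complex_eq by (auto intro!: derivative_eq_intros)
      from field_vector_diff_chain_within[OF this has_field_derivative_at_within[OF P]]
      show "((\<lambda>s. P (Complex a s)) has_derivative (\<lambda>d. d *\<^sub>R (\<i> * h (Complex a s)))) (at s within {-1..1})"
        by (simp add: o_def has_vector_derivative_def)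
      show "onorm (\<lambda>d. d *\<^sub>R (\<i> * h (Complex a s))) \<le> C * gauss_wt k a"
        using bound[of s a] s
        by (intro onorm_le) (auto simp: norm_mult mult.commute[of "C * _"] intro!: mult_left_mono)
    qed (use \<kappa> in auto)
    also have "\<dots> \<le> C * gauss_wt k a"
      using \<kappa> order_trans[OF norm_ge_zero bound[of 0 a]] by (intro mult_left_le) auto
    finally show ?thesis .
  qed
  have lim: "((\<lambda>a. (\<integral>x. indicator {-a..a} x *\<^sub>R h (Complex x \<kappa>) \<partial>lborel) -
      (\<integral>x. indicator {-a..a} x *\<^sub>R h (Complex x 0) \<partial>lborel)) \<longlongrightarrow>
      (\<integral>x. h (Complex x \<kappa>) \<partial>lborel) - (\<integral>x. h (Complex x 0) \<partial>lborel)) at_top"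
    using \<kappa> by (intro tendsto_diff integral_tendsto_at_top_symmetric int) auto
  have "((\<lambda>a. (\<integral>x. indicator {-a..a} x *\<^sub>R h (Complex x \<kappa>) \<partial>lborel) -
      (\<integral>x. indicator {-a..a} x *\<^sub>R h (Complex x 0) \<partial>lborel)) \<longlongrightarrow> 0) at_top"
  proof (rule Lim_null_comparison)
    show "((\<lambda>a. 2 * (C * gauss_wt k a)) \<longlongrightarrow> 0) at_top"
      using tendsto_mult_right_zero[OF tendsto_mult_right_zero[OF gauss_wt_tendsto_0]] .
    show "\<forall>\<^sub>F a in at_top. norm ((\<integral>x. indicator {-a..a} x *\<^sub>R h (Complex x \<kappa>) \<partial>lborel) -
      (\<integral>x. indicator {-a..a} x *\<^sub>R h (Complex x 0) \<partial>lborel)) \<le> 2 * (C * gauss_wt k a)"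
      using eventually_ge_at_top[of 0]
    proof eventually_elim
      case (elim a)
      have "P (Complex a \<kappa>) - P (Complex (- a) \<kappa>) - (P (Complex a 0) - P (Complex (- a) 0)) =
          (P (Complex a \<kappa>) - P (Complex a 0)) - (P (Complex (- a) \<kappa>) - P (Complex (- a) 0))"
        by simp
      also have "norm \<dots> \<le> C * gauss_wt k a + C * gauss_wt k (- a)"
        by (rule order_trans[OF norm_triangle_ineq4 add_mono[OF side side]])
      finally show ?case using elim by (simp add: FTC)
    qed
  qed
  from tendsto_unique[OF _ lim this] show ?thesis by simp
qed

lemma integral_lborel_cong_fst:
  fixes F F' :: "'a::euclidean_space \<times> 'b::euclidean_space \<Rightarrow> complex"
  assumes "integrable lborel F" "integrable lborel F'"
    and "\<And>y. (\<integral>x. F (x, y) \<partial>lborel) = (\<integral>x. F' (x, y) \<partial>lborel)"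
  shows "integral\<^sup>L lborel F = integral\<^sup>L lborel F'"
  using assms lborel_pair.integral_snd[of "\<lambda>x y. F (x, y)"] lborel_pair.integral_snd[of "\<lambda>x y. F' (x, y)"]
  by (simp add: lborel_prod)

text \<open>Allows a contour shift in the middle variable alone. For almost every \<open>x\<close>
  the slice is integrable, and there the problem is one for the first variable of a pair.\<close>

lemma integral_lborel_cong_snd:
  fixes F F' :: "'a::euclidean_space \<times> 'b::euclidean_space \<times> 'c::euclidean_space \<Rightarrow> complex"
  assumes F: "integrable lborel F" and F': "integrable lborel F'"
    and eq: "\<And>x z. (\<integral>y. F (x, y, z) \<partial>lborel) = (\<integral>y. F' (x, y, z) \<partial>lborel)"
  shows "integral\<^sup>L lborel F = integral\<^sup>L lborel F'"
proof -
  have I: "integrable (lborel \<Otimes>\<^sub>M lborel) F" "integrable (lborel \<Otimes>\<^sub>M lborel) F'"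
    using F F' by (simp_all add: lborel_prod)
  have [measurable]: "F \<in> borel_measurable (lborel \<Otimes>\<^sub>M lborel)" "F' \<in> borel_measurable (lborel \<Otimes>\<^sub>M lborel)"
    using I by auto
  have "AE x in lborel. (\<integral>y. F (x, y) \<partial>lborel) = (\<integral>y. F' (x, y) \<partial>lborel)"
    using lborel_pair.AE_integrable_fst'[OF I(1)] lborel_pair.AE_integrable_fst'[OF I(2)]
  proof eventually_elim
    case (elim x)
    then show ?case by (rule integral_lborel_cong_fst) (rule eq)
  qed
  then have "(\<integral>x. \<integral>y. F (x, y) \<partial>lborel \<partial>lborel) = (\<integral>x. \<integral>y. F' (x, y) \<partial>lborel \<partial>lborel)"
    by (intro integral_cong_AE) auto
  then show ?thesis
    using lborel_pair.integral_fst'[OF I(1)] lborel_pair.integral_fst'[OF I(2)] by (simp add: lborel_prod)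
qed

lemma integral_cis_gauss:
  "(\<integral>x. cis (a * x) * of_real (exp (- x\<^sup>2 / 2)) \<partial>lborel) = of_real (sqrt (2 * pi) * exp (- a\<^sup>2 / 2))"
proof -
  have "of_real (exp (- a\<^sup>2 / 2)) = char std_normal_distribution a"
    by (simp add: char_std_normal_distribution)
  also have "\<dots> = (\<integral>x. std_normal_density x *\<^sub>R cis (a * x) \<partial>lborel)"
    unfolding char_def by (subst integral_density) (auto simp: cis_conv_exp)
  also have "\<dots> = (\<integral>x. of_real (1 / sqrt (2 * pi)) * (cis (a * x) * of_real (exp (- x\<^sup>2 / 2))) \<partial>lborel)"
    by (rule Bochner_Integration.integral_cong)
       (auto simp: std_normal_density_def scaleR_conv_of_real mult_ac)
  also have "\<dots> = of_real (1 / sqrt (2 * pi)) * (\<integral>x. cis (a * x) * of_real (exp (- x\<^sup>2 / 2)) \<partial>lborel)"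
    by simp
  finally show ?thesis by (simp add: field_simps)
qed

text \<open>A Gaussian wave packet on the line with centre \<open>b\<close>, frequency
  \<open>e\<close> and width 1/c, its phase normalized to 0 at the centre.\<close>

definition wave :: "real \<Rightarrow> real \<Rightarrow> real \<Rightarrow> real \<Rightarrow> complex" where
  "wave b e c x = cis ((x - b) * e) * of_real (exp (- ((x - b) * c)\<^sup>2 / 2))"

lemma integrable_wave: "c \<noteq> 0 \<Longrightarrow> integrable lborel (wave b e c)"
  and integral_norm_wave: "c > 0 \<Longrightarrow> (\<integral>x. norm (wave b e c x) \<partial>lborel) = sqrt (2 * pi) / c"
  and fourier_wave: "c > 0 \<Longrightarrow> (\<integral>x. cis (- (x * \<zeta>)) * wave b e c x \<partial>lborel) =
    cis (- (b * \<zeta>)) * of_real (sqrt (2 * pi) / c * exp (- ((e - \<zeta>) / c)\<^sup>2 / 2))"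
proof -
  have 1: "integrable lborel (\<lambda>x::real. exp (- x\<^sup>2 / 2))"
    using integrable_exp_minus_square[of "1 / 2"] by simp
  have meas: "wave b e c \<in> borel_measurable borel" for b e c
    unfolding wave_def by measurable
  show "integrable lborel (wave b e c)" if "c \<noteq> 0"
  proof (rule Bochner_Integration.integrable_bound)
    show "integrable lborel (\<lambda>x. exp (- ((- b * c) + c * x)\<^sup>2 / 2))"
      using lborel_integrable_real_affine[OF 1 that] .
    show "AE x in lborel. norm (wave b e c x) \<le> norm (exp (- ((- b * c) + c * x)\<^sup>2 / 2))"
      by (intro AE_I2) (simp add: wave_def norm_mult algebra_simps)
  qed (use meas in simp)
  show "(\<integral>x. norm (wave b e c x) \<partial>lborel) = sqrt (2 * pi) / c" if "c > 0"
  proof -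
    have "(\<integral>x. exp (- x\<^sup>2 / 2) \<partial>lborel) = sqrt (2 * pi)"
    proof -
      have "complex_of_real (\<integral>x. exp (- x\<^sup>2 / 2) \<partial>lborel) = complex_of_real (sqrt (2 * pi))"
        by (subst integral_complex_of_real[symmetric]) (use integral_cis_gauss[of 0] in simp)
      then show ?thesis by (simp only: of_real_eq_iff)
    qed
    moreover have "(\<integral>x. norm (wave b e c x) \<partial>lborel) = \<bar>1 / c\<bar> *\<^sub>R (\<integral>x. norm (wave b e c (b + 1 / c * x)) \<partial>lborel)"
      using that by (intro lborel_integral_real_affine) simp
    ultimately show ?thesis using that by (simp add: wave_def norm_mult)
  qed
  show "(\<integral>x. cis (- (x * \<zeta>)) * wave b e c x \<partial>lborel) =
    cis (- (b * \<zeta>)) * of_real (sqrt (2 * pi) / c * exp (- ((e - \<zeta>) / c)\<^sup>2 / 2))" if "c > 0"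
  proof -
    have "(\<integral>x. cis (- (x * \<zeta>)) * wave b e c x \<partial>lborel) =
        \<bar>1 / c\<bar> *\<^sub>R (\<integral>x. cis (- ((b + 1 / c * x) * \<zeta>)) * wave b e c (b + 1 / c * x) \<partial>lborel)"
      using that by (intro lborel_integral_real_affine) simp
    also have "(\<lambda>x. cis (- ((b + 1 / c * x) * \<zeta>)) * wave b e c (b + 1 / c * x)) =
        (\<lambda>x. cis (- (b * \<zeta>)) * (cis ((e - \<zeta>) / c * x) * of_real (exp (- x\<^sup>2 / 2))))"
    proof
      fix x
      have "- ((b + 1 / c * x) * \<zeta>) + ((b + 1 / c * x) - b) * e = - (b * \<zeta>) + (e - \<zeta>) / c * x"
        using that by (simp add: field_simps)
      then have "cis (- ((b + 1 / c * x) * \<zeta>)) * cis (((b + 1 / c * x) - b) * e) = cis (- (b * \<zeta>)) * cis ((e - \<zeta>) / c * x)"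
        unfolding cis_mult by simp
      then show "cis (- ((b + 1 / c * x) * \<zeta>)) * wave b e c (b + 1 / c * x) =
          cis (- (b * \<zeta>)) * (cis ((e - \<zeta>) / c * x) * of_real (exp (- x\<^sup>2 / 2)))"
        using that by (simp add: wave_def mult.assoc[symmetric])
    qed
    finally show ?thesis
      unfolding integral_mult_right_zero integral_cis_gauss
      using that by (simp add: scaleR_conv_of_real del: of_real_exp)
  qed
qed

section \<open>Wave packets\<close>

text \<open>
  A packet of frequency \<open>M\<^sup>5\<close> in \<open>y\<^sub>1\<close> and widths \<open>M\<^sup>7\<close>, \<open>1/M\<close>, \<open>1/M\<^sup>3\<close> in \<open>x\<close>, \<open>y\<^sub>1\<close>, \<open>y\<^sub>2\<close>. It travels with
  velocity about \<open>- M\<^sup>1\<^sup>0\<close> in the direction of \<open>x\<close> and passes the point \<open>(0, n, 0)\<close> at time \<open>r\<close>,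
  during a time of order \<open>M\<^sup>-\<^sup>3\<close>.
\<close>

definition packet_freq :: "real \<Rightarrow> R3 \<Rightarrow> R3" where
  "packet_freq M = (\<lambda>(\<xi>, \<eta>, \<mu>). (\<xi> / M ^ 7, M ^ 5 + M * \<eta>, M ^ 3 * \<mu>))"

text \<open>The power (2 pi)^(-3/2) normalizes the Gaussian in the rescaled variables, and 1/M^4 is
  the amplitude. The factor -i cancels the i that a y1-derivative brings down: at the focus this
  derivative is close to the positive number M and survives the passage to real parts.\<close>

definition packet_const :: "real \<Rightarrow> complex" where
  "packet_const M = - \<i> * of_real ((1 / sqrt (2 * pi)) ^ 3 / M ^ 4)"

text \<open>The phase inside \<open>cis\<close> translates the initial packet to
  \<open>(r M^10, n, 0)\<close>; with velocity about -M^10 in x it arrives at x = 0 at time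
  \<open>r\<close>.\<close>

definition packet_amp :: "real \<Rightarrow> real \<Rightarrow> real \<Rightarrow> real \<Rightarrow> R3 \<Rightarrow> complex" where
  "packet_amp t r n M = (\<lambda>(\<xi>, \<eta>, \<mu>). packet_const M * of_real (exp (- (\<xi>\<^sup>2 + \<eta>\<^sup>2 + \<mu>\<^sup>2) / 2)) *
     (cis (- ((r * M ^ 10, n, 0) \<bullet> packet_freq M (\<xi>, \<eta>, \<mu>))) * symbol t (packet_freq M (\<xi>, \<eta>, \<mu>))))"

definition packet :: "real \<Rightarrow> real \<Rightarrow> real \<Rightarrow> real \<Rightarrow> R3 list \<Rightarrow> R3 \<Rightarrow> complex" where
  "packet t r n M = osc_integral lborel (packet_freq M) (packet_amp t r n M)"

definition gauss_wt3 :: "nat \<Rightarrow> R3 \<Rightarrow> real" where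
  "gauss_wt3 k = (\<lambda>(\<xi>, \<eta>, \<mu>). gauss_wt k \<xi> * (gauss_wt k \<eta> * gauss_wt k \<mu>))"

definition gauss_const :: "nat \<Rightarrow> real" where
  "gauss_const k = integral\<^sup>L lborel (gauss_wt3 k)"

lemma integrable_gauss_wt3: "integrable lborel (gauss_wt3 k)"
  unfolding gauss_wt3_def by (rule lborel_integral_prod3(1)[OF integrable_gauss_wt integrable_gauss_wt integrable_gauss_wt])

lemma gauss_wt3_nonneg [simp]: "gauss_wt3 k \<omega> \<ge> 0"
  by (simp add: gauss_wt3_def split: prod.split)

lemma gauss_const_nonneg [simp]: "gauss_const k \<ge> 0"
  unfolding gauss_const_def by (rule integral_nonneg_AE) simp

lemma gauss_wt3_eq:
  "gauss_wt3 k (\<xi>, \<eta>, \<mu>) = ((2 + \<bar>\<xi>\<bar>) * (2 + \<bar>\<eta>\<bar>) * (2 + \<bar>\<mu>\<bar>)) ^ k * exp (- (\<xi>\<^sup>2 + \<eta>\<^sup>2 + \<mu>\<^sup>2) / 4)"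
proof -
  have "- (\<xi>\<^sup>2 + \<eta>\<^sup>2 + \<mu>\<^sup>2) / 4 = - \<xi>\<^sup>2 / 4 + (- \<eta>\<^sup>2 / 4 + - \<mu>\<^sup>2 / 4)" by simp
  then show ?thesis
    unfolding gauss_wt3_def gauss_wt_def by (simp only: exp_add power_mult_distrib prod.case mult_ac)
qed

lemma prod_list_norm_nonneg [simp]: "0 \<le> (\<Prod>v\<leftarrow>vs. norm v)"
  by (induction vs) auto

text \<open>The integrand of a packet, continued analytically to complex \<open>\<xi>\<close> and \<open>\<eta>\<close>; \<open>u\<close> stands for \<open>1/M\<^sup>7\<close>.\<close>

definition cfreq_factor :: "R3 list \<Rightarrow> complex \<Rightarrow> complex \<Rightarrow> complex \<Rightarrow> complex" where
  "cfreq_factor vs a b c = (\<Prod>(v1, v2, v3)\<leftarrow>vs. \<i> * (of_real v1 * a + of_real v2 * b + of_real v3 * c))"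

definition packet_exponent :: "real \<Rightarrow> real \<Rightarrow> R3 \<Rightarrow> real \<Rightarrow> complex \<Rightarrow> complex \<Rightarrow> real \<Rightarrow> complex" where
  "packet_exponent t u = (\<lambda>(A, B, C) M z1 z2 \<mu>.
     \<i> * (of_real A * (of_real u * z1) + of_real B * (of_real (M ^ 5) + of_real M * z2) + of_real (C * (M ^ 3 * \<mu>))
       + of_real t * (of_real u * z1) *
         ((of_real u * z1)\<^sup>2 + (of_real (M ^ 5) + of_real M * z2)\<^sup>2 + (of_real (M ^ 3 * \<mu>))\<^sup>2))
     - (z1\<^sup>2 + z2\<^sup>2 + (of_real \<mu>)\<^sup>2) / 2)"

definition packet_ext :: "real \<Rightarrow> real \<Rightarrow> R3 \<Rightarrow> real \<Rightarrow> R3 list \<Rightarrow> complex \<Rightarrow> complex \<Rightarrow> real \<Rightarrow> complex" where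
  "packet_ext t u q M vs z1 z2 \<mu> = exp (packet_exponent t u q M z1 z2 \<mu>) *
     cfreq_factor vs (of_real u * z1) (of_real (M ^ 5) + of_real M * z2) (of_real (M ^ 3 * \<mu>))"

lemma cfreq_factor_simps [simp]:
  "cfreq_factor [] a b c = 1"
  "cfreq_factor ((v1, v2, v3) # vs) a b c =
     \<i> * (of_real v1 * a + of_real v2 * b + of_real v3 * c) * cfreq_factor vs a b c"
  by (simp_all add: cfreq_factor_def)

lemma freq_factor_eq_cfreq_factor: "freq_factor vs (a, b, c) = cfreq_factor vs (of_real a) (of_real b) (of_real c)"
  by (induction vs) auto

section \<open>Growth of the continued integrand\<close>

lemma norm_cfreq_factor_le:
  "norm (cfreq_factor vs a b c) \<le> (norm a + norm b + norm c) ^ length vs * (\<Prod>v\<leftarrow>vs. norm v)"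
proof (induction vs)
  case (Cons v vs)
  obtain v1 v2 v3 where v: "v = (v1, v2, v3)" by (cases v) auto
  have "\<bar>v1\<bar> \<le> norm v" "\<bar>v2\<bar> \<le> norm v" "\<bar>v3\<bar> \<le> norm v"
    using norm_fst_le[of v1 "(v2, v3)"] norm_snd_le[of "(v2, v3)" v1] norm_fst_le[of v2 v3] norm_snd_le[of v3 v2]
    by (auto simp: v)
  then have "\<bar>v1\<bar> * norm a + \<bar>v2\<bar> * norm b + \<bar>v3\<bar> * norm c \<le> norm v * norm a + norm v * norm b + norm v * norm c"
    by (intro add_mono mult_right_mono) auto
  moreover have "norm (of_real v1 * a + of_real v2 * b + of_real v3 * c) \<le> \<bar>v1\<bar> * norm a + \<bar>v2\<bar> * norm b + \<bar>v3\<bar> * norm c"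
    by (intro order_trans[OF norm_triangle_ineq] add_mono) (auto simp: norm_mult)
  ultimately have "norm (of_real v1 * a + of_real v2 * b + of_real v3 * c) \<le> norm v * (norm a + norm b + norm c)"
    by (simp add: algebra_simps)
  then have "norm (of_real v1 * a + of_real v2 * b + of_real v3 * c) * norm (cfreq_factor vs a b c) \<le>
      (norm v * (norm a + norm b + norm c)) * ((norm a + norm b + norm c) ^ length vs * (\<Prod>v\<leftarrow>vs. norm v))"
    by (intro mult_mono Cons.IH) auto
  then show ?case by (simp add: v norm_mult mult_ac)
qed simp

lemma holomorphic_cfreq_factor:
  assumes "a holomorphic_on S" "b holomorphic_on S" "c holomorphic_on S"
  shows "(\<lambda>z. cfreq_factor vs (a z) (b z) (c z)) holomorphic_on S"
  by (induction vs) (auto intro!: holomorphic_intros assms)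

lemma continuous_on_cfreq_factor [continuous_intros]:
  assumes "continuous_on S a" "continuous_on S b" "continuous_on S c"
  shows "continuous_on S (\<lambda>z. cfreq_factor vs (a z) (b z) (c z))"
  by (induction vs) (auto intro!: continuous_intros assms)

lemma norm_packet_freq_le:
  assumes M: "M \<ge> 1" and s: "\<bar>s\<bar> \<le> 1" and \<sigma>: "\<bar>\<sigma>\<bar> \<le> 1" and u: "u = 1 / M ^ 7"
  shows "norm (of_real u * Complex \<xi> s) + norm (of_real (M ^ 5) + of_real M * Complex \<eta> \<sigma>) +
    norm (complex_of_real (M ^ 3 * \<mu>)) \<le> 3 * M ^ 5 * ((2 + \<bar>\<xi>\<bar>) * (2 + \<bar>\<eta>\<bar>) * (2 + \<bar>\<mu>\<bar>))"
proof -
  define G where "G = (2 + \<bar>\<xi>\<bar>) * (2 + \<bar>\<eta>\<bar>) * (2 + \<bar>\<mu>\<bar>)"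
  have G1: "(2 + \<bar>\<xi>\<bar>) * (2 + \<bar>\<eta>\<bar>) \<ge> 2 + \<bar>\<xi>\<bar>" "(2 + \<bar>\<xi>\<bar>) * (2 + \<bar>\<eta>\<bar>) \<ge> 2 + \<bar>\<eta>\<bar>"
    using mult_left_mono[of 1 "2 + \<bar>\<eta>\<bar>" "2 + \<bar>\<xi>\<bar>"] mult_right_mono[of 1 "2 + \<bar>\<xi>\<bar>" "2 + \<bar>\<eta>\<bar>"] by auto
  have "1 \<le> (2 + \<bar>\<xi>\<bar>) * (2 + \<bar>\<eta>\<bar>)" using G1(1) abs_ge_zero[of \<xi>] by linarith
  then have "G \<ge> (2 + \<bar>\<xi>\<bar>) * (2 + \<bar>\<eta>\<bar>)" "G \<ge> 2 + \<bar>\<mu>\<bar>"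
    using mult_left_mono[of 1 "2 + \<bar>\<mu>\<bar>" "(2 + \<bar>\<xi>\<bar>) * (2 + \<bar>\<eta>\<bar>)"]
      mult_right_mono[of 1 "(2 + \<bar>\<xi>\<bar>) * (2 + \<bar>\<eta>\<bar>)" "2 + \<bar>\<mu>\<bar>"] G1 by (auto simp: G_def)
  with G1 have G: "2 + \<bar>\<xi>\<bar> \<le> G" "2 + \<bar>\<eta>\<bar> \<le> G" "2 + \<bar>\<mu>\<bar> \<le> G" by auto
  have M1: "M ^ 5 \<ge> 1" "M ^ 7 \<ge> 1" "M \<le> M ^ 5" "M ^ 3 \<le> M ^ 5"
    using M power_increasing[of 1 5 M] power_increasing[of 3 5 M] by (auto simp: one_le_power)
  have "norm (Complex \<xi> s) \<le> \<bar>\<xi>\<bar> + 1" "norm (Complex \<eta> \<sigma>) \<le> \<bar>\<eta>\<bar> + 1"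
    using cmod_le[of "Complex \<xi> s"] cmod_le[of "Complex \<eta> \<sigma>"] s \<sigma> by auto
  then have z: "norm (Complex \<xi> s) \<le> G" "norm (Complex \<eta> \<sigma>) + 1 \<le> G" "\<bar>\<mu>\<bar> \<le> G" using G by auto
  have "norm (of_real u * Complex \<xi> s) \<le> M ^ 5 * G"
  proof -
    have "\<bar>u\<bar> \<le> 1" using M M1(2) by (simp add: u)
    then have "\<bar>u\<bar> \<le> M ^ 5" using M1(1) by linarith
    then show ?thesis unfolding norm_mult norm_of_real using z M by (intro mult_mono) auto
  qed
  moreover have "norm (of_real (M ^ 5) + of_real M * Complex \<eta> \<sigma>) \<le> M ^ 5 * G"
  proof -
    have "norm (of_real (M ^ 5) + of_real M * Complex \<eta> \<sigma>) \<le> M ^ 5 + M * norm (Complex \<eta> \<sigma>)"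
      using M M1 by (intro order_trans[OF norm_triangle_ineq]) (simp add: norm_mult norm_power)
    also have "\<dots> \<le> M ^ 5 + M ^ 5 * norm (Complex \<eta> \<sigma>)"
      using M1 by (intro add_left_mono mult_right_mono) auto
    also have "\<dots> = M ^ 5 * (norm (Complex \<eta> \<sigma>) + 1)" by (simp add: algebra_simps)
    also have "\<dots> \<le> M ^ 5 * G" using z M by (intro mult_left_mono) auto
    finally show ?thesis .
  qed
  moreover have "norm (complex_of_real (M ^ 3 * \<mu>)) \<le> M ^ 5 * G"
    unfolding norm_of_real abs_mult using M M1 z by (intro mult_mono) auto
  ultimately show ?thesis unfolding G_def[symmetric] by simp
qed

text \<open>\<open>E\<close> collects everything gained or lost by leaving the real slice.
  Derivatives cost only the polynomial factor \<open>(3 * M ^ 5) ^ length vs\<close>, since M^5 is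
  the largest frequency scale.\<close>

lemma norm_packet_ext_le:
  assumes M: "M \<ge> 1" and s: "\<bar>s\<bar> \<le> 1" and \<sigma>: "\<bar>\<sigma>\<bar> \<le> 1" and u: "u = 1 / M ^ 7"
    and E: "Re (packet_exponent t u q M (Complex \<xi> s) (Complex \<eta> \<sigma>) \<mu>) \<le> E - (\<xi>\<^sup>2 + \<eta>\<^sup>2 + \<mu>\<^sup>2) / 4"
  shows "norm (packet_ext t u q M vs (Complex \<xi> s) (Complex \<eta> \<sigma>) \<mu>) \<le>
    (3 * M ^ 5) ^ length vs * (\<Prod>v\<leftarrow>vs. norm v) * exp E * gauss_wt3 (length vs) (\<xi>, \<eta>, \<mu>)"
proof -
  define G where "G = (2 + \<bar>\<xi>\<bar>) * (2 + \<bar>\<eta>\<bar>) * (2 + \<bar>\<mu>\<bar>)"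
  have "(norm (of_real u * Complex \<xi> s) + norm (of_real (M ^ 5) + of_real M * Complex \<eta> \<sigma>) +
      norm (complex_of_real (M ^ 3 * \<mu>))) ^ length vs \<le> (3 * M ^ 5 * G) ^ length vs"
    unfolding G_def by (intro power_mono add_nonneg_nonneg norm_ge_zero norm_packet_freq_le M s \<sigma> u)
  then have "norm (cfreq_factor vs (of_real u * Complex \<xi> s) (of_real (M ^ 5) + of_real M * Complex \<eta> \<sigma>) (of_real (M ^ 3 * \<mu>))) \<le>
      (3 * M ^ 5 * G) ^ length vs * (\<Prod>v\<leftarrow>vs. norm v)"
    by (intro order_trans[OF norm_cfreq_factor_le] mult_right_mono) auto
  then have "norm (packet_ext t u q M vs (Complex \<xi> s) (Complex \<eta> \<sigma>) \<mu>) \<le>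
      exp (E - (\<xi>\<^sup>2 + \<eta>\<^sup>2 + \<mu>\<^sup>2) / 4) * ((3 * M ^ 5 * G) ^ length vs * (\<Prod>v\<leftarrow>vs. norm v))"
    unfolding packet_ext_def norm_mult norm_exp_eq_Re using E by (intro mult_mono) auto
  also have "\<dots> = (3 * M ^ 5) ^ length vs * (\<Prod>v\<leftarrow>vs. norm v) * exp E * (G ^ length vs * exp (- (\<xi>\<^sup>2 + \<eta>\<^sup>2 + \<mu>\<^sup>2) / 4))"
  proof -
    have "exp (E - S / 4) = exp E * exp (- S / 4)" for S
      by (simp flip: exp_add)
    then show ?thesis by (simp only: power_mult_distrib mult_ac)
  qed
  finally show ?thesis by (simp add: gauss_wt3_eq G_def)
qed

section \<open>The real part of the exponent on shifted contours\<close>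

lemma Re_packet_exponent:
  "Re (packet_exponent t u (A, B, C) M (Complex \<xi> s) (Complex \<eta> 0) \<mu>) =
    - s * (A * u) - t * (u * s * ((M ^ 5 + M * \<eta>)\<^sup>2 + (M ^ 3 * \<mu>)\<^sup>2) + u ^ 3 * (3 * \<xi>\<^sup>2 * s - s ^ 3))
    - (\<xi>\<^sup>2 - s\<^sup>2 + \<eta>\<^sup>2 + \<mu>\<^sup>2) / 2"
  "Re (packet_exponent t u (A, B, C) M (Complex \<xi> 0) (Complex \<eta> s) \<mu>) =
    - s * B * M - t * u * \<xi> * 2 * (M ^ 5 + M * \<eta>) * M * s - (\<xi>\<^sup>2 + \<eta>\<^sup>2 - s\<^sup>2 + \<mu>\<^sup>2) / 2"
  unfolding packet_exponent_def by (simp_all add: power2_eq_square power3_eq_cube) algebra+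

lemma abs_mult_le_sixteenth:
  fixes t s M :: real
  assumes "M \<ge> 16 * (\<bar>t\<bar> + 1)" "\<bar>s\<bar> \<le> 1"
  shows "\<bar>t * s / M\<bar> \<le> 1 / 16"
proof -
  have "\<bar>t * s\<bar> \<le> \<bar>t\<bar>" using assms(2) by (simp add: abs_mult mult_left_le)
  moreover have "M > 0" using assms(1) abs_ge_zero[of t] unfolding distrib_left by linarith
  ultimately show ?thesis using assms(1) by (simp add: abs_mult field_simps)
qed

lemma abs_mult_le_sixteenth_mult:
  fixes q x :: real
  assumes "\<bar>q\<bar> \<le> 1 / 16" "x \<ge> 0"
  shows "q * x \<le> x / 16" "- (q * x) \<le> x / 16"
proof -
  have "\<bar>q * x\<bar> \<le> 1 / 16 * x"
    unfolding abs_mult using assms by (intro mult_mono) auto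
  then show "q * x \<le> x / 16" "- (q * x) \<le> x / 16" by auto
qed

text \<open>The transport part t s M^3 of the cubic phase meets the contribution -r s M^3 of the
  initial position, which leaves the gain s (t - r) M^3. All remaining phase terms carry the factor
  t s / M, at most 1/16 in modulus by the lower bound on \<open>M\<close>; they use up less than a
  quarter of each of the squares and a bounded constant.\<close>

lemma packet_exponent_bound_time:
  fixes t r M p1 :: real
  assumes M: "M \<ge> 16 * (\<bar>t\<bar> + 1)" and s: "\<bar>s\<bar> \<le> 1" and u: "u = 1 / M ^ 7"
  shows "Re (packet_exponent t u (p1 - r * M ^ 10, B, C) M (Complex \<xi> s) (Complex \<eta> 0) \<mu>) \<le>
    (\<bar>p1\<bar> + 1 - s * (t - r) * M ^ 3) - (\<xi>\<^sup>2 + \<eta>\<^sup>2 + \<mu>\<^sup>2) / 4"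
proof -
  have M0: "M \<ge> 1" using M abs_ge_zero[of t] unfolding distrib_left by linarith
  define q where "q = t * s / M"
  have q: "\<bar>q\<bar> \<le> 1 / 16" unfolding q_def by (rule abs_mult_le_sixteenth[OF M s])
  \<comment> \<open>Sizes of the lower-order terms relative to 1/M: \<eta>^2 / M^5 comes from the
    square of M \<eta>, and \<xi>^3 / M^21 from the cube of the x-frequency.\<close>
  define d e where "d = 1 / M ^ 4" and "e = 1 / M ^ 20"
  have de: "0 \<le> d" "d \<le> 1" "0 \<le> e" "e \<le> 1" using M0 by (auto simp: d_def e_def one_le_power divide_le_eq)
  have "Re (packet_exponent t u (p1 - r * M ^ 10, B, C) M (Complex \<xi> s) (Complex \<eta> 0) \<mu>) =
     - (s * u * p1) - s * (t - r) * M ^ 3 - q * (2 * \<eta>) - q * d * \<eta>\<^sup>2 - q * \<mu>\<^sup>2 - q * e * (3 * \<xi>\<^sup>2) + q * e * s\<^sup>2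
     - (\<xi>\<^sup>2 - s\<^sup>2 + \<eta>\<^sup>2 + \<mu>\<^sup>2) / 2"
    using M0 unfolding Re_packet_exponent(1) q_def d_def e_def u
    by (simp add: field_simps power2_eq_square power3_eq_cube power_numeral_reduce numeral_eq_Suc)
  moreover have "- (s * u * p1) \<le> \<bar>p1\<bar>"
  proof -
    have "\<bar>s * u\<bar> \<le> 1 * 1" unfolding abs_mult using s M0 by (intro mult_mono) (auto simp: u one_le_power)
    then have "\<bar>s * u * p1\<bar> \<le> 1 * \<bar>p1\<bar>" unfolding abs_mult[of _ p1] by (intro mult_right_mono) auto
    then show ?thesis by auto
  qed
  moreover have "- (q * (2 * \<eta>)) \<le> (1 + \<eta>\<^sup>2) / 16"
  proof -
    have "\<bar>q * (2 * \<eta>)\<bar> \<le> 1 / 16 * \<bar>2 * \<eta>\<bar>" unfolding abs_mult[of q] using q by (intro mult_right_mono) auto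
    moreover have "\<bar>2 * \<eta>\<bar> \<le> 1 + \<eta>\<^sup>2" using zero_le_power2[of "\<bar>\<eta>\<bar> - 1"] by (simp add: power2_diff)
    ultimately show ?thesis by auto
  qed
  moreover have "- (q * d * \<eta>\<^sup>2) \<le> \<eta>\<^sup>2 / 16" "- (q * e * (3 * \<xi>\<^sup>2)) \<le> 3 * \<xi>\<^sup>2 / 16" "q * e * s\<^sup>2 \<le> 1 / 16" "- (q * \<mu>\<^sup>2) \<le> \<mu>\<^sup>2 / 16"
  proof -
    have qd: "\<bar>q * d\<bar> \<le> 1 / 16" "\<bar>q * e\<bar> \<le> 1 / 16"
      using mult_mono[OF q de(2)] mult_mono[OF q de(4)] de by (auto simp: abs_mult)
    have s2: "s\<^sup>2 \<le> 1" using s by (simp add: abs_square_le_1)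
    show "- (q * d * \<eta>\<^sup>2) \<le> \<eta>\<^sup>2 / 16" "- (q * e * (3 * \<xi>\<^sup>2)) \<le> 3 * \<xi>\<^sup>2 / 16" "q * e * s\<^sup>2 \<le> 1 / 16" "- (q * \<mu>\<^sup>2) \<le> \<mu>\<^sup>2 / 16"
      using abs_mult_le_sixteenth_mult(2)[OF qd(1), of "\<eta>\<^sup>2"] abs_mult_le_sixteenth_mult(2)[OF qd(2), of "3 * \<xi>\<^sup>2"]
        abs_mult_le_sixteenth_mult(1)[OF qd(2), of "s\<^sup>2"] abs_mult_le_sixteenth_mult(2)[OF q, of "\<mu>\<^sup>2"] s2 by auto
  qed
  moreover have "s\<^sup>2 \<le> 1" using s by (simp add: abs_square_le_1)
  moreover have "0 \<le> \<xi>\<^sup>2" "0 \<le> \<eta>\<^sup>2" "0 \<le> \<mu>\<^sup>2" by auto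
  ultimately show ?thesis by (simp only: diff_divide_distrib add_divide_distrib)
qed

text \<open>An imaginary part of \<eta> changes the phase of the y1-translation by B M s, and
  otherwise only produces cross terms with the small factor t s / M. The bound is uniform in
  \<open>A\<close>, so decay in y1 is available at every time, including the focusing time.\<close>

lemma packet_exponent_bound_space:
  fixes t M :: real
  assumes M: "M \<ge> 16 * (\<bar>t\<bar> + 1)" and s: "\<bar>s\<bar> \<le> 1" and u: "u = 1 / M ^ 7"
  shows "Re (packet_exponent t u (A, B, C) M (Complex \<xi> 0) (Complex \<eta> s) \<mu>) \<le>
    (1 - s * B * M) - (\<xi>\<^sup>2 + \<eta>\<^sup>2 + \<mu>\<^sup>2) / 4"
proof -
  have M0: "M \<ge> 1" using M abs_ge_zero[of t] unfolding distrib_left by linarith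
  define q where "q = t * s / M"
  have q: "\<bar>q\<bar> \<le> 1 / 16" unfolding q_def by (rule abs_mult_le_sixteenth[OF M s])
  define d where "d = 1 / M ^ 4"
  have d: "0 \<le> d" "d \<le> 1" using M0 by (auto simp: d_def one_le_power divide_le_eq)
  have qd: "\<bar>q * d\<bar> \<le> 1 / 16" using mult_mono[OF q d(2)] d by (auto simp: abs_mult)
  have "Re (packet_exponent t u (A, B, C) M (Complex \<xi> 0) (Complex \<eta> s) \<mu>) =
     - (s * B * M) - q * (2 * \<xi>) - q * d * (2 * \<xi> * \<eta>) - (\<xi>\<^sup>2 + \<eta>\<^sup>2 - s\<^sup>2 + \<mu>\<^sup>2) / 2"
    using M0 unfolding Re_packet_exponent(2) q_def d_def u
    by (simp add: field_simps power2_eq_square power3_eq_cube power_numeral_reduce numeral_eq_Suc)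
  moreover have "- (q * (2 * \<xi>)) \<le> (1 + \<xi>\<^sup>2) / 16"
  proof -
    have "\<bar>q * (2 * \<xi>)\<bar> \<le> 1 / 16 * \<bar>2 * \<xi>\<bar>" unfolding abs_mult[of q] using q by (intro mult_right_mono) auto
    moreover have "\<bar>2 * \<xi>\<bar> \<le> 1 + \<xi>\<^sup>2" using zero_le_power2[of "\<bar>\<xi>\<bar> - 1"] by (simp add: power2_diff)
    ultimately show ?thesis by auto
  qed
  moreover have "- (q * d * (2 * \<xi> * \<eta>)) \<le> (\<xi>\<^sup>2 + \<eta>\<^sup>2) / 16"
  proof -
    have "\<bar>q * d * (2 * \<xi> * \<eta>)\<bar> \<le> 1 / 16 * \<bar>2 * \<xi> * \<eta>\<bar>" unfolding abs_mult[of "q * d"] using qd by (intro mult_right_mono) auto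
    moreover have "\<bar>2 * \<xi> * \<eta>\<bar> \<le> \<xi>\<^sup>2 + \<eta>\<^sup>2" using zero_le_power2[of "\<bar>\<xi>\<bar> - \<bar>\<eta>\<bar>"] by (simp add: power2_diff abs_mult)
    ultimately show ?thesis by auto
  qed
  moreover have "s\<^sup>2 \<le> 1" using s by (simp add: abs_square_le_1)
  moreover have "0 \<le> \<xi>\<^sup>2" "0 \<le> \<eta>\<^sup>2" "0 \<le> \<mu>\<^sup>2" by auto
  ultimately show ?thesis by (simp only: diff_divide_distrib add_divide_distrib)
qed

lemma Complex_0: "Complex a 0 = complex_of_real a"
  by (simp add: complex_of_real_def)

lemma packet_integrand_eq:
  fixes p1 p2 p3 :: real
  assumes "u = 1 / M ^ 7"
  shows "cis ((p1, p2, p3) \<bullet> packet_freq M (\<xi>, \<eta>, \<mu>)) * freq_factor vs (packet_freq M (\<xi>, \<eta>, \<mu>)) * packet_amp t r n M (\<xi>, \<eta>, \<mu>) =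
    packet_const M * packet_ext t u (p1 - r * M ^ 10, p2 - n, p3) M vs (Complex \<xi> 0) (Complex \<eta> 0) \<mu>"
proof -
  define a b c where "a = u * \<xi>" and "b = M ^ 5 + M * \<eta>" and "c = M ^ 3 * \<mu>"
  have Z: "packet_freq M (\<xi>, \<eta>, \<mu>) = (a, b, c)" by (simp add: packet_freq_def a_def b_def c_def assms)
  define \<theta> where "\<theta> = (p1 - r * M ^ 10) * a + (p2 - n) * b + p3 * c + t * a * (a\<^sup>2 + b\<^sup>2 + c\<^sup>2)"
  have "packet_exponent t u (p1 - r * M ^ 10, p2 - n, p3) M (Complex \<xi> 0) (Complex \<eta> 0) \<mu> =
      \<i> * of_real \<theta> + of_real (- (\<xi>\<^sup>2 + \<eta>\<^sup>2 + \<mu>\<^sup>2) / 2)"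
    by (simp add: packet_exponent_def Complex_0 \<theta>_def a_def b_def c_def) (simp add: add_divide_distrib)
  then have "exp (packet_exponent t u (p1 - r * M ^ 10, p2 - n, p3) M (Complex \<xi> 0) (Complex \<eta> 0) \<mu>) =
      cis \<theta> * of_real (exp (- (\<xi>\<^sup>2 + \<eta>\<^sup>2 + \<mu>\<^sup>2) / 2))"
    by (simp only: exp_add cis_conv_exp exp_of_real[symmetric])
  moreover have "cis \<theta> = cis ((p1, p2, p3) \<bullet> (a, b, c)) * (cis (- ((r * M ^ 10, n, 0) \<bullet> (a, b, c))) * symbol t (a, b, c))"
    unfolding symbol_eq cis_mult by (rule arg_cong[of _ _ cis]) (simp add: \<theta>_def algebra_simps)
  ultimately show ?thesis
    unfolding packet_amp_def packet_ext_def prod.case Z freq_factor_eq_cfreq_factor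
    by (simp add: a_def b_def c_def Complex_0 mult_ac)
qed

lemma continuous_on_packet_ext:
  "continuous_on UNIV (\<lambda>\<omega>. packet_ext t u q M vs (Complex (fst \<omega>) s) (Complex (fst (snd \<omega>)) \<sigma>) (snd (snd \<omega>)))"
  unfolding packet_ext_def packet_exponent_def case_prod_unfold Complex_eq by (intro continuous_intros) auto

context
  fixes t u M E :: real and q :: R3 and vs :: "R3 list" and s \<sigma> :: real
  assumes M: "M \<ge> 1" and s: "\<bar>s\<bar> \<le> 1" and \<sigma>: "\<bar>\<sigma>\<bar> \<le> 1" and u: "u = 1 / M ^ 7"
    and E: "\<And>\<xi> \<eta> \<mu>. Re (packet_exponent t u q M (Complex \<xi> s) (Complex \<eta> \<sigma>) \<mu>) \<le> E - (\<xi>\<^sup>2 + \<eta>\<^sup>2 + \<mu>\<^sup>2) / 4"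
begin

lemma integrable_packet_ext:
  "integrable lborel (\<lambda>\<omega>. packet_ext t u q M vs (Complex (fst \<omega>) s) (Complex (fst (snd \<omega>)) \<sigma>) (snd (snd \<omega>)))"
proof (rule Bochner_Integration.integrable_bound)
  show "integrable lborel (\<lambda>\<omega>. (3 * M ^ 5) ^ length vs * (\<Prod>v\<leftarrow>vs. norm v) * exp E * gauss_wt3 (length vs) \<omega>)"
    by (intro integrable_mult_right integrable_gauss_wt3)
  show "(\<lambda>\<omega>. packet_ext t u q M vs (Complex (fst \<omega>) s) (Complex (fst (snd \<omega>)) \<sigma>) (snd (snd \<omega>))) \<in> borel_measurable lborel"
    using borel_measurable_continuous_onI[OF continuous_on_packet_ext] by simp
  show "AE \<omega> in lborel. norm (packet_ext t u q M vs (Complex (fst \<omega>) s) (Complex (fst (snd \<omega>)) \<sigma>) (snd (snd \<omega>)))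
      \<le> norm ((3 * M ^ 5) ^ length vs * (\<Prod>v\<leftarrow>vs. norm v) * exp E * gauss_wt3 (length vs) \<omega>)"
  proof (rule AE_I2)
    fix \<omega> :: R3
    show "norm (packet_ext t u q M vs (Complex (fst \<omega>) s) (Complex (fst (snd \<omega>)) \<sigma>) (snd (snd \<omega>)))
      \<le> norm ((3 * M ^ 5) ^ length vs * (\<Prod>v\<leftarrow>vs. norm v) * exp E * gauss_wt3 (length vs) \<omega>)"
      using order_trans[OF norm_packet_ext_le[OF M s \<sigma> u E, of vs "fst \<omega>" "fst (snd \<omega>)" "snd (snd \<omega>)"] abs_ge_self]
      by simp
  qed
qed

lemma norm_integral_packet_ext_le:
  "norm (\<integral>\<omega>. packet_ext t u q M vs (Complex (fst \<omega>) s) (Complex (fst (snd \<omega>)) \<sigma>) (snd (snd \<omega>)) \<partial>lborel) \<le>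
    (3 * M ^ 5) ^ length vs * (\<Prod>v\<leftarrow>vs. norm v) * exp E * gauss_const (length vs)"
proof -
  have "norm (\<integral>\<omega>. packet_ext t u q M vs (Complex (fst \<omega>) s) (Complex (fst (snd \<omega>)) \<sigma>) (snd (snd \<omega>)) \<partial>lborel) \<le>
      (\<integral>\<omega>. (3 * M ^ 5) ^ length vs * (\<Prod>v\<leftarrow>vs. norm v) * exp E * gauss_wt3 (length vs) \<omega> \<partial>lborel)"
  proof (rule order_trans[OF integral_norm_bound integral_mono])
    show "integrable lborel (\<lambda>\<omega>. norm (packet_ext t u q M vs (Complex (fst \<omega>) s) (Complex (fst (snd \<omega>)) \<sigma>) (snd (snd \<omega>))))"
      by (rule integrable_norm[OF integrable_packet_ext])
    show "integrable lborel (\<lambda>\<omega>. (3 * M ^ 5) ^ length vs * (\<Prod>v\<leftarrow>vs. norm v) * exp E * gauss_wt3 (length vs) \<omega>)"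
      by (intro integrable_mult_right integrable_gauss_wt3)
    fix \<omega> :: R3
    show "norm (packet_ext t u q M vs (Complex (fst \<omega>) s) (Complex (fst (snd \<omega>)) \<sigma>) (snd (snd \<omega>))) \<le>
      (3 * M ^ 5) ^ length vs * (\<Prod>v\<leftarrow>vs. norm v) * exp E * gauss_wt3 (length vs) \<omega>"
      using norm_packet_ext_le[OF M s \<sigma> u E, of vs "fst \<omega>" "fst (snd \<omega>)" "snd (snd \<omega>)"] by simp
  qed
  also have "\<dots> = (3 * M ^ 5) ^ length vs * (\<Prod>v\<leftarrow>vs. norm v) * exp E * gauss_const (length vs)"
    by (simp add: gauss_const_def)
  finally show ?thesis .
qed

end

section \<open>Size of a packet and its decay away from the focus\<close>

lemma packet_exponent_bound_real:
  "Re (packet_exponent t u q M (Complex \<xi> 0) (Complex \<eta> 0) \<mu>) \<le> 0 - (\<xi>\<^sup>2 + \<eta>\<^sup>2 + \<mu>\<^sup>2) / 4"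
proof -
  have "0 \<le> \<xi>\<^sup>2" "0 \<le> \<eta>\<^sup>2" "0 \<le> \<mu>\<^sup>2" by auto
  then show ?thesis
    by (cases q) (simp only: Re_packet_exponent(1), simp add: field_simps)
qed

lemma packet_eq:
  assumes "u = 1 / M ^ 7"
  shows "packet t r n M vs p = packet_const M *
    (\<integral>\<omega>. packet_ext t u (fst p - r * M ^ 10, fst (snd p) - n, snd (snd p)) M vs (Complex (fst \<omega>) 0) (Complex (fst (snd \<omega>)) 0) (snd (snd \<omega>)) \<partial>lborel)"
proof -
  have "packet t r n M vs p = (\<integral>\<omega>. packet_const M *
    packet_ext t u (fst p - r * M ^ 10, fst (snd p) - n, snd (snd p)) M vs (Complex (fst \<omega>) 0) (Complex (fst (snd \<omega>)) 0) (snd (snd \<omega>)) \<partial>lborel)"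
    unfolding packet_def osc_integral_def
  proof (rule Bochner_Integration.integral_cong[OF refl])
    fix \<omega> :: R3
    show "cis (p \<bullet> packet_freq M \<omega>) * freq_factor vs (packet_freq M \<omega>) * packet_amp t r n M \<omega> = packet_const M *
      packet_ext t u (fst p - r * M ^ 10, fst (snd p) - n, snd (snd p)) M vs (Complex (fst \<omega>) 0) (Complex (fst (snd \<omega>)) 0) (snd (snd \<omega>))"
      using packet_integrand_eq[OF assms, of "fst p" "fst (snd p)" "snd (snd p)" "fst \<omega>" "fst (snd \<omega>)" "snd (snd \<omega>)" vs t r n]
      by simp
  qed
  then show ?thesis by simp
qed

lemma norm_packet_const:
  assumes "M \<ge> 1"
  shows "norm (packet_const M) \<le> 1 / M ^ 4"
proof -
  have "(1 / sqrt (2 * pi)) ^ 3 \<le> 1"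
    using pi_gt3 by (intro power_le_one) (auto simp: real_le_rsqrt)
  then show ?thesis
    using assms by (simp add: packet_const_def norm_mult norm_divide norm_power divide_right_mono)
qed

lemma norm_packet_const_times_le:
  assumes "M \<ge> 1" "norm I \<le> (3 * M ^ 5) ^ k * P * e * c"
  shows "norm (packet_const M * I) \<le> (3 ^ k * c) * (M ^ (5 * k) / M ^ 4) * e * P"
proof -
  have "norm (packet_const M * I) \<le> 1 / M ^ 4 * ((3 * M ^ 5) ^ k * P * e * c)"
    unfolding norm_mult using assms norm_packet_const by (intro mult_mono) auto
  moreover have "M ^ (5 * k) = (M ^ 5) ^ k" by (rule power_mult)
  ultimately show ?thesis by (simp add: power_mult_distrib mult_ac)
qed

text \<open>The bound without any shift, hence for all times and all M \<ge> 1: order M^-4 for the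
  packet itself and order M for a first derivative.\<close>

lemma norm_packet_le:
  assumes "M \<ge> 1"
  shows "norm (packet t r n M vs p) \<le>
    (3 ^ length vs * gauss_const (length vs)) * (M ^ (5 * length vs) / M ^ 4) * (\<Prod>v\<leftarrow>vs. norm v)"
  unfolding packet_eq[OF refl]
  using norm_packet_const_times_le[OF assms norm_integral_packet_ext_le[OF assms _ _ refl packet_exponent_bound_real]]
  by simp

lemma holomorphic_packet_ext:
  "(\<lambda>z. packet_ext t u q M vs z w \<mu>) holomorphic_on S" "(\<lambda>z. packet_ext t u q M vs w z \<mu>) holomorphic_on S"
  unfolding packet_ext_def packet_exponent_def case_prod_unfold
  by (intro holomorphic_intros holomorphic_cfreq_factor; simp)+

text \<open>The \<xi>-contour moves to imaginary part sgn (t - r). The gain |t - r| M^3 is the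
  distance |t - r| M^10 to the focus along x, measured in widths M^7.\<close>

lemma norm_packet_le_time:
  assumes M: "M \<ge> 16 * (\<bar>t\<bar> + 1)"
  shows "norm (packet t r n M vs p) \<le>
    (3 ^ length vs * gauss_const (length vs)) * (M ^ (5 * length vs) / M ^ 4) *
      exp (norm p + 1 - \<bar>t - r\<bar> * M ^ 3) * (\<Prod>v\<leftarrow>vs. norm v)"
proof -
  have M1: "M \<ge> 1" using M abs_ge_zero[of t] unfolding distrib_left by linarith
  define u where "u = 1 / M ^ 7"
  define q where "q = (fst p - r * M ^ 10, fst (snd p) - n, snd (snd p))"
  define \<kappa> where "\<kappa> = sgn (t - r)"
  have \<kappa>: "\<bar>\<kappa>\<bar> \<le> 1" "\<kappa> * (t - r) = \<bar>t - r\<bar>" by (auto simp: \<kappa>_def abs_sgn_eq mult_sgn_abs abs_mult_sgn sgn_mult_abs linordered_idom_class.abs_sgn mult.commute)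
  have p1: "\<bar>fst p\<bar> \<le> norm p" using norm_fst_le[of "fst p" "snd p"] by simp
  have E: "Re (packet_exponent t u q M (Complex \<xi> s) (Complex \<eta> 0) \<mu>) \<le>
      (norm p + 1 - s * (t - r) * M ^ 3) - (\<xi>\<^sup>2 + \<eta>\<^sup>2 + \<mu>\<^sup>2) / 4" if "\<bar>s\<bar> \<le> 1" for s \<xi> \<eta> \<mu>
    using packet_exponent_bound_time[OF M that u_def, of "fst p" r "fst (snd p) - n" "snd (snd p)" \<xi> \<eta> \<mu>] p1
    unfolding q_def by linarith
  let ?F = "\<lambda>s \<omega>. packet_ext t u q M vs (Complex (fst \<omega>) s) (Complex (fst (snd \<omega>)) 0) (snd (snd \<omega>))"
  have "integral\<^sup>L lborel (?F \<kappa>) = integral\<^sup>L lborel (?F 0)"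
  proof (rule integral_lborel_cong_fst)
    show "integrable lborel (?F \<kappa>)" "integrable lborel (?F 0)"
      by (rule integrable_packet_ext[OF M1 _ _ u_def E]; simp add: \<kappa>)+
    fix y :: "real \<times> real"
    obtain \<eta> \<mu> where y: "y = (\<eta>, \<mu>)" by (cases y) auto
    have "(\<integral>x. packet_ext t u q M vs (Complex x \<kappa>) (Complex \<eta> 0) \<mu> \<partial>lborel) = (\<integral>x. packet_ext t u q M vs (Complex x 0) (Complex \<eta> 0) \<mu> \<partial>lborel)"
    proof (rule contour_shift[OF holomorphic_packet_ext(1) _ \<kappa>(1)])
      fix x s :: real assume s: "\<bar>s\<bar> \<le> 1"
      \<comment> \<open>In between the two contours \<open>s\<close> may have the wrong sign. There
        only some bound uniform in \<open>s\<close> is needed, so the gain is counted as a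
        loss.\<close>
      have "\<bar>s * (t - r) * M ^ 3\<bar> \<le> 1 * \<bar>t - r\<bar> * M ^ 3"
        unfolding abs_mult using s M1 by (intro mult_mono) auto
      then have "norm p + 1 - s * (t - r) * M ^ 3 \<le> norm p + 1 + \<bar>t - r\<bar> * M ^ 3" by auto
      then have E': "Re (packet_exponent t u q M (Complex x s) (Complex \<eta> 0) \<mu>) \<le>
          (norm p + 1 + \<bar>t - r\<bar> * M ^ 3) - (x\<^sup>2 + \<eta>\<^sup>2 + \<mu>\<^sup>2) / 4"
        using E[OF s, of x \<eta> \<mu>] by linarith
      show "norm (packet_ext t u q M vs (Complex x s) (Complex \<eta> 0) \<mu>) \<le>
          ((3 * M ^ 5) ^ length vs * (\<Prod>v\<leftarrow>vs. norm v) * exp (norm p + 1 + \<bar>t - r\<bar> * M ^ 3) *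
          (gauss_wt (length vs) \<eta> * gauss_wt (length vs) \<mu>)) * gauss_wt (length vs) x"
        using norm_packet_ext_le[OF M1 s _ u_def E', of vs] by (simp add: gauss_wt3_def mult_ac)
    qed
    then show "(\<integral>x. ?F \<kappa> (x, y) \<partial>lborel) = (\<integral>x. ?F 0 (x, y) \<partial>lborel)" by (simp add: y)
  qed
  then have "packet t r n M vs p = packet_const M * integral\<^sup>L lborel (?F \<kappa>)"
    by (simp add: packet_eq[OF u_def] q_def)
  then show ?thesis
    using norm_packet_const_times_le[OF M1 norm_integral_packet_ext_le[OF M1 \<kappa>(1) _ u_def E[OF \<kappa>(1)], of vs]] \<kappa>(2)
    by simp
qed

text \<open>The \<eta>-contour moves towards the side on which y1 - n lies; the gain is the distance
  |y1 - n| measured in widths 1/M.\<close>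

lemma norm_packet_le_space:
  assumes M: "M \<ge> 16 * (\<bar>t\<bar> + 1)"
  shows "norm (packet t r n M vs p) \<le>
    (3 ^ length vs * gauss_const (length vs)) * (M ^ (5 * length vs) / M ^ 4) *
      exp (1 - \<bar>fst (snd p) - n\<bar> * M) * (\<Prod>v\<leftarrow>vs. norm v)"
proof -
  have M1: "M \<ge> 1" using M abs_ge_zero[of t] unfolding distrib_left by linarith
  define u where "u = 1 / M ^ 7"
  define B where "B = fst (snd p) - n"
  define q where "q = (fst p - r * M ^ 10, B, snd (snd p))"
  define \<kappa> where "\<kappa> = sgn B"
  have \<kappa>: "\<bar>\<kappa>\<bar> \<le> 1" "\<kappa> * B = \<bar>B\<bar>" by (auto simp: \<kappa>_def abs_sgn_eq mult_sgn_abs abs_mult_sgn sgn_mult_abs linordered_idom_class.abs_sgn mult.commute)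
  have E: "Re (packet_exponent t u q M (Complex \<xi> 0) (Complex \<eta> s) \<mu>) \<le>
      (1 - s * B * M) - (\<xi>\<^sup>2 + \<eta>\<^sup>2 + \<mu>\<^sup>2) / 4" if "\<bar>s\<bar> \<le> 1" for s \<xi> \<eta> \<mu>
    unfolding q_def by (rule packet_exponent_bound_space[OF M that u_def])
  let ?F = "\<lambda>s \<omega>. packet_ext t u q M vs (Complex (fst \<omega>) 0) (Complex (fst (snd \<omega>)) s) (snd (snd \<omega>))"
  have "integral\<^sup>L lborel (?F \<kappa>) = integral\<^sup>L lborel (?F 0)"
  proof (rule integral_lborel_cong_snd)
    show "integrable lborel (?F \<kappa>)" "integrable lborel (?F 0)"
      by (rule integrable_packet_ext[OF M1 _ _ u_def E]; simp add: \<kappa>)+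
    fix \<xi> \<mu> :: real
    have "(\<integral>x. packet_ext t u q M vs (Complex \<xi> 0) (Complex x \<kappa>) \<mu> \<partial>lborel) = (\<integral>x. packet_ext t u q M vs (Complex \<xi> 0) (Complex x 0) \<mu> \<partial>lborel)"
    proof (rule contour_shift[OF holomorphic_packet_ext(2) _ \<kappa>(1)])
      fix x s :: real assume s: "\<bar>s\<bar> \<le> 1"
      have "\<bar>s * B * M\<bar> \<le> 1 * \<bar>B\<bar> * M"
        unfolding abs_mult using s M1 by (intro mult_mono) auto
      then have "1 - s * B * M \<le> 1 + \<bar>B\<bar> * M" by auto
      then have E': "Re (packet_exponent t u q M (Complex \<xi> 0) (Complex x s) \<mu>) \<le>
          (1 + \<bar>B\<bar> * M) - (\<xi>\<^sup>2 + x\<^sup>2 + \<mu>\<^sup>2) / 4"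
        using E[OF s, of \<xi> x \<mu>] by linarith
      show "norm (packet_ext t u q M vs (Complex \<xi> 0) (Complex x s) \<mu>) \<le>
          ((3 * M ^ 5) ^ length vs * (\<Prod>v\<leftarrow>vs. norm v) * exp (1 + \<bar>B\<bar> * M) *
          (gauss_wt (length vs) \<xi> * gauss_wt (length vs) \<mu>)) * gauss_wt (length vs) x"
        using norm_packet_ext_le[OF M1 _ s u_def E', of vs] by (simp add: gauss_wt3_def mult_ac)
    qed
    then show "(\<integral>x. ?F \<kappa> (\<xi>, x, \<mu>) \<partial>lborel) = (\<integral>x. ?F 0 (\<xi>, x, \<mu>) \<partial>lborel)" by simp
  qed
  then have "packet t r n M vs p = packet_const M * integral\<^sup>L lborel (?F \<kappa>)"
    by (simp add: packet_eq[OF u_def] q_def B_def)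
  then show ?thesis
    using norm_packet_const_times_le[OF M1 norm_integral_packet_ext_le[OF M1 _ \<kappa>(1) u_def E[OF \<kappa>(1)], of vs]] \<kappa>(2)
    by (simp add: B_def)
qed

section \<open>Packets as smooth functions\<close>

lemma continuous_on_packet_freq [continuous_intros]:
  assumes "continuous_on S f"
  shows "continuous_on S (\<lambda>x. packet_freq M (f x))"
proof -
  define c where "c = 1 / M ^ 7"
  have "packet_freq M \<omega> = (c * fst \<omega>, M ^ 5 + M * fst (snd \<omega>), M ^ 3 * snd (snd \<omega>))" for \<omega>
    by (simp add: packet_freq_def c_def case_prod_unfold)
  then show ?thesis using assms by (auto intro!: continuous_intros)
qed

lemma borel_measurable_packet_freq [measurable]: "packet_freq M \<in> borel_measurable borel"
  by (intro borel_measurable_continuous_onI continuous_on_packet_freq continuous_on_id)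

lemma borel_measurable_packet_amp [measurable]: "packet_amp t r n M \<in> borel_measurable borel"
proof -
  have "continuous_on UNIV (\<lambda>\<omega>. packet_const M * of_real (exp (- ((fst \<omega>)\<^sup>2 + (fst (snd \<omega>))\<^sup>2 + (snd (snd \<omega>))\<^sup>2) / 2)) *
     (cis (- ((r * M ^ 10, n, 0) \<bullet> packet_freq M \<omega>)) * symbol t (packet_freq M \<omega>)))"
    by (intro continuous_intros continuous_on_compose2[OF continuous_on_symbol[of UNIV]]) auto
  moreover have "packet_amp t r n M = (\<lambda>\<omega>. packet_const M * of_real (exp (- ((fst \<omega>)\<^sup>2 + (fst (snd \<omega>))\<^sup>2 + (snd (snd \<omega>))\<^sup>2) / 2)) *
     (cis (- ((r * M ^ 10, n, 0) \<bullet> packet_freq M \<omega>)) * symbol t (packet_freq M \<omega>)))"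
    by (auto simp: packet_amp_def)
  ultimately show ?thesis by (simp only: borel_measurable_continuous_onI)
qed

lemma packet_moments:
  assumes "M \<ge> 1"
  shows "integrable lborel (\<lambda>\<omega>. norm (packet_freq M \<omega>) ^ k * norm (packet_amp t r n M \<omega>))"
proof (rule Bochner_Integration.integrable_bound)
  show "integrable lborel (\<lambda>\<omega>. (3 * M ^ 5) ^ k * norm (packet_const M) * gauss_wt3 k \<omega>)"
    by (intro integrable_mult_right integrable_gauss_wt3)
  show "AE \<omega> in lborel. norm (norm (packet_freq M \<omega>) ^ k * norm (packet_amp t r n M \<omega>)) \<le>
      norm ((3 * M ^ 5) ^ k * norm (packet_const M) * gauss_wt3 k \<omega>)"
  proof (rule AE_I2)
    fix \<omega> :: R3
    obtain \<xi> \<eta> \<mu> where \<omega>: "\<omega> = (\<xi>, \<eta>, \<mu>)" by (cases \<omega>) auto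
    define G where "G = (2 + \<bar>\<xi>\<bar>) * (2 + \<bar>\<eta>\<bar>) * (2 + \<bar>\<mu>\<bar>)"
    define S where "S = \<xi>\<^sup>2 + \<eta>\<^sup>2 + \<mu>\<^sup>2"
    have S: "S \<ge> 0" by (simp add: S_def)
    have "norm (packet_freq M \<omega>) \<le> \<bar>\<xi> / M ^ 7\<bar> + (\<bar>M ^ 5 + M * \<eta>\<bar> + \<bar>M ^ 3 * \<mu>\<bar>)"
      using norm_Pair_le[of "\<xi> / M ^ 7" "(M ^ 5 + M * \<eta>, M ^ 3 * \<mu>)"] norm_Pair_le[of "M ^ 5 + M * \<eta>" "M ^ 3 * \<mu>"]
      by (simp add: \<omega> packet_freq_def)
    also have "\<dots> \<le> 3 * M ^ 5 * G"
    proof -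
      have "norm (of_real (1 / M ^ 7) * complex_of_real \<xi>) + norm (of_real (M ^ 5) + of_real M * complex_of_real \<eta>) +
          norm (complex_of_real (M ^ 3 * \<mu>)) \<le> 3 * M ^ 5 * G"
        using norm_packet_freq_le[OF assms _ _ refl, of 0 0 \<xi> \<eta> \<mu>] by (simp add: Complex_0 G_def)
      then show ?thesis
        unfolding of_real_mult[symmetric] of_real_add[symmetric] norm_of_real by simp
    qed
    finally have "norm (packet_freq M \<omega>) ^ k \<le> (3 * M ^ 5 * G) ^ k"
      by (intro power_mono) auto
    moreover have "norm (packet_amp t r n M \<omega>) \<le> norm (packet_const M) * exp (- S / 4)"
    proof -
      have "norm (packet_amp t r n M \<omega>) = norm (packet_const M) * exp (- S / 2)"
        unfolding \<omega> packet_amp_def prod.case S_def by (simp add: norm_mult del: of_real_exp)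
      then show ?thesis using S by (simp add: mult_left_mono)
    qed
    ultimately have "norm (packet_freq M \<omega>) ^ k * norm (packet_amp t r n M \<omega>) \<le>
        (3 * M ^ 5 * G) ^ k * (norm (packet_const M) * exp (- S / 4))"
      using assms by (intro mult_mono) (auto simp: G_def)
    also have "\<dots> = (3 * M ^ 5) ^ k * norm (packet_const M) * (G ^ k * exp (- S / 4))"
      by (simp only: power_mult_distrib mult_ac)
    also have "\<dots> = (3 * M ^ 5) ^ k * norm (packet_const M) * gauss_wt3 k \<omega>"
      by (simp only: \<omega> gauss_wt3_eq G_def S_def)
    finally have "norm (packet_freq M \<omega>) ^ k * norm (packet_amp t r n M \<omega>) \<le>
        (3 * M ^ 5) ^ k * norm (packet_const M) * gauss_wt3 k \<omega>" .
    from order_trans[OF this abs_ge_self]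
    show "norm (norm (packet_freq M \<omega>) ^ k * norm (packet_amp t r n M \<omega>)) \<le>
      norm ((3 * M ^ 5) ^ k * norm (packet_const M) * gauss_wt3 k \<omega>)" by simp
  qed
qed measurable

lemma packet_has_derivative:
  assumes "M \<ge> 1"
  shows "(packet t r n M vs has_derivative (\<lambda>h. packet t r n M (h # vs) p)) (at p)"
  unfolding packet_def by (rule osc_integral_has_derivative) (use packet_moments[OF assms] in measurable)

lemma continuous_on_packet:
  assumes "M \<ge> 1"
  shows "continuous_on UNIV (packet t r n M vs)"
  using packet_has_derivative[OF assms]
  by (auto intro!: continuous_at_imp_continuous_on has_derivative_continuous)

section \<open>The packet at time 0 and its Fourier transform\<close>

lemma packet_initial:
  assumes "M \<ge> 1"
  shows "packet 0 r n M [] p = - \<i> / of_real (M ^ 4) *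
    (case p of (p1, p2, p3) \<Rightarrow> wave (r * M ^ 10) 0 (1 / M ^ 7) p1 * (wave n (M ^ 5) M p2 * wave 0 0 (M ^ 3) p3))"
proof -
  obtain p1 p2 p3 where p: "p = (p1, p2, p3)" by (cases p) auto
  define g where "g a x = cis (a * x) * complex_of_real (exp (- x\<^sup>2 / 2))" for a x :: real
  have g: "integrable lborel (g a)" "integral\<^sup>L lborel (g a) = of_real (sqrt (2 * pi) * exp (- a\<^sup>2 / 2))" for a
    using integrable_wave[of 1 0 a] integral_cis_gauss[of a] by (simp_all add: g_def[abs_def] wave_def[abs_def] mult.commute)
  define a where "a = (p1 - r * M ^ 10) / M ^ 7"
  have eq: "cis (p \<bullet> packet_freq M (\<xi>, \<eta>, \<mu>)) * packet_amp 0 r n M (\<xi>, \<eta>, \<mu>) =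
      packet_const M * cis ((p2 - n) * M ^ 5) * (g a \<xi> * (g ((p2 - n) * M) \<eta> * g (p3 * M ^ 3) \<mu>))" for \<xi> \<eta> \<mu>
  proof -
    have "p \<bullet> packet_freq M (\<xi>, \<eta>, \<mu>) + - ((r * M ^ 10, n, 0) \<bullet> packet_freq M (\<xi>, \<eta>, \<mu>)) =
        (p2 - n) * M ^ 5 + (a * \<xi> + ((p2 - n) * M * \<eta> + p3 * M ^ 3 * \<mu>))"
      by (simp add: p packet_freq_def a_def algebra_simps diff_divide_distrib)
    then have c: "cis (p \<bullet> packet_freq M (\<xi>, \<eta>, \<mu>)) * cis (- ((r * M ^ 10, n, 0) \<bullet> packet_freq M (\<xi>, \<eta>, \<mu>))) =
        cis ((p2 - n) * M ^ 5) * (cis (a * \<xi>) * (cis ((p2 - n) * M * \<eta>) * cis (p3 * M ^ 3 * \<mu>)))"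
      by (simp only: cis_mult)
    have e: "exp (- (\<xi>\<^sup>2 + \<eta>\<^sup>2 + \<mu>\<^sup>2) / 2) = exp (- \<xi>\<^sup>2 / 2) * (exp (- \<eta>\<^sup>2 / 2) * exp (- \<mu>\<^sup>2 / 2))"
      unfolding exp_add[symmetric] by (rule arg_cong[of _ _ exp]) (simp add: add_divide_distrib)
    have s: "symbol 0 \<zeta> = 1" for \<zeta> by (simp add: symbol_def split: prod.split)
    have "cis (p \<bullet> packet_freq M (\<xi>, \<eta>, \<mu>)) * packet_amp 0 r n M (\<xi>, \<eta>, \<mu>) = packet_const M *
        of_real (exp (- (\<xi>\<^sup>2 + \<eta>\<^sup>2 + \<mu>\<^sup>2) / 2)) *
        (cis (p \<bullet> packet_freq M (\<xi>, \<eta>, \<mu>)) * cis (- ((r * M ^ 10, n, 0) \<bullet> packet_freq M (\<xi>, \<eta>, \<mu>))))"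
      unfolding packet_amp_def prod.case s by (simp only: mult_ac mult_1_left mult_1_right)
    then show ?thesis unfolding c e g_def by (simp only: of_real_mult mult_ac)
  qed
  have "packet 0 r n M [] p = (\<integral>\<omega>. packet_const M * cis ((p2 - n) * M ^ 5) *
      (case \<omega> of (\<xi>, \<eta>, \<mu>) \<Rightarrow> g a \<xi> * (g ((p2 - n) * M) \<eta> * g (p3 * M ^ 3) \<mu>)) \<partial>lborel)"
    unfolding packet_def osc_integral_def freq_factor_Nil mult_1_right
    by (rule Bochner_Integration.integral_cong[OF refl]) (auto simp only: eq split: prod.split)
  also have "\<dots> = packet_const M * cis ((p2 - n) * M ^ 5) *
      (of_real (sqrt (2 * pi) * exp (- a\<^sup>2 / 2)) * (of_real (sqrt (2 * pi) * exp (- ((p2 - n) * M)\<^sup>2 / 2)) *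
       of_real (sqrt (2 * pi) * exp (- (p3 * M ^ 3)\<^sup>2 / 2))))"
    unfolding integral_mult_right_zero lborel_integral_prod3(2)[OF g(1) g(1) g(1)] g(2) ..
  also have "\<dots> = (packet_const M * of_real (sqrt (2 * pi)) ^ 3) *
      (wave (r * M ^ 10) 0 (1 / M ^ 7) p1 * (wave n (M ^ 5) M p2 * wave 0 0 (M ^ 3) p3))"
    unfolding wave_def a_def by (simp add: power3_eq_cube mult_ac del: of_real_exp)
  also have "packet_const M * of_real (sqrt (2 * pi)) ^ 3 = - \<i> / of_real (M ^ 4)"
    by (simp add: packet_const_def power_divide power_mult_distrib flip: of_real_power)
  finally show ?thesis by (simp add: p)
qed

text \<open>The Fourier transform of the initial packet divided by (2 pi)^3, in the original
  frequencies. The factor M^3 is the inverse Jacobian of \<open>packet_freq\<close>; the terms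
  \<open>0 - a\<close> and \<open>0 * c\<close> keep the literal shape of
  \<open>fourier_wave\<close>.\<close>

definition packet_dual :: "real \<Rightarrow> real \<Rightarrow> real \<Rightarrow> R3 \<Rightarrow> complex" where
  "packet_dual r n M = (\<lambda>(a, b, c). of_real (M ^ 3) * packet_const M *
     ((cis (- (r * M ^ 10 * a)) * of_real (exp (- ((0 - a) / (1 / M ^ 7))\<^sup>2 / 2))) *
     ((cis (- (n * b)) * of_real (exp (- ((M ^ 5 - b) / M)\<^sup>2 / 2))) *
      (cis (- (0 * c)) * of_real (exp (- ((0 - c) / M ^ 3)\<^sup>2 / 2))))))"

text \<open>The explicit product of Gaussians has amplitude M^-4 and effective volume M^7 M^-1 M^-3
  = M^3. The resulting mass 1/M is what makes the series of packets converge in L^1.\<close>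

lemma integrable_packet_initial:
  assumes "M \<ge> 1"
  shows "integrable lborel (packet 0 r n M [])"
    and "(\<integral>p. norm (packet 0 r n M [] p) \<partial>lborel) = sqrt (2 * pi) ^ 3 / M"
proof -
  have M0: "M > 0" using assms by simp
  let ?w1 = "wave (r * M ^ 10) 0 (1 / M ^ 7)" and ?w2 = "wave n (M ^ 5) M" and ?w3 = "wave 0 0 (M ^ 3)"
  have i: "integrable lborel ?w1" "integrable lborel ?w2" "integrable lborel ?w3"
    using M0 by (auto intro: integrable_wave)
  show "integrable lborel (packet 0 r n M [])"
    unfolding packet_initial[OF assms, abs_def]
    by (intro integrable_mult_right lborel_integral_prod3(1)[OF i])
  have "(\<integral>p. norm (packet 0 r n M [] p) \<partial>lborel) =
      (\<integral>p. 1 / M ^ 4 * (case p of (a, b, c) \<Rightarrow> norm (?w1 a) * (norm (?w2 b) * norm (?w3 c))) \<partial>lborel)"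
    unfolding packet_initial[OF assms]
    by (rule Bochner_Integration.integral_cong[OF refl])
       (use M0 in \<open>auto simp: norm_mult norm_divide norm_power split: prod.split\<close>)
  also have "\<dots> = 1 / M ^ 4 * (sqrt (2 * pi) / (1 / M ^ 7) * (sqrt (2 * pi) / M * (sqrt (2 * pi) / M ^ 3)))"
    unfolding integral_mult_right_zero lborel_integral_prod3(2)[OF integrable_norm[OF i(1)] integrable_norm[OF i(2)] integrable_norm[OF i(3)]]
    using M0 by (simp add: integral_norm_wave)
  also have "\<dots> = sqrt (2 * pi) ^ 3 / M"
    using M0 by (simp add: field_simps power3_eq_cube numeral_eq_Suc del: real_sqrt_mult_self)
  finally show "(\<integral>p. norm (packet 0 r n M [] p) \<partial>lborel) = sqrt (2 * pi) ^ 3 / M" .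
qed

lemma fourier_packet_initial:
  assumes "M \<ge> 1"
  shows "(\<integral>p. cis (- (p \<bullet> \<zeta>)) * packet 0 r n M [] p \<partial>lborel) = complex_of_real ((2 * pi) ^ 3) * packet_dual r n M \<zeta>"
proof -
  have M0: "M > 0" using assms by simp
  obtain z1 z2 z3 where z: "\<zeta> = (z1, z2, z3)" by (cases \<zeta>) auto
  let ?w1 = "\<lambda>x. cis (- (x * z1)) * wave (r * M ^ 10) 0 (1 / M ^ 7) x"
    and ?w2 = "\<lambda>x. cis (- (x * z2)) * wave n (M ^ 5) M x" and ?w3 = "\<lambda>x. cis (- (x * z3)) * wave 0 0 (M ^ 3) x"
  have iw: "integrable lborel (\<lambda>x. cis (- (x * z)) * wave b e c x)" if "c > 0" for z b e c
  proof (rule Bochner_Integration.integrable_bound)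
    show "integrable lborel (wave b e c)" by (rule integrable_wave) (use that in simp)
    show "(\<lambda>x. cis (- (x * z)) * wave b e c x) \<in> borel_measurable lborel"
      unfolding wave_def by measurable
  qed (use that in \<open>auto simp: norm_mult\<close>)
  have i: "integrable lborel ?w1" "integrable lborel ?w2" "integrable lborel ?w3"
    by (rule iw; use M0 in simp)+
  have "(\<integral>p. cis (- (p \<bullet> \<zeta>)) * packet 0 r n M [] p \<partial>lborel) =
      (\<integral>p. - \<i> / of_real (M ^ 4) * (case p of (a, b, c) \<Rightarrow> ?w1 a * (?w2 b * ?w3 c)) \<partial>lborel)"
  proof (rule Bochner_Integration.integral_cong[OF refl])
    fix p :: R3
    obtain a b c where p: "p = (a, b, c)" by (cases p) auto
    have "cis (- (p \<bullet> \<zeta>)) = cis (- (a * z1)) * (cis (- (b * z2)) * cis (- (c * z3)))"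
      unfolding cis_mult by (simp add: p z algebra_simps)
    then show "cis (- (p \<bullet> \<zeta>)) * packet 0 r n M [] p =
        - \<i> / of_real (M ^ 4) * (case p of (a, b, c) \<Rightarrow> ?w1 a * (?w2 b * ?w3 c))"
      unfolding packet_initial[OF assms] p prod.case by (simp only: mult_ac)
  qed
  also have "\<dots> = - \<i> / of_real (M ^ 4) *
     ((cis (- (r * M ^ 10 * z1)) * of_real (sqrt (2 * pi) / (1 / M ^ 7) * exp (- ((0 - z1) / (1 / M ^ 7))\<^sup>2 / 2))) *
     ((cis (- (n * z2)) * of_real (sqrt (2 * pi) / M * exp (- ((M ^ 5 - z2) / M)\<^sup>2 / 2))) *
      (cis (- (0 * z3)) * of_real (sqrt (2 * pi) / M ^ 3 * exp (- ((0 - z3) / M ^ 3)\<^sup>2 / 2)))))"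
    unfolding integral_mult_right_zero lborel_integral_prod3(2)[OF i]
    using M0 by (simp only: fourier_wave zero_less_power zero_less_divide_1_iff)
  also have "\<dots> = (- \<i> / of_real (M ^ 4) * of_real (sqrt (2 * pi) / (1 / M ^ 7) * (sqrt (2 * pi) / M * (sqrt (2 * pi) / M ^ 3)))) *
     ((cis (- (r * M ^ 10 * z1)) * of_real (exp (- ((0 - z1) / (1 / M ^ 7))\<^sup>2 / 2))) *
     ((cis (- (n * z2)) * of_real (exp (- ((M ^ 5 - z2) / M)\<^sup>2 / 2))) *
      (cis (- (0 * z3)) * of_real (exp (- ((0 - z3) / M ^ 3)\<^sup>2 / 2)))))"
    by (simp only: of_real_mult mult_ac)
  also have "- \<i> / of_real (M ^ 4) * complex_of_real (sqrt (2 * pi) / (1 / M ^ 7) * (sqrt (2 * pi) / M * (sqrt (2 * pi) / M ^ 3))) =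
      complex_of_real ((2 * pi) ^ 3) * (of_real (M ^ 3) * packet_const M)"
  proof -
    have "1 / M ^ 4 * (sqrt (2 * pi) / (1 / M ^ 7) * (sqrt (2 * pi) / M * (sqrt (2 * pi) / M ^ 3))) =
        (sqrt (2 * pi) * sqrt (2 * pi)) ^ 3 * (M ^ 3 * ((1 / sqrt (2 * pi)) ^ 3 / M ^ 4))"
      using M0 by (simp add: field_simps numeral_eq_Suc del: real_sqrt_mult_self)
    also have "sqrt (2 * pi) * sqrt (2 * pi) = 2 * pi" by simp
    finally have "complex_of_real (1 / M ^ 4 * (sqrt (2 * pi) / (1 / M ^ 7) * (sqrt (2 * pi) / M * (sqrt (2 * pi) / M ^ 3)))) =
      complex_of_real ((2 * pi) ^ 3 * (M ^ 3 * ((1 / sqrt (2 * pi)) ^ 3 / M ^ 4)))" by (rule arg_cong)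
    then have "- \<i> * (complex_of_real (1 / M ^ 4) * complex_of_real (sqrt (2 * pi) / (1 / M ^ 7) * (sqrt (2 * pi) / M * (sqrt (2 * pi) / M ^ 3)))) =
      - \<i> * (complex_of_real ((2 * pi) ^ 3) * (of_real (M ^ 3) * of_real ((1 / sqrt (2 * pi)) ^ 3 / M ^ 4)))"
      by (simp only: of_real_mult)
    moreover have "- \<i> / of_real (M ^ 4) = - \<i> * complex_of_real (1 / M ^ 4)" by (simp add: divide_inverse)
    ultimately show ?thesis unfolding packet_const_def by (simp only: mult_ac)
  qed
  finally show ?thesis by (simp only: packet_dual_def z prod.case mult.assoc)
qed

lemma Basis_R3: "(Basis :: R3 set) = {(1, 0, 0), (0, 1, 0), (0, 0, 1)}"
  by (auto simp: Basis_prod_def zero_prod_def)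

text \<open>Substitution by a diagonal affine map with determinant M^-7 M M^3 = M^-3.\<close>

lemma integral_packet_freq:
  fixes F :: "R3 \<Rightarrow> complex"
  assumes "M \<ge> 1" and [measurable]: "F \<in> borel_measurable borel"
  shows "(\<integral>\<zeta>. F \<zeta> \<partial>lborel) = (\<integral>\<omega>. of_real (1 / M ^ 3) * F (packet_freq M \<omega>) \<partial>lborel)"
    and "integrable lborel (\<lambda>\<omega>. F (packet_freq M \<omega>)) \<Longrightarrow> integrable lborel F"
proof -
  have M0: "M > 0" using assms by simp
  define d :: R3 where "d = (1 / M ^ 7, M, M ^ 3)"
  define T where "T x = (0, M ^ 5, 0) + (\<Sum>j\<in>Basis. ((j \<bullet> d) * (x \<bullet> j)) *\<^sub>R j)" for x :: R3
  have T: "T = packet_freq M"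
    using M0 by (auto simp: fun_eq_iff T_def packet_freq_def Basis_R3 d_def)
  have "lborel = density (distr lborel borel T) (\<lambda>_. ennreal (\<Prod>j\<in>Basis. \<bar>j \<bullet> d\<bar>))"
    unfolding T_def by (rule lborel_affine_euclidean) (use M0 in \<open>auto simp: Basis_R3 d_def\<close>)
  also have "(\<Prod>j\<in>Basis. \<bar>j \<bullet> d\<bar>) = 1 / M ^ 3"
    using M0 by (simp add: Basis_R3 d_def field_simps numeral_eq_Suc)
  finally have eq: "lborel = density (distr lborel borel (packet_freq M)) (\<lambda>_. ennreal (1 / M ^ 3))"
    unfolding T .
  show "(\<integral>\<zeta>. F \<zeta> \<partial>lborel) = (\<integral>\<omega>. of_real (1 / M ^ 3) * F (packet_freq M \<omega>) \<partial>lborel)"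
    by (subst eq) (use M0 in \<open>simp add: integral_density integral_distr scaleR_conv_of_real\<close>)
  assume "integrable lborel (\<lambda>\<omega>. F (packet_freq M \<omega>))"
  then show "integrable lborel F"
    by (subst eq) (use M0 in \<open>simp add: integrable_density integrable_distr_eq\<close>)
qed

lemma packet_amp_eq_dual:
  assumes "M \<ge> 1"
  shows "packet_amp t r n M \<omega> = of_real (1 / M ^ 3) * (symbol t (packet_freq M \<omega>) * packet_dual r n M (packet_freq M \<omega>))"
proof -
  have M0: "M > 0" using assms by simp
  obtain \<xi> \<eta> \<mu> where \<omega>: "\<omega> = (\<xi>, \<eta>, \<mu>)" by (cases \<omega>) auto
  have e: "exp (- (\<xi>\<^sup>2 + \<eta>\<^sup>2 + \<mu>\<^sup>2) / 2) = exp (- \<xi>\<^sup>2 / 2) * (exp (- \<eta>\<^sup>2 / 2) * exp (- \<mu>\<^sup>2 / 2))"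
    unfolding exp_add[symmetric] by (rule arg_cong[of _ _ exp]) (simp add: add_divide_distrib)
  have c: "cis (- ((r * M ^ 10, n, 0) \<bullet> (a, b, c))) = cis (- (r * M ^ 10 * a)) * (cis (- (n * b)) * cis (- (0 * c)))" for a b c
    unfolding cis_mult by simp
  have x: "(0 - \<xi> / M ^ 7) / (1 / M ^ 7) = - \<xi>" "(M ^ 5 - (M ^ 5 + M * \<eta>)) / M = - \<eta>" "(0 - M ^ 3 * \<mu>) / M ^ 3 = - \<mu>"
    using M0 by auto
  have m: "complex_of_real (1 / M ^ 3) * of_real (M ^ 3) = 1" using M0 by simp
  have "of_real (1 / M ^ 3) * (symbol t (packet_freq M \<omega>) * packet_dual r n M (packet_freq M \<omega>)) =
      (complex_of_real (1 / M ^ 3) * of_real (M ^ 3)) * packet_amp t r n M \<omega>"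
    unfolding \<omega> packet_amp_def packet_dual_def packet_freq_def prod.case c e x power2_minus
    by (simp only: of_real_mult mult_ac)
  then show ?thesis unfolding m by simp
qed

lemma borel_measurable_packet_dual:
  assumes "M \<ge> 1"
  shows "packet_dual r n M \<in> borel_measurable borel"
  unfolding packet_dual_def case_prod_unfold using assms
  by (intro borel_measurable_continuous_onI continuous_intros) auto

text \<open>Identifies the packet at time \<open>t\<close> with the function that the duality lemmas
  produce for the evolution of the initial packet.\<close>

lemma packet_eq_integral_dual:
  assumes "M \<ge> 1"
  shows "packet t r n M [] p = (\<integral>\<zeta>. cis (p \<bullet> \<zeta>) * (symbol t \<zeta> * packet_dual r n M \<zeta>) \<partial>lborel)"
proof -
  have "(\<lambda>\<zeta>. cis (p \<bullet> \<zeta>) * (symbol t \<zeta> * packet_dual r n M \<zeta>)) \<in> borel_measurable borel"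
    using borel_measurable_packet_dual[OF assms] by measurable
  from integral_packet_freq(1)[OF assms this] show ?thesis
    unfolding packet_def osc_integral_def freq_factor_Nil packet_amp_eq_dual[OF assms]
    by (simp only: mult_ac mult_1_right mult_1_left)
qed

lemma integrable_packet_dual:
  assumes "M \<ge> 1"
  shows "integrable lborel (packet_dual r n M)"
proof (rule integral_packet_freq(2)[OF assms])
  have M0: "M > 0" using assms by simp
  have "integrable lborel (\<lambda>\<omega>. norm (packet_amp 0 r n M \<omega>))"
    using packet_moments[OF assms, of 0 0 r n] by simp
  then have "integrable lborel (packet_amp 0 r n M)" by (rule integrable_norm_cancel) measurable
  then have "integrable lborel (\<lambda>\<omega>. of_real (M ^ 3) * packet_amp 0 r n M \<omega>)" by (rule integrable_mult_right)
  moreover have "of_real (M ^ 3) * packet_amp 0 r n M \<omega> = packet_dual r n M (packet_freq M \<omega>)" for \<omega>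
    unfolding packet_amp_eq_dual[OF assms] using M0 by (simp add: symbol_def split: prod.split)
  ultimately show "integrable lborel (\<lambda>\<omega>. packet_dual r n M (packet_freq M \<omega>))" by simp
qed (rule borel_measurable_packet_dual[OF assms])

text \<open>This is the function to which \<open>W t T\<close> applies \<open>T\<close> when tested
  on \<open>\<phi>\<close>. Boundedness and measurability suffice, because the datum is
  integrable.\<close>

lemma fourier_symbol_test_function:
  fixes \<phi> :: "R3 \<Rightarrow> complex"
  assumes "test_function \<phi>"
  obtains B where "B \<ge> 0" "\<And>p. norm (fourier (\<lambda>\<zeta>. symbol t \<zeta> * inverse_fourier \<phi> \<zeta>) p) \<le> B"
    and "fourier (\<lambda>\<zeta>. symbol t \<zeta> * inverse_fourier \<phi> \<zeta>) \<in> borel_measurable borel"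
proof
  have i: "integrable lborel (inverse_fourier \<phi>)" by (rule integrable_inverse_fourier_test_function[OF assms])
  then have [measurable]: "inverse_fourier \<phi> \<in> borel_measurable borel" "inverse_fourier \<phi> \<in> borel_measurable lborel"
    by auto
  show "0 \<le> (\<integral>\<zeta>. norm (inverse_fourier \<phi> \<zeta>) \<partial>lborel)" by simp
  show "norm (fourier (\<lambda>\<zeta>. symbol t \<zeta> * inverse_fourier \<phi> \<zeta>) p) \<le> (\<integral>\<zeta>. norm (inverse_fourier \<phi> \<zeta>) \<partial>lborel)" for p
    using norm_integral_cis_le[of lborel "\<lambda>x. - (x \<bullet> p)" "\<lambda>\<zeta>. symbol t \<zeta> * inverse_fourier \<phi> \<zeta>"]
    by (simp add: fourier_def norm_mult)
  have [measurable]: "(\<lambda>\<zeta>. symbol t \<zeta> * inverse_fourier \<phi> \<zeta>) \<in> borel_measurable lborel" by measurable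
  have "fourier (\<lambda>\<zeta>. symbol t \<zeta> * inverse_fourier \<phi> \<zeta>) \<in> borel_measurable lborel"
    unfolding fourier_def by measurable
  then show "fourier (\<lambda>\<zeta>. symbol t \<zeta> * inverse_fourier \<phi> \<zeta>) \<in> borel_measurable borel" by simp
qed

lemma integral_Re_packet_times_fourier:
  assumes "M \<ge> 1" "test_function \<phi>"
  shows "(\<integral>p. of_real (Re (packet 0 r n M [] p)) * fourier (\<lambda>\<zeta>. symbol t \<zeta> * inverse_fourier \<phi> \<zeta>) p \<partial>lborel) =
    (\<integral>p. of_real (Re (packet t r n M [] p)) * \<phi> p \<partial>lborel)"
proof -
  obtain B where B: "\<And>p. norm (fourier (\<lambda>\<zeta>. symbol t \<zeta> * inverse_fourier \<phi> \<zeta>) p) \<le> B"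
    "fourier (\<lambda>\<zeta>. symbol t \<zeta> * inverse_fourier \<phi> \<zeta>) \<in> borel_measurable borel"
    using fourier_symbol_test_function[OF assms(2), of t] by metis
  show ?thesis
    by (rule integral_Re_times_fourier_symbol[OF integrable_packet_initial(1)[OF assms(1)] integrable_packet_dual[OF assms(1)]
      fourier_packet_initial[OF assms(1)] assms(2) B continuous_on_packet[OF assms(1)] packet_eq_integral_dual[OF assms(1)]])
qed

text \<open>At time \<open>r\<close> transport exactly cancels the initial shift. Within a fraction
  \<open>\<delta>\<close> of the length M^-5 set by the frequency, the remaining phase is of order
  \<delta> + r/M times a polynomial weight, so the integrand is close to M times a probability
  density.\<close>

lemma packet_derivative_at_focus:
  assumes M: "M \<ge> 1" and \<delta>: "\<delta> \<ge> 0" and r: "r \<ge> 0" and p: "norm (p - (0, n, 0)) \<le> \<delta> / M ^ 5"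
  shows "norm (packet r r n M [(0, 1, 0)] p - of_real M) \<le> gauss_const 3 * (5 * \<delta> * M + 5 * r + 1)"
proof -
  have M0: "M > 0" using M by simp
  obtain p1 p2 p3 where pp: "p = (p1, p2, p3)" by (cases p) auto
  have "\<bar>p1\<bar> \<le> norm (p - (0, n, 0))" "\<bar>p2 - n\<bar> \<le> norm (p - (0, n, 0))" "\<bar>p3\<bar> \<le> norm (p - (0, n, 0))"
    using norm_fst_le[of p1 "(p2 - n, p3)"] norm_snd_le[of "(p2 - n, p3)" p1] norm_fst_le[of "p2 - n" p3] norm_snd_le[of p3 "p2 - n"]
    by (auto simp: pp)
  then have "\<bar>p1\<bar> \<le> \<delta> / M ^ 5" "\<bar>p2 - n\<bar> \<le> \<delta> / M ^ 5" "\<bar>p3\<bar> \<le> \<delta> / M ^ 5" using p by auto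
  then have b: "\<bar>p1\<bar> * M ^ 5 \<le> \<delta>" "\<bar>p2 - n\<bar> * M ^ 5 \<le> \<delta>" "\<bar>p3\<bar> * M ^ 5 \<le> \<delta>"
    using M0 by (auto simp: pos_le_divide_eq)
  define c where "c = (1 / sqrt (2 * pi)) ^ 3"
  have c: "0 \<le> c" "c \<le> 1"
    unfolding c_def using pi_gt3 by (auto intro!: power_le_one simp: real_le_rsqrt)
  \<comment> \<open>The standard normal density on the rescaled frequency space: its mass is 1, so
    the main term is exactly \<open>M\<close>.\<close>
  define g where "g \<omega> = (case \<omega> of (\<xi>, \<eta>, \<mu>) \<Rightarrow> c * exp (- (\<xi>\<^sup>2 + \<eta>\<^sup>2 + \<mu>\<^sup>2) / 2))" for \<omega> :: R3
  have g_eq: "g = (\<lambda>(\<xi>, \<eta>, \<mu>). std_normal_density \<xi> * (std_normal_density \<eta> * std_normal_density \<mu>))"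
  proof -
    have "exp (- (\<xi>\<^sup>2 + \<eta>\<^sup>2 + \<mu>\<^sup>2) / 2) = exp (- \<xi>\<^sup>2 / 2) * (exp (- \<eta>\<^sup>2 / 2) * exp (- \<mu>\<^sup>2 / 2))" for \<xi> \<eta> \<mu> :: real
      unfolding exp_add[symmetric] by (rule arg_cong[of _ _ exp]) (simp add: add_divide_distrib)
    then show ?thesis by (auto simp: fun_eq_iff g_def c_def std_normal_density_def power3_eq_cube)
  qed
  have nd: "integrable lborel std_normal_density" "integral\<^sup>L lborel std_normal_density = 1" by auto
  have g: "integrable lborel g" "integral\<^sup>L lborel g = 1"
    unfolding g_eq using lborel_integral_prod3[OF nd(1) nd(1) nd(1)] nd(2) by simp_all
  \<comment> \<open>The total phase after the terms r M^3 \<xi> have cancelled: three terms from the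
    displacement from the focus, then the dispersion with its factor r/M.\<close>
  define \<Theta> where "\<Theta> \<omega> = (case \<omega> of (\<xi>, \<eta>, \<mu>) \<Rightarrow> p1 * \<xi> / M ^ 7 + (p2 - n) * (M ^ 5 + M * \<eta>) + p3 * (M ^ 3 * \<mu>) +
      r / M * (2 * \<xi> * \<eta> + \<xi> * \<eta>\<^sup>2 / M ^ 4 + \<xi> * \<mu>\<^sup>2 + \<xi> ^ 3 / M ^ 20))" for \<omega> :: R3
  have integrand: "cis (p \<bullet> packet_freq M \<omega>) * freq_factor [(0, 1, 0)] (packet_freq M \<omega>) * packet_amp r r n M \<omega> =
      of_real ((M + fst (snd \<omega>) / M ^ 3) * g \<omega>) * cis (\<Theta> \<omega>)" for \<omega>
  proof -
    obtain \<xi> \<eta> \<mu> where \<omega>: "\<omega> = (\<xi>, \<eta>, \<mu>)" by (cases \<omega>) auto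
    have "p \<bullet> packet_freq M \<omega> + (- ((r * M ^ 10, n, 0) \<bullet> packet_freq M \<omega>) +
        r * (\<xi> / M ^ 7) * ((\<xi> / M ^ 7)\<^sup>2 + ((M ^ 5 + M * \<eta>)\<^sup>2 + (M ^ 3 * \<mu>)\<^sup>2))) = \<Theta> \<omega>"
      using M0 by (simp add: pp \<omega> packet_freq_def \<Theta>_def field_simps power2_eq_square power3_eq_cube numeral_eq_Suc)
    then have 1: "cis (p \<bullet> packet_freq M \<omega>) * (cis (- ((r * M ^ 10, n, 0) \<bullet> packet_freq M \<omega>)) * symbol r (packet_freq M \<omega>)) = cis (\<Theta> \<omega>)"
      by (simp add: \<omega> packet_freq_def symbol_eq cis_mult)
    \<comment> \<open>The i of the derivative meets the -i of \<open>packet_const\<close>, and M^5 /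
      M^4 = M.\<close>
    have 2: "freq_factor [(0, 1, 0)] (packet_freq M \<omega>) * packet_const M = of_real ((M + \<eta> / M ^ 3) * c)"
    proof -
      have "(M ^ 5 + M * \<eta>) * (c / M ^ 4) = (M + \<eta> / M ^ 3) * c"
        using M0 by (simp add: field_simps numeral_eq_Suc)
      then have "complex_of_real ((M ^ 5 + M * \<eta>) * (c / M ^ 4)) = of_real ((M + \<eta> / M ^ 3) * c)" by simp
      then show ?thesis unfolding packet_const_def c_def[symmetric] \<omega> packet_freq_def by (simp add: mult_ac)
    qed
    have "cis (p \<bullet> packet_freq M \<omega>) * freq_factor [(0, 1, 0)] (packet_freq M \<omega>) * packet_amp r r n M \<omega> =
        (freq_factor [(0, 1, 0)] (packet_freq M \<omega>) * packet_const M) * of_real (exp (- (\<xi>\<^sup>2 + \<eta>\<^sup>2 + \<mu>\<^sup>2) / 2)) *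
        (cis (p \<bullet> packet_freq M \<omega>) * (cis (- ((r * M ^ 10, n, 0) \<bullet> packet_freq M \<omega>)) * symbol r (packet_freq M \<omega>)))"
      unfolding packet_amp_def \<omega> prod.case by (simp only: mult_ac)
    then show ?thesis unfolding 1 2 by (simp add: \<omega> g_def mult_ac del: of_real_exp)
  qed
  let ?f = "\<lambda>\<omega>. of_real ((M + fst (snd \<omega>) / M ^ 3) * g \<omega>) * cis (\<Theta> \<omega>)"
  have If: "integrable lborel ?f"
    using integrable_osc[of "packet_freq M" lborel "packet_amp r r n M" p "[(0, 1, 0)]"] packet_moments[OF M]
    unfolding integrand by simp
  have pk: "packet r r n M [(0, 1, 0)] p = integral\<^sup>L lborel ?f"
    unfolding packet_def osc_integral_def integrand ..
  have Ig: "integrable lborel (\<lambda>\<omega>. complex_of_real (M * g \<omega>))" "(\<integral>\<omega>. complex_of_real (M * g \<omega>) \<partial>lborel) = of_real M"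
    using g by (auto simp del: of_real_mult simp: integral_complex_of_real)
  have "packet r r n M [(0, 1, 0)] p - of_real M = (\<integral>\<omega>. ?f \<omega> - of_real (M * g \<omega>) \<partial>lborel)"
    unfolding pk Ig(2)[symmetric] by (rule Bochner_Integration.integral_diff[OF If Ig(1), symmetric])
  also have "norm \<dots> \<le> (\<integral>\<omega>. (5 * \<delta> * M + 5 * r + 1) * gauss_wt3 3 \<omega> \<partial>lborel)"
  proof (rule order_trans[OF integral_norm_bound integral_mono])
    show "integrable lborel (\<lambda>\<omega>. norm (?f \<omega> - of_real (M * g \<omega>)))"
      by (intro integrable_norm Bochner_Integration.integrable_diff If Ig)
    show "integrable lborel (\<lambda>\<omega>. (5 * \<delta> * M + 5 * r + 1) * gauss_wt3 3 \<omega>)"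
      by (intro integrable_mult_right integrable_gauss_wt3)
    fix \<omega> :: R3
    obtain \<xi> \<eta> \<mu> where \<omega>: "\<omega> = (\<xi>, \<eta>, \<mu>)" by (cases \<omega>) auto
    define x y z where "x = 2 + \<bar>\<xi>\<bar>" and "y = 2 + \<bar>\<eta>\<bar>" and "z = 2 + \<bar>\<mu>\<bar>"
    have xyz: "x \<ge> 2" "y \<ge> 2" "z \<ge> 2" "\<bar>\<xi>\<bar> \<le> x" "\<bar>\<eta>\<bar> \<le> y" "\<bar>\<mu>\<bar> \<le> z" by (auto simp: x_def y_def z_def)
    \<comment> \<open>No variable occurs in the phase with a power above 3, so this cube dominates
      all its monomials; hence the index 3 in \<open>gauss_const 3\<close>.\<close>
    define G where "G = (x * y * z) ^ 3"
    have mono: "a ^ i * b ^ j * d ^ k \<le> G" if "0 \<le> a" "a \<le> x" "0 \<le> b" "b \<le> y" "0 \<le> d" "d \<le> z" "i \<le> 3" "j \<le> 3" "k \<le> 3" for a b d i j k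
    proof -
      have "a ^ i \<le> x ^ 3" "b ^ j \<le> y ^ 3" "d ^ k \<le> z ^ 3"
        using that xyz by (auto intro!: order_trans[OF power_mono power_increasing])
      then have "a ^ i * b ^ j * d ^ k \<le> x ^ 3 * y ^ 3 * z ^ 3"
        using that xyz by (intro mult_mono) auto
      then show ?thesis by (simp add: G_def power_mult_distrib)
    qed
    have G: "\<bar>\<xi>\<bar> \<le> G" "\<bar>\<eta>\<bar> \<le> G" "\<bar>\<mu>\<bar> \<le> G" "1 \<le> G" "\<bar>\<xi>\<bar> * \<bar>\<eta>\<bar> \<le> G" "\<bar>\<xi>\<bar> * \<eta>\<^sup>2 \<le> G" "\<bar>\<xi>\<bar> * \<mu>\<^sup>2 \<le> G" "\<bar>\<xi>\<bar> ^ 3 \<le> G"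
    proof -
      have mono': "\<bar>\<xi>\<bar> ^ i * \<bar>\<eta>\<bar> ^ j * \<bar>\<mu>\<bar> ^ k \<le> G" if "i \<le> 3" "j \<le> 3" "k \<le> 3" for i j k
        by (rule mono) (use that xyz in auto)
      show "\<bar>\<xi>\<bar> \<le> G" using mono'[of 1 0 0] by simp
      show "\<bar>\<eta>\<bar> \<le> G" using mono'[of 0 1 0] by simp
      show "\<bar>\<mu>\<bar> \<le> G" using mono'[of 0 0 1] by simp
      show "1 \<le> G" using mono'[of 0 0 0] by simp
      show "\<bar>\<xi>\<bar> * \<bar>\<eta>\<bar> \<le> G" using mono'[of 1 1 0] by simp
      show "\<bar>\<xi>\<bar> * \<eta>\<^sup>2 \<le> G" using mono'[of 1 2 0] by simp
      show "\<bar>\<xi>\<bar> * \<mu>\<^sup>2 \<le> G" using mono'[of 1 0 2] by simp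
      show "\<bar>\<xi>\<bar> ^ 3 \<le> G" using mono'[of 3 0 0] by simp
    qed
    have Th: "\<bar>\<Theta> \<omega>\<bar> \<le> 5 * (\<delta> + r / M) * G"
    proof -
      have M5: "1 / M ^ 7 \<le> M ^ 5" "M \<le> M ^ 5" "M ^ 3 \<le> M ^ 5" "1 / M ^ 4 \<le> 1" "1 / M ^ 20 \<le> 1"
      proof -
        have "1 / M ^ 7 \<le> 1" "1 \<le> M ^ 5" using M by (auto simp: one_le_power divide_le_eq)
        then show "1 / M ^ 7 \<le> M ^ 5" by linarith
        show "M \<le> M ^ 5" "M ^ 3 \<le> M ^ 5" "1 / M ^ 4 \<le> 1" "1 / M ^ 20 \<le> 1"
          using M power_increasing[of 1 5 M] power_increasing[of 3 5 M] by (auto simp: one_le_power divide_le_eq)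
      qed
      have t1: "\<bar>p1 * \<xi> / M ^ 7\<bar> \<le> \<delta> * G"
      proof -
        have "\<bar>p1 * \<xi> / M ^ 7\<bar> = (\<bar>p1\<bar> * (1 / M ^ 7)) * \<bar>\<xi>\<bar>" using M0 by (simp add: abs_mult)
        also have "\<dots> \<le> (\<bar>p1\<bar> * M ^ 5) * \<bar>\<xi>\<bar>" by (intro mult_right_mono mult_left_mono M5 abs_ge_zero)
        also have "\<dots> \<le> \<delta> * G" by (rule mult_mono[OF b(1) G(1) \<delta> abs_ge_zero])
        finally show ?thesis .
      qed
      have t2: "\<bar>(p2 - n) * (M ^ 5 + M * \<eta>)\<bar> \<le> \<delta> * G + \<delta> * G"
      proof -
        have "\<bar>(p2 - n) * (M ^ 5 + M * \<eta>)\<bar> = \<bar>(p2 - n) * M ^ 5 + (p2 - n) * M * \<eta>\<bar>" by (simp add: algebra_simps)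
        also have "\<dots> \<le> \<bar>p2 - n\<bar> * M ^ 5 + (\<bar>p2 - n\<bar> * M) * \<bar>\<eta>\<bar>"
          using M0 by (intro order_trans[OF abs_triangle_ineq]) (simp add: abs_mult)
        also have "\<dots> \<le> \<bar>p2 - n\<bar> * M ^ 5 * 1 + (\<bar>p2 - n\<bar> * M ^ 5) * \<bar>\<eta>\<bar>"
          unfolding mult_1_right by (intro add_left_mono mult_right_mono mult_left_mono M5 abs_ge_zero)
        also have "\<dots> \<le> \<delta> * G + \<delta> * G"
          by (intro add_mono mult_mono[OF b(2) G(4) \<delta> zero_le_one] mult_mono[OF b(2) G(2) \<delta> abs_ge_zero])
        finally show ?thesis .
      qed
      have t3: "\<bar>p3 * (M ^ 3 * \<mu>)\<bar> \<le> \<delta> * G"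
      proof -
        have "\<bar>p3 * (M ^ 3 * \<mu>)\<bar> = (\<bar>p3\<bar> * M ^ 3) * \<bar>\<mu>\<bar>" using M0 by (simp add: abs_mult)
        also have "\<dots> \<le> (\<bar>p3\<bar> * M ^ 5) * \<bar>\<mu>\<bar>" by (intro mult_right_mono mult_left_mono M5 abs_ge_zero)
        also have "\<dots> \<le> \<delta> * G" by (rule mult_mono[OF b(3) G(3) \<delta> abs_ge_zero])
        finally show ?thesis .
      qed
      have s: "\<bar>2 * \<xi> * \<eta> + \<xi> * \<eta>\<^sup>2 / M ^ 4 + \<xi> * \<mu>\<^sup>2 + \<xi> ^ 3 / M ^ 20\<bar> \<le> 5 * G"
      proof -
        have "\<bar>\<xi> * \<eta>\<^sup>2 / M ^ 4\<bar> \<le> G"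
        proof -
          have "\<bar>\<xi> * \<eta>\<^sup>2 / M ^ 4\<bar> = (\<bar>\<xi>\<bar> * \<eta>\<^sup>2) * (1 / M ^ 4)"
            using M0 by (simp only: abs_divide abs_mult abs_power2 power_abs[of M] abs_of_pos times_divide_eq_right mult_1_right)
          also have "\<dots> \<le> G * 1" by (rule mult_mono[OF G(6) M5(4)]) (use G(4) M0 in simp_all)
          finally show ?thesis by simp
        qed
        moreover have "\<bar>\<xi> ^ 3 / M ^ 20\<bar> \<le> G"
        proof -
          have "\<bar>\<xi> ^ 3 / M ^ 20\<bar> = \<bar>\<xi>\<bar> ^ 3 * (1 / M ^ 20)"
            using M0 by (simp only: abs_divide power_abs abs_of_pos times_divide_eq_right mult_1_right)
          also have "\<dots> \<le> G * 1" by (rule mult_mono[OF G(8) M5(5)]) (use G(4) M0 in simp_all)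
          finally show ?thesis by simp
        qed
        moreover have "\<bar>2 * \<xi> * \<eta>\<bar> \<le> 2 * G" "\<bar>\<xi> * \<mu>\<^sup>2\<bar> \<le> G"
          using G(5) G(7) by (simp_all add: abs_mult)
        ultimately show ?thesis by linarith
      qed
      have t4: "\<bar>r / M * (2 * \<xi> * \<eta> + \<xi> * \<eta>\<^sup>2 / M ^ 4 + \<xi> * \<mu>\<^sup>2 + \<xi> ^ 3 / M ^ 20)\<bar> \<le> r / M * (5 * G)"
        unfolding abs_mult[of "r / M"] using r M0 by (intro mult_mono s) simp_all
      have tri: "\<bar>a + b + d + e\<bar> \<le> A + B + D + E"
        if "\<bar>a\<bar> \<le> A" "\<bar>b\<bar> \<le> B" "\<bar>d\<bar> \<le> D" "\<bar>e\<bar> \<le> E" for a b d e A B D E :: real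
        using that by linarith
      have "\<bar>\<Theta> \<omega>\<bar> \<le> \<delta> * G + (\<delta> * G + \<delta> * G) + \<delta> * G + r / M * (5 * G)"
        unfolding \<Theta>_def \<omega> prod.case by (rule tri[OF t1 t2 t3 t4])
      moreover have "0 \<le> \<delta> * G" using \<delta> G(4) by simp
      ultimately show ?thesis by (simp add: algebra_simps)
    qed
    have cis1: "norm (cis a - 1) \<le> \<bar>a\<bar>" for a
      using iexp_approx1[of a 0] by (simp add: cis_conv_exp)
    have g0: "0 \<le> g \<omega>" "g \<omega> \<le> exp (- (\<xi>\<^sup>2 + \<eta>\<^sup>2 + \<mu>\<^sup>2) / 4)"
    proof -
      show "0 \<le> g \<omega>" using c by (simp add: g_def \<omega>)
      have "c * exp (- (\<xi>\<^sup>2 + \<eta>\<^sup>2 + \<mu>\<^sup>2) / 2) \<le> 1 * exp (- (\<xi>\<^sup>2 + \<eta>\<^sup>2 + \<mu>\<^sup>2) / 4)"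
      proof (intro mult_mono)
        have "- S / 2 \<le> - S / 4" if "0 \<le> S" for S :: real using that by simp
        from this[of "\<xi>\<^sup>2 + \<eta>\<^sup>2 + \<mu>\<^sup>2"]
        show "exp (- (\<xi>\<^sup>2 + \<eta>\<^sup>2 + \<mu>\<^sup>2) / 2) \<le> exp (- (\<xi>\<^sup>2 + \<eta>\<^sup>2 + \<mu>\<^sup>2) / 4)"
          unfolding exp_le_cancel_iff by simp
      qed (use c in auto)
      then show "g \<omega> \<le> exp (- (\<xi>\<^sup>2 + \<eta>\<^sup>2 + \<mu>\<^sup>2) / 4)" by (simp add: g_def \<omega>)
    qed
    \<comment> \<open>The error splits into the oscillation of the phase, multiplied by M, and the
      deviation \<eta> / M^3 of the frequency from its mean.\<close>
    have "?f \<omega> - of_real (M * g \<omega>) = of_real (g \<omega>) * (of_real M * (cis (\<Theta> \<omega>) - 1) + of_real (\<eta> / M ^ 3) * cis (\<Theta> \<omega>))"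
      by (simp add: \<omega> algebra_simps)
    also have "norm \<dots> \<le> g \<omega> * (M * \<bar>\<Theta> \<omega>\<bar> + \<bar>\<eta>\<bar>)"
    proof -
      have "norm (of_real M * (cis (\<Theta> \<omega>) - 1) + of_real (\<eta> / M ^ 3) * cis (\<Theta> \<omega>)) \<le>
          M * norm (cis (\<Theta> \<omega>) - 1) + \<bar>\<eta> / M ^ 3\<bar>"
        using M0 by (intro order_trans[OF norm_triangle_ineq]) (simp add: norm_mult norm_divide norm_power)
      also have "\<dots> \<le> M * \<bar>\<Theta> \<omega>\<bar> + \<bar>\<eta>\<bar>"
      proof (intro add_mono mult_left_mono cis1)
        have "1 \<le> M ^ 3" using M by (simp add: one_le_power)
        then show "\<bar>\<eta> / M ^ 3\<bar> \<le> \<bar>\<eta>\<bar>"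
          using mult_left_mono[of 1 "M ^ 3" "\<bar>\<eta>\<bar>"] M0 by (simp add: pos_divide_le_eq)
      qed (use M0 in auto)
      finally show ?thesis unfolding norm_mult norm_of_real using g0 by (intro mult_mono) auto
    qed
    also have "\<dots> \<le> exp (- (\<xi>\<^sup>2 + \<eta>\<^sup>2 + \<mu>\<^sup>2) / 4) * (M * (5 * (\<delta> + r / M) * G) + G)"
      using M0 by (intro mult_mono[OF g0(2)] add_mono[OF mult_left_mono[OF Th] G(2)]) auto
    also have "M * (5 * (\<delta> + r / M) * G) + G = (5 * \<delta> * M + 5 * r + 1) * G"
      using M0 by (simp add: field_simps)
    also have "exp (- (\<xi>\<^sup>2 + \<eta>\<^sup>2 + \<mu>\<^sup>2) / 4) * ((5 * \<delta> * M + 5 * r + 1) * G) = (5 * \<delta> * M + 5 * r + 1) * gauss_wt3 3 \<omega>"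
      unfolding \<omega> gauss_wt3_eq G_def x_def y_def z_def by (simp only: mult_ac)
    finally show "norm (?f \<omega> - of_real (M * g \<omega>)) \<le> (5 * \<delta> * M + 5 * r + 1) * gauss_wt3 3 \<omega>" .
  qed
  also have "\<dots> = gauss_const 3 * (5 * \<delta> * M + 5 * r + 1)"
    by (simp add: gauss_const_def)
  finally show ?thesis .
qed

section \<open>The superposition of packets\<close>

text \<open>Double exponential growth makes each scale the square of the preceding one. This gap
  separates packets that focus at the same point.\<close>

definition packet_scale :: "nat \<Rightarrow> real" where
  "packet_scale j = 2 ^ (2 ^ j)"

lemma scale_Suc: "packet_scale (Suc j) = (packet_scale j)\<^sup>2"
  by (simp add: packet_scale_def power_mult[symmetric] mult.commute)

lemma scale_ge: "packet_scale j \<ge> real j + 1"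
proof -
  have "j + 1 \<le> 2 ^ j" for j :: nat by (induction j) auto
  from this[of j] this[of "2 ^ j"] have "j + 1 \<le> (2::nat) ^ (2 ^ j)" by linarith
  then have "real (j + 1) \<le> real (2 ^ (2 ^ j))" by (rule of_nat_mono)
  then show ?thesis by (simp add: packet_scale_def)
qed

lemma scale_ge_1 [simp]: "packet_scale j \<ge> 1" and scale_pos [simp]: "packet_scale j > 0"
  by (simp_all add: packet_scale_def)

lemma scale_nonneg [simp]: "packet_scale j \<ge> 0" and scale_nonzero [simp]: "packet_scale j \<noteq> 0"
  by (simp_all add: packet_scale_def)

lemma scale_mono: "i \<le> j \<Longrightarrow> packet_scale i \<le> packet_scale j"
  unfolding packet_scale_def by (intro power_increasing) auto

lemma scale_square_le: "i < j \<Longrightarrow> (packet_scale i)\<^sup>2 \<le> packet_scale j"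
  using scale_mono[of "Suc i" j] by (simp add: scale_Suc)

lemma sum_scale_le: "(\<Sum>i<Suc j. packet_scale i) \<le> 2 * packet_scale j"
proof (induction j)
  case (Suc j)
  have "packet_scale j \<ge> 2" using power_increasing[of 1 "2 ^ j" "2::real"] by (simp add: packet_scale_def)
  then have "2 * packet_scale j \<le> packet_scale (Suc j)" by (simp add: scale_Suc power2_eq_square)
  with Suc show ?case by simp
qed (simp add: packet_scale_def)

lemma summable_scale_exp:
  assumes "\<delta> > 0"
  shows "summable (\<lambda>j. packet_scale j ^ k * exp (- \<delta> * packet_scale j))"
proof (rule summable_comparison_test')
  \<comment> \<open>Half of the exponential absorbs the power through
    \<open>power_le_fact_exp\<close>; the other half is below a geometric sequence, since the scale
    exceeds its index.\<close>
  define C where "C = fact k * (2 / \<delta>) ^ k"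
  show "summable (\<lambda>j. C * exp (- \<delta> / 2) ^ j)"
    using assms by (intro summable_mult summable_geometric) simp
  show "norm (packet_scale j ^ k * exp (- \<delta> * packet_scale j)) \<le> C * exp (- \<delta> / 2) ^ j" if "j \<ge> 0" for j
  proof -
    have "packet_scale j ^ k = (2 / \<delta>) ^ k * (\<delta> / 2 * packet_scale j) ^ k"
      using assms by (simp add: power_mult_distrib[symmetric])
    also have "\<dots> \<le> (2 / \<delta>) ^ k * (fact k * exp (\<delta> / 2 * packet_scale j))"
      using assms by (intro mult_left_mono power_le_fact_exp) (auto intro: less_imp_le)
    finally have "packet_scale j ^ k * exp (- \<delta> * packet_scale j) \<le> (C * exp (\<delta> / 2 * packet_scale j)) * exp (- \<delta> * packet_scale j)"
      unfolding C_def by (intro mult_right_mono) (auto simp: mult_ac)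
    also have "\<dots> = C * exp (\<delta> / 2 * packet_scale j + - \<delta> * packet_scale j)" by (simp only: exp_add mult.assoc)
    also have "\<dots> = C * exp (- (\<delta> / 2 * packet_scale j))" by simp
    also have "\<dots> \<le> C * exp (- (\<delta> / 2 * j))"
    proof (intro mult_left_mono)
      have "\<delta> / 2 * j \<le> \<delta> / 2 * packet_scale j" using assms scale_ge[of j] by (intro mult_left_mono) auto
      then show "exp (- (\<delta> / 2 * packet_scale j)) \<le> exp (- (\<delta> / 2 * j))" by simp
    qed (use assms in \<open>simp add: C_def\<close>)
    also have "exp (- (\<delta> / 2 * j)) = exp (- \<delta> / 2) ^ j"
      by (simp add: exp_of_nat_mult[symmetric] mult.commute)
    finally have "packet_scale j ^ k * exp (- \<delta> * packet_scale j) \<le> C * exp (- \<delta> / 2) ^ j" .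
    moreover have "0 \<le> packet_scale j ^ k * exp (- \<delta> * packet_scale j)" by simp
    ultimately show ?thesis by (simp only: real_norm_def abs_of_nonneg)
  qed
qed

lemma summable_inverse_scale: "summable (\<lambda>j. 1 / packet_scale j)"
proof (rule summable_comparison_test')
  show "summable (\<lambda>j. (1 / 2 :: real) ^ j)" by (intro summable_geometric) simp
  show "norm (1 / packet_scale j) \<le> (1 / 2) ^ j" if "j \<ge> 0" for j
  proof -
    have "j \<le> 2 ^ j" by (rule less_imp_le[OF less_exp])
    then have "(2::real) ^ j \<le> packet_scale j" unfolding packet_scale_def by (intro power_increasing) auto
    then show ?thesis by (simp add: power_one_over frac_le)
  qed
qed

lemma inverse_scale_power_le: "1 / packet_scale j ^ Suc k \<le> 1 / packet_scale j"
  using power_increasing[of 1 "Suc k" "packet_scale j"] by (intro divide_left_mono) auto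

text \<open>An enumeration without repetition, so a focusing time determines its stage. Time 0 is
  left out, which places the datum itself among the regular times.\<close>

definition pos_rat :: "nat \<Rightarrow> real" where
  "pos_rat = from_nat_into (\<rat> \<inter> {0<..})"

lemma bij_betw_pos_rat: "bij_betw pos_rat UNIV (\<rat> \<inter> {0<..})"
proof -
  have "range (\<lambda>n. real (Suc n)) \<subseteq> \<rat> \<inter> {0<..}" by auto
  moreover have "infinite (range (\<lambda>n. real (Suc n)))"
    by (intro range_inj_infinite) (auto simp: inj_def)
  ultimately have "infinite (\<rat> \<inter> {0<..} :: real set)" using finite_subset by blast
  then show ?thesis
    unfolding pos_rat_def by (intro bij_betw_from_nat_into countable_Int1 countable_rat)
qed

lemma pos_rat_pos: "pos_rat n > 0"
  and range_pos_rat: "range pos_rat = \<rat> \<inter> {0<..}"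
  and pos_rat_eq_iff: "pos_rat m = pos_rat n \<longleftrightarrow> m = n"
  using bij_betw_pos_rat by (auto simp: bij_betw_def inj_def)

text \<open>Every positive rational is the focusing time of infinitely many packets.\<close>

definition stage :: "nat \<Rightarrow> nat" where
  "stage j = fst (prod_decode j)"

lemma stage_infinite: "\<exists>j>N. stage j = n"
proof (intro exI conjI)
  show "stage (prod_encode (n, Suc N)) = n" by (simp add: stage_def)
  show "prod_encode (n, Suc N) > N" using le_prod_encode_2[of "Suc N" n] by simp
qed

section \<open>The individual packets of the series and their summable majorants\<close>

definition pcomp :: "real \<Rightarrow> nat \<Rightarrow> R3 list \<Rightarrow> R3 \<Rightarrow> complex" where
  "pcomp t j = packet t (pos_rat (stage j)) (real (stage j)) (packet_scale j)"

lemma pcomp_has_derivative: "(pcomp t j vs has_derivative (\<lambda>h. pcomp t j (h # vs) p)) (at p)"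
  unfolding pcomp_def by (rule packet_has_derivative) simp

lemma continuous_on_pcomp: "continuous_on UNIV (pcomp t j vs)"
  unfolding pcomp_def by (rule continuous_on_packet) simp

lemma norm_pcomp_le:
  "norm (pcomp t j vs p) \<le>
    (3 ^ length vs * gauss_const (length vs)) * (packet_scale j ^ (5 * length vs) / packet_scale j ^ 4) * (\<Prod>v\<leftarrow>vs. norm v)"
  unfolding pcomp_def by (rule norm_packet_le) simp

lemma norm_pcomp_Nil_le: "norm (pcomp t j [] p) \<le> gauss_const 0 / packet_scale j ^ 4"
  using norm_pcomp_le[of t j "[]" p] by simp

text \<open>Terms outside \<open>J\<close> are set to 0 instead of being reindexed. One majorant
  lemma then serves the full series at a regular time and, at a focusing time, the series without
  the packets that focus there.\<close>

definition sub_pcomp :: "nat set \<Rightarrow> real \<Rightarrow> nat \<Rightarrow> R3 list \<Rightarrow> R3 \<Rightarrow> complex" where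
  "sub_pcomp J t j vs p = (if j \<in> J then pcomp t j vs p else 0)"

lemma sub_pcomp_has_derivative:
  "(sub_pcomp J t j vs has_derivative (\<lambda>h. sub_pcomp J t j (h # vs) p)) (at p)"
  using pcomp_has_derivative[of t j vs p] by (cases "j \<in> J") (auto simp: sub_pcomp_def[abs_def])

text \<open>Small scales are finitely many and get the crude bound. Among the others, stages below
  \<open>N\<close> decay by the distance of \<open>t\<close> to their finitely many focusing times,
  and later stages decay in y1. No rate of approximation of \<open>t\<close> by rationals enters,
  since \<open>d\<close> may depend on \<open>N\<close>.\<close>

lemma sub_pcomp_bounds:
  assumes J: "\<And>j. j \<in> J \<Longrightarrow> pos_rat (stage j) \<noteq> t"
  shows "\<exists>B. summable B \<and> (\<forall>j vs p. length vs = k \<longrightarrow> norm p \<le> R \<longrightarrow>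
    norm (sub_pcomp J t j vs p) \<le> B j * (\<Prod>v\<leftarrow>vs. norm v))"
proof -
  \<comment> \<open>The additional 1 keeps y1 at distance at least 1 from \<open>n\<close> whenever
    \<open>norm p \<le> R\<close> and \<open>n \<ge> N\<close>.\<close>
  define N where "N = nat \<lceil>\<bar>R\<bar> + 1\<rceil>"
  have N: "real n \<ge> \<bar>R\<bar> + 1" if "n \<ge> N" for n using that unfolding N_def by linarith
  obtain d where d: "d > 0" "\<And>x. x \<in> pos_rat ` {..<N} \<Longrightarrow> x \<noteq> t \<Longrightarrow> d \<le> dist t x"
    using finite_set_avoid[of "pos_rat ` {..<N}" t] by auto
  \<comment> \<open>A common rate for both mechanisms: \<open>d\<close> from the decay in time, 1
    from the distance in y1.\<close>
  define \<delta> where "\<delta> = min d 1"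
  have \<delta>: "\<delta> > 0" "\<delta> \<le> 1" "\<delta> \<le> d" using d by (auto simp: \<delta>_def)
  define C where "C = 3 ^ k * gauss_const k"
  have C: "C \<ge> 0" by (simp add: C_def)
  define T where "T = 16 * (\<bar>t\<bar> + 1)"
  define B where "B j = (C * exp (\<bar>R\<bar> + 1)) * (packet_scale j ^ (5 * k) * exp (- \<delta> * packet_scale j)) +
    (if packet_scale j < T then C * packet_scale j ^ (5 * k) else 0)" for j
  have "finite {j. packet_scale j < T}"
  proof (rule finite_subset)
    show "{j. packet_scale j < T} \<subseteq> {..nat \<lceil>T\<rceil>}"
    proof
      fix j assume "j \<in> {j. packet_scale j < T}"
      then have "real j < T" using scale_ge[of j] by simp
      then show "j \<in> {..nat \<lceil>T\<rceil>}" by simp linarith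
    qed
  qed simp
  then have "summable (\<lambda>j. if packet_scale j < T then C * packet_scale j ^ (5 * k) else 0)"
    by (rule summable_finite) auto
  then have "summable B"
    unfolding B_def by (intro summable_add summable_mult summable_scale_exp \<delta>)
  moreover have "norm (sub_pcomp J t j vs p) \<le> B j * (\<Prod>v\<leftarrow>vs. norm v)" if vs: "length vs = k" and p: "norm p \<le> R" for j vs p
  proof (cases "j \<in> J")
    case False
    have "0 \<le> B j" using C unfolding B_def by (intro add_nonneg_nonneg mult_nonneg_nonneg) auto
    then show ?thesis using False by (simp add: sub_pcomp_def)
  next
    case j: True
    define P where "P = (\<Prod>v\<leftarrow>vs. norm v)"
    have P: "P \<ge> 0" by (simp add: P_def)
    have sc: "packet_scale j ^ (5 * k) / packet_scale j ^ 4 \<le> packet_scale j ^ (5 * k)"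
      using divide_left_mono[of 1 "packet_scale j ^ 4" "packet_scale j ^ (5 * k)"] by (simp add: one_le_power)
    have "norm (pcomp t j vs p) \<le> B j * P"
    proof (cases "packet_scale j < T")
      case True
      have "norm (pcomp t j vs p) \<le> C * (packet_scale j ^ (5 * k) / packet_scale j ^ 4) * P"
        using norm_pcomp_le[of t j vs p] by (simp add: C_def P_def vs)
      also have "\<dots> \<le> C * packet_scale j ^ (5 * k) * P"
        using C P sc by (intro mult_right_mono mult_left_mono) auto
      also have "\<dots> \<le> B j * P"
        using C P True by (intro mult_right_mono) (auto simp: B_def)
      finally show ?thesis .
    next
      case False
      then have M: "packet_scale j \<ge> 16 * (\<bar>t\<bar> + 1)" by (simp add: T_def)
      define E where "E = exp (\<bar>R\<bar> + 1) * exp (- \<delta> * packet_scale j)"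
      obtain e where e: "norm (pcomp t j vs p) \<le> C * (packet_scale j ^ (5 * k) / packet_scale j ^ 4) * exp e * P" "e \<le> \<bar>R\<bar> + 1 + - \<delta> * packet_scale j"
      proof (cases "stage j < N")
        case True
        show ?thesis
        proof (rule that)
          show "norm (pcomp t j vs p) \<le> C * (packet_scale j ^ (5 * k) / packet_scale j ^ 4) *
              exp (norm p + 1 - \<bar>t - pos_rat (stage j)\<bar> * packet_scale j ^ 3) * P"
            unfolding pcomp_def C_def P_def vs[symmetric] by (rule norm_packet_le_time[OF M])
          have "\<delta> * packet_scale j \<le> \<bar>t - pos_rat (stage j)\<bar> * packet_scale j ^ 3"
          proof (rule mult_mono)
            show "\<delta> \<le> \<bar>t - pos_rat (stage j)\<bar>"
              using d(2)[of "pos_rat (stage j)"] True J[OF j] \<delta>(3) by (auto simp: dist_real_def)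
            show "packet_scale j \<le> packet_scale j ^ 3" using power_increasing[of 1 3 "packet_scale j"] by simp
          qed (use scale_pos[of j] in \<open>auto intro: less_imp_le\<close>)
          then show "norm p + 1 - \<bar>t - pos_rat (stage j)\<bar> * packet_scale j ^ 3 \<le> \<bar>R\<bar> + 1 + - \<delta> * packet_scale j"
            using p by linarith
        qed
      next
        case False
        show ?thesis
        proof (rule that)
          show "norm (pcomp t j vs p) \<le> C * (packet_scale j ^ (5 * k) / packet_scale j ^ 4) *
              exp (1 - \<bar>fst (snd p) - real (stage j)\<bar> * packet_scale j) * P"
            unfolding pcomp_def C_def P_def vs[symmetric] by (rule norm_packet_le_space[OF M])
          have "\<bar>fst (snd p)\<bar> \<le> norm p"
            using norm_fst_le[of "fst (snd p)" "snd (snd p)"] norm_snd_le[of "snd p" "fst p"] by simp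
          then have "1 \<le> \<bar>fst (snd p) - real (stage j)\<bar>" using p N[of "stage j"] False by linarith
          then have "\<delta> * packet_scale j \<le> \<bar>fst (snd p) - real (stage j)\<bar> * packet_scale j"
            using \<delta> by (intro mult_right_mono) (auto intro: less_imp_le)
          then show "1 - \<bar>fst (snd p) - real (stage j)\<bar> * packet_scale j \<le> \<bar>R\<bar> + 1 + - \<delta> * packet_scale j"
            using abs_ge_zero[of R] by linarith
        qed
      qed
      note e(1)
      also have "C * (packet_scale j ^ (5 * k) / packet_scale j ^ 4) * exp e * P \<le> C * packet_scale j ^ (5 * k) * exp (\<bar>R\<bar> + 1 + - \<delta> * packet_scale j) * P"
        using C P sc e(2) by (intro mult_right_mono mult_mono mult_left_mono) auto
      also have "\<dots> = (C * exp (\<bar>R\<bar> + 1)) * (packet_scale j ^ (5 * k) * exp (- \<delta> * packet_scale j)) * P"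
        by (simp only: exp_add mult_ac)
      also have "\<dots> = B j * P" using False by (simp add: B_def)
      finally show ?thesis .
    qed
    then show ?thesis using j by (simp add: sub_pcomp_def P_def)
  qed
  ultimately show ?thesis by blast
qed

lemma C_k_suminf_pcomp:
  assumes "t \<notin> range pos_rat"
  shows "C_k k (\<lambda>p. \<Sum>j. pcomp t j [] p)"
proof -
  have "C_k k (\<lambda>p. \<Sum>j. sub_pcomp UNIV t j [] p)"
    by (rule C_k_if_derivative_family[where F = "\<lambda>vs p. \<Sum>j. sub_pcomp UNIV t j vs p"])
       (intro series_has_derivative sub_pcomp_has_derivative sub_pcomp_bounds, use assms in auto)
  then show ?thesis by (simp add: sub_pcomp_def)
qed

section \<open>The datum and its evolution as distributions\<close>

lemma summable_norm_pcomp: "summable (\<lambda>j. norm (pcomp t j [] p))"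
proof (rule summable_comparison_test')
  show "summable (\<lambda>j. gauss_const 0 * (1 / packet_scale j))" by (intro summable_mult summable_inverse_scale)
  show "norm (norm (pcomp t j [] p)) \<le> gauss_const 0 * (1 / packet_scale j)" if "j \<ge> 0" for j
    using norm_pcomp_Nil_le[of t j p] mult_left_mono[OF inverse_scale_power_le[of j 3], of "gauss_const 0"]
    by (simp add: numeral_eq_Suc)
qed

lemma integral_norm_pcomp_0: "(\<integral>p. norm (pcomp 0 j [] p) \<partial>lborel) = sqrt (2 * pi) ^ 3 * (1 / packet_scale j)"
  and integrable_pcomp_0: "integrable lborel (pcomp 0 j [])"
  unfolding pcomp_def using integrable_packet_initial[of "packet_scale j" "pos_rat (stage j)" "real (stage j)"] by auto

definition data :: "R3 \<Rightarrow> real" where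
  "data p = Re (\<Sum>j. pcomp 0 j [] p)"

definition data_dist :: "(R3 \<Rightarrow> complex) \<Rightarrow> complex" where
  "data_dist \<phi> = (\<integral>p. of_real (data p) * \<phi> p \<partial>lborel)"

text \<open>The majorant is the product of the two norms, so the lemma covers two situations:
  L^1-summable packets against a bounded function at time 0, and uniformly summable packets against
  a test function at time \<open>t\<close>.\<close>

lemma integral_suminf_Re_times:
  fixes f :: "nat \<Rightarrow> R3 \<Rightarrow> complex" and h :: "R3 \<Rightarrow> complex"
  assumes s: "\<And>p. summable (\<lambda>j. norm (f j p))"
    and int: "\<And>j. integrable lborel (\<lambda>p. of_real (Re (f j p)) * h p)"
    and D: "summable D" "\<And>j. (\<integral>p. norm (f j p) * norm (h p) \<partial>lborel) \<le> D j"
    and int': "\<And>j. integrable lborel (\<lambda>p. norm (f j p) * norm (h p))"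
  shows "integrable lborel (\<lambda>p. of_real (Re (\<Sum>j. f j p)) * h p)"
    and "(\<integral>p. of_real (Re (\<Sum>j. f j p)) * h p \<partial>lborel) = (\<Sum>j. \<integral>p. of_real (Re (f j p)) * h p \<partial>lborel)"
    and "summable (\<lambda>j. \<integral>p. of_real (Re (f j p)) * h p \<partial>lborel)"
proof -
  have le: "norm (of_real (Re (f j p)) * h p) \<le> norm (f j p) * norm (h p)" for j p
    unfolding norm_mult norm_of_real by (intro mult_right_mono abs_Re_le_cmod) auto
  have 1: "summable (\<lambda>j. norm (of_real (Re (f j p)) * h p))" for p
    by (rule summable_comparison_test'[OF summable_mult2[OF s]]) (use le in simp)
  have 2: "summable (\<lambda>j. \<integral>p. norm (of_real (Re (f j p)) * h p) \<partial>lborel)"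
  proof (rule summable_comparison_test'[OF D(1)])
    show "norm (\<integral>p. norm (of_real (Re (f j p)) * h p) \<partial>lborel) \<le> D j" if "j \<ge> 0" for j
    proof -
      have "(\<integral>p. norm (of_real (Re (f j p)) * h p) \<partial>lborel) \<le> (\<integral>p. norm (f j p) * norm (h p) \<partial>lborel)"
        by (intro integral_mono integrable_norm int int' le)
      also have "\<dots> \<le> D j" by (rule D)
      finally show ?thesis by simp
    qed
  qed
  have eq: "of_real (Re (\<Sum>j. f j p)) * h p = (\<Sum>j. of_real (Re (f j p)) * h p)" for p
  proof -
    have "summable (\<lambda>j. f j p)" by (rule summable_norm_cancel[OF s])
    then have "(\<lambda>j. of_real (Re (f j p)) * h p) sums (of_real (Re (\<Sum>j. f j p)) * h p)"
      by (intro sums_mult2 sums_of_real sums_Re summable_sums)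
    then show ?thesis by (rule sums_unique)
  qed
  show "integrable lborel (\<lambda>p. of_real (Re (\<Sum>j. f j p)) * h p)"
    unfolding eq by (rule integrable_suminf[OF int AE_I2[OF 1] 2])
  show "(\<integral>p. of_real (Re (\<Sum>j. f j p)) * h p \<partial>lborel) = (\<Sum>j. \<integral>p. of_real (Re (f j p)) * h p \<partial>lborel)"
    unfolding eq by (rule integral_suminf[OF int AE_I2[OF 1] 2])
  show "summable (\<lambda>j. \<integral>p. of_real (Re (f j p)) * h p \<partial>lborel)"
    by (rule summable_integral[OF int AE_I2[OF 1] 2])
qed

text \<open>The packets have summable L^1 norms at time 0, so the datum pairs continuously with
  bounded measurable functions in the supremum norm. This yields temperedness with order 0 as well
  as the expansion of \<open>W t\<close>.\<close>

lemma data_times_bounded: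
  assumes h [measurable]: "h \<in> borel_measurable borel" and B: "B \<ge> 0" "\<And>p. norm (h p) \<le> B"
  shows "integrable lborel (\<lambda>p. of_real (data p) * h p)"
    and "data_dist h = (\<Sum>j. \<integral>p. of_real (Re (pcomp 0 j [] p)) * h p \<partial>lborel)"
    and "norm (data_dist h) \<le> (\<Sum>j. sqrt (2 * pi) ^ 3 * (1 / packet_scale j)) * B"
    and "summable (\<lambda>j. \<integral>p. of_real (Re (pcomp 0 j [] p)) * h p \<partial>lborel)"
proof -
  have [measurable]: "pcomp 0 j [] \<in> borel_measurable borel" for j
    by (rule borel_measurable_continuous_onI[OF continuous_on_pcomp])
  have int': "integrable lborel (\<lambda>p. norm (pcomp 0 j [] p) * norm (h p))" for j
  proof (rule Bochner_Integration.integrable_bound)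
    show "integrable lborel (\<lambda>p. B * norm (pcomp 0 j [] p))" by (intro integrable_mult_right integrable_norm integrable_pcomp_0)
    show "AE p in lborel. norm (norm (pcomp 0 j [] p) * norm (h p)) \<le> norm (B * norm (pcomp 0 j [] p))"
      using B by (intro AE_I2) (simp add: abs_mult mult.commute[of B] mult_left_mono)
  qed measurable
  have int: "integrable lborel (\<lambda>p. of_real (Re (pcomp 0 j [] p)) * h p)" for j
  proof (rule Bochner_Integration.integrable_bound[OF int'])
    show "AE p in lborel. norm (of_real (Re (pcomp 0 j [] p)) * h p) \<le> norm (norm (pcomp 0 j [] p) * norm (h p))"
      by (intro AE_I2) (simp add: norm_mult abs_mult mult_right_mono abs_Re_le_cmod)
  qed measurable
  have le: "(\<integral>p. norm (pcomp 0 j [] p) * norm (h p) \<partial>lborel) \<le> sqrt (2 * pi) ^ 3 * (1 / packet_scale j) * B" for j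
  proof -
    have "(\<integral>p. norm (pcomp 0 j [] p) * norm (h p) \<partial>lborel) \<le> (\<integral>p. norm (pcomp 0 j [] p) * B \<partial>lborel)"
      using B by (intro integral_mono int' integrable_mult_left integrable_norm integrable_pcomp_0 mult_left_mono) auto
    then show ?thesis by (simp add: integral_norm_pcomp_0)
  qed
  have sD: "summable (\<lambda>j. sqrt (2 * pi) ^ 3 * (1 / packet_scale j) * B)"
    by (intro summable_mult2 summable_mult summable_inverse_scale)
  note * = integral_suminf_Re_times[OF summable_norm_pcomp int sD le int']
  show "integrable lborel (\<lambda>p. of_real (data p) * h p)" unfolding data_def by (rule *)
  show eq: "data_dist h = (\<Sum>j. \<integral>p. of_real (Re (pcomp 0 j [] p)) * h p \<partial>lborel)"
    unfolding data_def data_dist_def by (rule *)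
  show "summable (\<lambda>j. \<integral>p. of_real (Re (pcomp 0 j [] p)) * h p \<partial>lborel)" by (rule *)
  have "norm (\<integral>p. of_real (Re (pcomp 0 j [] p)) * h p \<partial>lborel) \<le> sqrt (2 * pi) ^ 3 * (1 / packet_scale j) * B" for j
  proof -
    have "norm (\<integral>p. of_real (Re (pcomp 0 j [] p)) * h p \<partial>lborel) \<le> (\<integral>p. norm (pcomp 0 j [] p) * norm (h p) \<partial>lborel)"
    proof (rule order_trans[OF integral_norm_bound integral_mono[OF integrable_norm[OF int] int']])
      show "norm (of_real (Re (pcomp 0 j [] p)) * h p) \<le> norm (pcomp 0 j [] p) * norm (h p)" for p
        unfolding norm_mult norm_of_real by (intro mult_right_mono abs_Re_le_cmod) auto
    qed
    with le[of j] show ?thesis by linarith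
  qed
  then have "norm (data_dist h) \<le> (\<Sum>j. sqrt (2 * pi) ^ 3 * (1 / packet_scale j) * B)"
    unfolding eq by (rule norm_suminf_le[OF _ sD])
  also have "\<dots> = (\<Sum>j. sqrt (2 * pi) ^ 3 * (1 / packet_scale j)) * B"
    by (intro suminf_mult2[symmetric] summable_mult summable_inverse_scale)
  finally show "norm (data_dist h) \<le> (\<Sum>j. sqrt (2 * pi) ^ 3 * (1 / packet_scale j)) * B" .
qed

text \<open>Holds at every \<open>t\<close>. At a focusing time this weak expansion is the
  description of the solution from which the singularity is read off.\<close>

lemma W_data_dist:
  assumes "test_function \<phi>"
  shows "W t data_dist \<phi> = (\<Sum>j. \<integral>p. of_real (Re (pcomp t j [] p)) * \<phi> p \<partial>lborel)"
    and "summable (\<lambda>j. \<integral>p. of_real (Re (pcomp t j [] p)) * \<phi> p \<partial>lborel)"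
proof -
  obtain B where B: "B \<ge> 0" "\<And>p. norm (fourier (\<lambda>\<zeta>. symbol t \<zeta> * inverse_fourier \<phi> \<zeta>) p) \<le> B"
    "fourier (\<lambda>\<zeta>. symbol t \<zeta> * inverse_fourier \<phi> \<zeta>) \<in> borel_measurable borel"
    using fourier_symbol_test_function[OF assms, of t] by metis
  have "(\<integral>p. of_real (Re (pcomp 0 j [] p)) * fourier (\<lambda>\<zeta>. symbol t \<zeta> * inverse_fourier \<phi> \<zeta>) p \<partial>lborel) =
      (\<integral>p. of_real (Re (pcomp t j [] p)) * \<phi> p \<partial>lborel)" for j
    unfolding pcomp_def by (rule integral_Re_packet_times_fourier[OF _ assms]) simp
  then show "W t data_dist \<phi> = (\<Sum>j. \<integral>p. of_real (Re (pcomp t j [] p)) * \<phi> p \<partial>lborel)"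
    "summable (\<lambda>j. \<integral>p. of_real (Re (pcomp t j [] p)) * \<phi> p \<partial>lborel)"
    using data_times_bounded(2,4)[OF B(3,1,2)] by (simp_all add: W_eq)
qed

lemma represented_by_suminf_pcomp:
  assumes "t \<notin> range pos_rat"
  shows "represented_by (W t data_dist) (\<lambda>p. of_real (Re (\<Sum>j. pcomp t j [] p)))"
  unfolding represented_by_def
proof (intro allI impI conjI)
  fix \<phi> :: "R3 \<Rightarrow> complex" assume \<phi>: "test_function \<phi>"
  have cont: "continuous_on UNIV (\<lambda>p. complex_of_real (Re (\<Sum>j. pcomp t j [] p)))"
    by (intro continuous_intros C_k_imp_continuous_on[OF C_k_suminf_pcomp[OF assms, of 0]])
  show "integrable lborel (\<lambda>p. of_real (Re (\<Sum>j. pcomp t j [] p)) * \<phi> p)"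
    by (rule integrable_continuous_times_test_function[OF cont \<phi>])
  have c: "continuous_on UNIV (\<lambda>p. complex_of_real (Re (pcomp t j [] p)))" for j
    by (intro continuous_intros continuous_on_pcomp)
  have i: "integrable lborel (\<lambda>p. norm (pcomp t j [] p) * norm (\<phi> p))" for j
    using integrable_norm[OF integrable_continuous_times_test_function[OF continuous_on_pcomp \<phi>]] by (simp add: norm_mult)
  have le: "(\<integral>p. norm (pcomp t j [] p) * norm (\<phi> p) \<partial>lborel) \<le> gauss_const 0 * (1 / packet_scale j) * (\<integral>p. norm (\<phi> p) \<partial>lborel)" for j
  proof -
    have "norm (pcomp t j [] p) \<le> gauss_const 0 * (1 / packet_scale j)" for p
      using norm_pcomp_Nil_le[of t j p] mult_left_mono[OF inverse_scale_power_le[of j 3], of "gauss_const 0"]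
      by (simp add: numeral_eq_Suc)
    then have "(\<integral>p. norm (pcomp t j [] p) * norm (\<phi> p) \<partial>lborel) \<le> (\<integral>p. gauss_const 0 * (1 / packet_scale j) * norm (\<phi> p) \<partial>lborel)"
      by (intro integral_mono i integrable_mult_right integrable_norm test_functionD[OF \<phi>] mult_right_mono) auto
    then show ?thesis by simp
  qed
  have sD: "summable (\<lambda>j. gauss_const 0 * (1 / packet_scale j) * (\<integral>p. norm (\<phi> p) \<partial>lborel))"
    by (intro summable_mult2 summable_mult summable_inverse_scale)
  show "W t data_dist \<phi> = (\<integral>p. of_real (Re (\<Sum>j. pcomp t j [] p)) * \<phi> p \<partial>lborel)"
    unfolding W_data_dist(1)[OF \<phi>]
    by (rule integral_suminf_Re_times(2)[OF summable_norm_pcomp integrable_continuous_times_test_function[OF c \<phi>] sD le i, symmetric])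
qed

lemma norm_le_schwartz_norm_0:
  fixes \<phi> :: "'a::euclidean_space \<Rightarrow> complex"
  assumes "schwartz \<phi>"
  shows "norm (\<phi> x) \<le> schwartz_norm 0 \<phi>"
proof -
  have "bounded (range (\<lambda>x. norm x ^ 0 *\<^sub>R dir_derivs [] \<phi> x))"
    using assms unfolding schwartz_def by blast
  then have "bounded (range \<phi>)" by simp
  then have bdd: "bdd_above (range (\<lambda>x. norm (\<phi> x)))"
    by (auto simp: bounded_iff bdd_above_def)
  have eq: "{vs \<in> lists Basis. length vs \<le> 0} \<times> UNIV = (\<lambda>x. ([] :: 'a list, x :: 'a)) ` UNIV"
    by auto
  have "schwartz_norm 0 \<phi> = (SUP x. norm (\<phi> x))"
    unfolding schwartz_norm_def eq image_image by simp
  then show ?thesis using cSUP_upper[OF _ bdd, of x] by simp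
qed

lemma tempered_distribution_data_dist: "tempered_distribution data_dist"
  unfolding tempered_distribution_def
proof (intro conjI allI impI)
  have S: "\<phi> \<in> borel_measurable borel" "schwartz_norm 0 \<phi> \<ge> 0" if "schwartz \<phi>" for \<phi> :: "R3 \<Rightarrow> complex"
  proof -
    have "C_k 0 \<phi>" using that unfolding schwartz_def C_infinity_def by blast
    then show "\<phi> \<in> borel_measurable borel" by (simp add: borel_measurable_continuous_onI)
    show "schwartz_norm 0 \<phi> \<ge> 0" using norm_le_schwartz_norm_0[OF that, of 0] norm_ge_zero order_trans by blast
  qed
  note I = data_times_bounded[OF S norm_le_schwartz_norm_0]
  fix a b :: complex and \<phi> \<psi> :: "R3 \<Rightarrow> complex" assume "schwartz \<phi>" "schwartz \<psi>"
  then have i: "integrable lborel (\<lambda>p. of_real (data p) * \<phi> p)" "integrable lborel (\<lambda>p. of_real (data p) * \<psi> p)"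
    using I(1) by auto
  have "data_dist (\<lambda>x. a * \<phi> x + b * \<psi> x) = (\<integral>p. a * (of_real (data p) * \<phi> p) + b * (of_real (data p) * \<psi> p) \<partial>lborel)"
    unfolding data_dist_def by (simp add: algebra_simps)
  then show "data_dist (\<lambda>x. a * \<phi> x + b * \<psi> x) = a * data_dist \<phi> + b * data_dist \<psi>"
    using i by (simp add: data_dist_def)
next
  have "norm (data_dist \<phi>) \<le> (\<Sum>j. sqrt (2 * pi) ^ 3 * (1 / packet_scale j)) * schwartz_norm 0 \<phi>" if "schwartz \<phi>" for \<phi>
  proof (rule data_times_bounded(3))
    have "C_k 0 \<phi>" using that unfolding schwartz_def C_infinity_def by blast
    then show "\<phi> \<in> borel_measurable borel" by (simp add: borel_measurable_continuous_onI)
    show "schwartz_norm 0 \<phi> \<ge> 0" using norm_le_schwartz_norm_0[OF that, of 0] norm_ge_zero order_trans by blast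
  qed (rule norm_le_schwartz_norm_0[OF that])
  then show "\<exists>C N. \<forall>\<phi>. schwartz \<phi> \<longrightarrow> norm (data_dist \<phi>) \<le> C * schwartz_norm N \<phi>" by blast
qed

lemma zero_notin_range_pos_rat: "0 \<notin> range pos_rat"
  using range_pos_rat by simp

text \<open>The datum is the solution at time 0, which is not a focusing time.\<close>

lemma C_infinity_data: "C_infinity data"
  unfolding C_infinity_def data_def
  by (intro allI C_k_compose_bounded_linear[OF bounded_linear_Re] C_k_suminf_pcomp zero_notin_range_pos_rat)

lemma represented_by_data: "represented_by data_dist (\<lambda>p. of_real (data p))"
  unfolding represented_by_def
proof (intro allI impI conjI)
  fix \<phi> :: "R3 \<Rightarrow> complex" assume \<phi>: "test_function \<phi>"
  show "data_dist \<phi> = (\<integral>p. of_real (data p) * \<phi> p \<partial>lborel)" by (simp add: data_dist_def)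
  have "continuous_on UNIV (\<lambda>p. complex_of_real (data p))"
    using C_infinity_data unfolding C_infinity_def by (intro continuous_intros C_k_imp_continuous_on) auto
  then show "integrable lborel (\<lambda>p. of_real (data p) * \<phi> p)"
    by (rule integrable_continuous_times_test_function[OF _ \<phi>])
qed

section \<open>Singularity at the rational times\<close>

lemma integral_lborel_dilate:
  fixes f :: "'a::euclidean_space \<Rightarrow> real"
  assumes [measurable]: "f \<in> borel_measurable borel" and s: "s > 0"
  shows "(\<integral>x. f (s *\<^sub>R (x - c)) \<partial>lborel) = (\<integral>x. f x \<partial>lborel) / s ^ DIM('a)"
proof -
  have eq: "lborel = density (distr lborel borel (\<lambda>x::'a. - (s *\<^sub>R c) + s *\<^sub>R x)) (\<lambda>_. ennreal (s ^ DIM('a)))"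
    using lborel_affine[of s "- (s *\<^sub>R c)"] s by simp
  have "(\<integral>x. f x \<partial>lborel) = s ^ DIM('a) * (\<integral>x. f (s *\<^sub>R (x - c)) \<partial>lborel)"
    by (subst eq) (use s in \<open>simp add: integral_density integral_distr scaleR_diff_right\<close>)
  then show ?thesis using s by simp
qed

text \<open>All are rescalings of a single bump, with mass normalized to 1; the L^1 norm of the
  derivative then grows linearly in \<open>s\<close>. The order of the quantifiers matters:
  \<open>K\<close> is uniform in the scale and the centre.\<close>

lemma focusing_bumps:
  fixes v :: "'a::euclidean_space"
  shows "\<exists>K\<ge>0. \<forall>s c. s > 0 \<longrightarrow> (\<exists>\<psi>. test_function (\<lambda>x. complex_of_real (\<psi> x)) \<and> (\<forall>x. \<psi> x \<ge> 0) \<and>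
    integrable lborel \<psi> \<and> integral\<^sup>L lborel \<psi> = 1 \<and> (\<forall>x. norm (x - c) > 1 / s \<longrightarrow> \<psi> x = 0) \<and>
    (\<integral>x. norm (frechet_derivative (\<lambda>x. complex_of_real (\<psi> x)) (at x) v) \<partial>lborel) \<le> K * s)"
proof -
  obtain b :: "'a \<Rightarrow> real" where b: "\<And>k. C_k k b" "\<And>x. b x \<ge> 0" "\<And>x. norm x \<ge> 1 \<Longrightarrow> b x = 0" "integral\<^sup>L lborel b > 0"
    using bump_function_exists[where 'a = 'a] by metis
  define I where "I = integral\<^sup>L lborel b"
  have I: "I > 0" using b(4) by (simp add: I_def)
  define D where "D x = \<bar>frechet_derivative b (at x) v\<bar>" for x
  have b_meas: "b \<in> borel_measurable borel"
    by (rule borel_measurable_continuous_onI[OF C_k_imp_continuous_on[OF b(1)[of 0]]])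
  have D_meas: "D \<in> borel_measurable borel"
  proof -
    have "continuous_on UNIV (\<lambda>x. frechet_derivative b (at x) v)" using b(1)[of "Suc 0"] by simp
    then show ?thesis unfolding D_def by (intro borel_measurable_continuous_onI continuous_intros)
  qed
  define K where "K = integral\<^sup>L lborel D / I"
  have "K \<ge> 0" unfolding K_def using I by (intro divide_nonneg_pos integral_nonneg_AE) (auto simp: D_def)
  moreover have "\<exists>\<psi>. test_function (\<lambda>x. complex_of_real (\<psi> x)) \<and> (\<forall>x. \<psi> x \<ge> 0) \<and>
    integrable lborel \<psi> \<and> integral\<^sup>L lborel \<psi> = 1 \<and> (\<forall>x. norm (x - c) > 1 / s \<longrightarrow> \<psi> x = 0) \<and>
    (\<integral>x. norm (frechet_derivative (\<lambda>x. complex_of_real (\<psi> x)) (at x) v) \<partial>lborel) \<le> K * s" if s: "s > 0" for s c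
  proof (intro exI conjI allI impI)
    define a where "a = s ^ DIM('a) / I"
    have a: "a > 0" using s I by (simp add: a_def)
    let ?\<psi> = "\<lambda>x. a * b (s *\<^sub>R (x - c))"
    have z: "b (s *\<^sub>R (x - c)) = 0" if "norm (x - c) \<ge> 1 / s" for x
      using that s by (intro b(3)) (simp add: divide_le_eq mult.commute)
    have C: "C_k k ?\<psi>" for k by (intro C_k_mult C_k_const C_k_affine_compose b)
    have C': "C_k k (\<lambda>x. complex_of_real (?\<psi> x))" for k
      by (rule C_k_compose_bounded_linear[OF bounded_linear_of_real C])
    have out: "?\<psi> x = 0" if "x \<notin> cball c (1 / s)" for x
      using z[of x] that by (simp add: dist_norm norm_minus_commute)
    show "test_function (\<lambda>x. complex_of_real (?\<psi> x))"
      by (rule test_functionI[OF C' compact_cball[of c "1 / s"]]) (use out in simp)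
    show "?\<psi> x \<ge> 0" for x using a b(2) by simp
    show "integrable lborel ?\<psi>"
      by (rule integrable_continuous_compact_support[OF C_k_imp_continuous_on[OF C[of 0]] compact_cball[of c "1 / s"] out])
    show "integral\<^sup>L lborel ?\<psi> = 1"
      using s I by (simp add: integral_lborel_dilate[OF b_meas] a_def I_def[symmetric])
    show "?\<psi> x = 0" if "norm (x - c) > 1 / s" for x using z[of x] that by simp
    have "norm (frechet_derivative (\<lambda>x. complex_of_real (?\<psi> x)) (at x) v) = (a * s) * D (s *\<^sub>R (x - c))" for x
    proof -
      note Db = C_k_Suc_imp_has_derivative[OF b(1)[of "Suc 0"], of "s *\<^sub>R (x - c)"]
      have "((\<lambda>x. s *\<^sub>R (x - c)) has_derivative (\<lambda>v. s *\<^sub>R v)) (at x)"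
        by (auto intro!: derivative_eq_intros)
      from has_derivative_compose[OF this Db]
      have "((\<lambda>x. complex_of_real (?\<psi> x)) has_derivative
          (\<lambda>v. complex_of_real (a * frechet_derivative b (at (s *\<^sub>R (x - c))) (s *\<^sub>R v)))) (at x)"
        by (rule bounded_linear.has_derivative[OF bounded_linear_of_real has_derivative_mult_right])
      from frechet_derivative_eqI[OF this, of v] show ?thesis
        using a s by (simp add: D_def linear_cmul[OF has_derivative_linear[OF Db]] abs_mult norm_mult)
    qed
    then have "(\<integral>x. norm (frechet_derivative (\<lambda>x. complex_of_real (?\<psi> x)) (at x) v) \<partial>lborel) = (a * s) * (integral\<^sup>L lborel D / s ^ DIM('a))"
      by (simp add: integral_lborel_dilate[OF D_meas s])
    also have "\<dots> = K * s" using s I by (simp add: a_def K_def)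
    finally show "(\<integral>x. norm (frechet_derivative (\<lambda>x. complex_of_real (?\<psi> x)) (at x) v) \<partial>lborel) \<le> K * s" by simp
  qed
  ultimately show ?thesis by blast
qed

lemma norm_weighted_integral_le:
  fixes f :: "'a::euclidean_space \<Rightarrow> complex" and \<psi> :: "'a \<Rightarrow> real"
  assumes \<psi>: "\<And>x. \<psi> x \<ge> 0" "integrable lborel \<psi>" "integral\<^sup>L lborel \<psi> = 1"
    and f: "integrable lborel (\<lambda>x. f x * of_real (\<psi> x))" and D: "\<And>x. \<psi> x \<noteq> 0 \<Longrightarrow> norm (f x) \<le> D"
  shows "norm (\<integral>x. f x * of_real (\<psi> x) \<partial>lborel) \<le> D"
proof -
  have "norm (\<integral>x. f x * of_real (\<psi> x) \<partial>lborel) \<le> (\<integral>x. D * \<psi> x \<partial>lborel)"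
  proof (rule order_trans[OF integral_norm_bound integral_mono])
    show "integrable lborel (\<lambda>x. norm (f x * of_real (\<psi> x)))" by (rule integrable_norm[OF f])
    show "integrable lborel (\<lambda>x. D * \<psi> x)" by (rule integrable_mult_right[OF \<psi>(2)])
    show "norm (f x * of_real (\<psi> x)) \<le> D * \<psi> x" for x
      using D[of x] \<psi>(1)[of x] by (cases "\<psi> x = 0") (auto simp: norm_mult intro: mult_right_mono)
  qed
  then show ?thesis by (simp add: \<psi>(3))
qed

lemma C_k_Re_pcomp: "C_k k (\<lambda>p. complex_of_real (Re (pcomp t j vs p)))"
  by (intro C_k_compose_bounded_linear[OF bounded_linear_of_real] C_k_compose_bounded_linear[OF bounded_linear_Re]
      C_k_if_derivative_family pcomp_has_derivative)

lemma frechet_derivative_Re_pcomp: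
  "frechet_derivative (\<lambda>p. complex_of_real (Re (pcomp t j vs p))) (at p) v = of_real (Re (pcomp t j (v # vs) p))"
  by (rule frechet_derivative_eqI[OF bounded_linear.has_derivative[OF bounded_linear_of_real
        bounded_linear.has_derivative[OF bounded_linear_Re pcomp_has_derivative]]])

lemma integral_Re_pcomp_by_parts:
  assumes "test_function \<phi>"
  shows "(\<integral>p. of_real (Re (pcomp t j [] p)) * frechet_derivative \<phi> (at p) v \<partial>lborel) =
    - (\<integral>p. of_real (Re (pcomp t j [v] p)) * \<phi> p \<partial>lborel)"
  using integral_by_parts_test_function[OF C_k_Re_pcomp assms] by (simp add: frechet_derivative_Re_pcomp)

text \<open>Pairing with the y1-derivative of a unit-mass bump of width \<delta> / M^5 at the focus
  stays bounded by \<open>S\<close> if the representative is C^1, however large M is. In the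
  expansion, however, packet \<open>j\<close> contributes at least M/2, and all the others together
  only O(sqrt M).\<close>

lemma not_C1_at_rational:
  assumes t: "t = pos_rat n" and g: "C_k 1 g" and rep: "represented_by (W t data_dist) g"
  shows False
proof -
  define v c :: R3 where "v = (0, 1, 0)" and "c = (0, real n, 0)"
  have nv: "norm v = 1" by (simp add: v_def norm_Pair)
  have g1: "C_k (Suc 0) g" using g by simp
  have contg': "continuous_on UNIV (\<lambda>p. frechet_derivative g (at p) v)"
    using g1 unfolding C_k.simps by blast
  obtain S where S: "S \<ge> 0" "\<And>p. p \<in> cball c 1 \<Longrightarrow> norm (frechet_derivative g (at p) v) \<le> S"
  proof -
    have "bounded ((\<lambda>p. frechet_derivative g (at p) v) ` cball c 1)"
      by (intro compact_imp_bounded compact_continuous_image continuous_on_subset[OF contg']) auto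
    then obtain S where "S > 0" "\<And>p. p \<in> cball c 1 \<Longrightarrow> norm (frechet_derivative g (at p) v) \<le> S"
      unfolding bounded_pos by auto
    then show ?thesis using that[of S] by simp
  qed
  \<comment> \<open>Packets of the other stages do not focus at time \<open>t\<close>; their
    derivatives near the focus have a summable majorant that does not depend on
    \<open>j\<close>.\<close>
  define J where "J = {j. stage j \<noteq> n}"
  have "pos_rat (stage j) \<noteq> t" if "j \<in> J" for j
    using that by (simp add: J_def t pos_rat_eq_iff)
  from sub_pcomp_bounds[OF this, of J 1 "norm c + 1"] obtain B where B: "summable B"
    "\<And>j vs p. length vs = 1 \<Longrightarrow> norm p \<le> norm c + 1 \<Longrightarrow> norm (sub_pcomp J t j vs p) \<le> B j * (\<Prod>v\<leftarrow>vs. norm v)"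
    by metis
  have B_J: "norm (pcomp t j [v] p) \<le> B j" if "j \<in> J" "norm p \<le> norm c + 1" for j p
    using B(2)[of "[v]" p j] nv that by (simp add: sub_pcomp_def)
  have B0: "B j \<ge> 0" for j
    using order_trans[OF norm_ge_zero B(2)[of "[v]" c j]] nv by simp
  obtain K where K: "K \<ge> 0" and bumps: "\<forall>s c. s > 0 \<longrightarrow> (\<exists>\<psi>. test_function (\<lambda>x. complex_of_real (\<psi> x)) \<and> (\<forall>x. \<psi> x \<ge> 0) \<and>
    integrable lborel \<psi> \<and> integral\<^sup>L lborel \<psi> = 1 \<and> (\<forall>x. norm (x - c) > 1 / s \<longrightarrow> \<psi> x = 0) \<and>
    (\<integral>x. norm (frechet_derivative (\<lambda>x. complex_of_real (\<psi> x)) (at x) v) \<partial>lborel) \<le> K * s)"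
    using focusing_bumps[of v] by (elim exE conjE)
  \<comment> \<open>Chosen so that the phase error 5 \<delta> M \<open>gauss_const 3\<close> is at
    most M/4.\<close>
  define \<delta> where "\<delta> = 1 / (20 * (gauss_const 3 + 1))"
  have g3: "gauss_const 3 + 1 > 0" using gauss_const_nonneg[of 3] by linarith
  have \<delta>: "0 < \<delta>" "\<delta> \<le> 1" "20 * \<delta> * gauss_const 3 \<le> 1"
  proof -
    show "0 < \<delta>" unfolding \<delta>_def using g3 by (intro divide_pos_pos mult_pos_pos) auto
    have "1 \<le> 20 * (gauss_const 3 + 1)" using gauss_const_nonneg[of 3] unfolding distrib_left by linarith
    then show "\<delta> \<le> 1" unfolding \<delta>_def using g3 by (subst divide_le_eq_1_pos) (intro mult_pos_pos, auto)
    have "20 * \<delta> * gauss_const 3 = gauss_const 3 / (gauss_const 3 + 1)"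
      unfolding \<delta>_def using g3 by (simp add: divide_simps)
    also have "\<dots> \<le> 1" using g3 by simp
    finally show "20 * \<delta> * gauss_const 3 \<le> 1" .
  qed
  define Kg C1 where "Kg = gauss_const 0 * K / \<delta>" and "C1 = 3 * gauss_const 1"
  have Kg: "Kg \<ge> 0" "C1 \<ge> 0" using K \<delta> by (auto simp: Kg_def C1_def)
  \<comment> \<open>Everything in the upper bound that does not depend on \<open>j\<close>.\<close>
  define K1 where "K1 = S + (\<Sum>j. B j) + Kg * (\<Sum>j. 1 / packet_scale j)"
  have K1: "K1 \<ge> 0"
    unfolding K1_def using S Kg B0 by (intro add_nonneg_nonneg mult_nonneg_nonneg suminf_nonneg B(1) summable_inverse_scale) auto
  \<comment> \<open>The first entry makes M exceed twice the upper bound for packet \<open>j\<close>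
    at the end; the second keeps the part of the focus error that does not grow with M below
    M/4.\<close>
  define N where "N = nat \<lceil>max (4 * C1 + 2 * K1 + 1) (4 * gauss_const 3 * (5 * t + 1))\<rceil>"
  have N: "4 * C1 + 2 * K1 + 1 \<le> real N" "4 * gauss_const 3 * (5 * t + 1) \<le> real N"
    unfolding N_def by linarith+
  obtain j where j: "j > Suc N" "stage j = n" using stage_infinite[of "Suc N" n] by blast
  then obtain i0 where i0: "j = Suc i0" "i0 \<ge> N" by (cases j) auto
  define M where "M = packet_scale j"
  have M0: "M \<ge> 1" "M > 0" by (simp_all add: M_def)
  have MN: "packet_scale i0 \<ge> real N" "M \<ge> real N"
    using scale_ge[of i0] scale_ge[of j] i0 by (auto simp: M_def)
  \<comment> \<open>The bump radius 1/s = \<delta> / M^5 is the radius in which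
    \<open>packet_derivative_at_focus\<close> applies.\<close>
  define s where "s = M ^ 5 / \<delta>"
  have s: "s > 0" "1 / s = \<delta> / M ^ 5" using M0 \<delta> by (auto simp: s_def)
  have s1: "1 / s \<le> 1"
  proof -
    have "\<delta> \<le> M ^ 5" using \<delta>(2) one_le_power[OF M0(1), of 5] by linarith
    then show ?thesis unfolding s(2) using M0 by (simp add: divide_le_eq)
  qed
  obtain \<psi> where \<psi>: "test_function (\<lambda>x. complex_of_real (\<psi> x))" "\<And>x. \<psi> x \<ge> 0"
    "integrable lborel \<psi>" "integral\<^sup>L lborel \<psi> = 1" "\<And>x. norm (x - c) > 1 / s \<Longrightarrow> \<psi> x = 0"
    "(\<integral>x. norm (frechet_derivative (\<lambda>x. complex_of_real (\<psi> x)) (at x) v) \<partial>lborel) \<le> K * s"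
    using bumps[rule_format, OF s(1), of c] by (elim exE conjE) blast
  define D\<phi> where "D\<phi> = (\<lambda>x. frechet_derivative (\<lambda>x. complex_of_real (\<psi> x)) (at x) v)"
  have D\<phi>: "test_function D\<phi>" unfolding D\<phi>_def by (rule test_function_frechet_derivative[OF \<psi>(1)])
  have supp: "norm (p - c) \<le> 1 / s" if "\<psi> p \<noteq> 0" for p using \<psi>(5)[of p] that by force
  have supp1: "norm (p - c) \<le> 1" if "\<psi> p \<noteq> 0" for p using supp[OF that] s1 by linarith
  have supp2: "norm p \<le> norm c + 1" if "\<psi> p \<noteq> 0" for p
    using supp1[OF that] norm_triangle_sub[of p c] by linarith
  define a where "a i = (\<integral>p. of_real (Re (pcomp t i [] p)) * D\<phi> p \<partial>lborel)" for i
  have sum_a: "summable a" "W t data_dist D\<phi> = suminf a"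
    unfolding a_def using W_data_dist[OF D\<phi>] by auto
  have a_eq: "a i = - (\<integral>p. of_real (Re (pcomp t i [v] p)) * of_real (\<psi> p) \<partial>lborel)" for i
    unfolding a_def D\<phi>_def by (rule integral_Re_pcomp_by_parts[OF \<psi>(1)])
  have int: "integrable lborel (\<lambda>p. complex_of_real (Re (pcomp t i [v] p)) * of_real (\<psi> p))" for i
    by (rule integrable_continuous_times_test_function[OF C_k_imp_continuous_on[OF C_k_Re_pcomp[where k = 0]] \<psi>(1)])
  have a_le: "norm (a i) \<le> D" if "\<And>p. \<psi> p \<noteq> 0 \<Longrightarrow> norm (pcomp t i [v] p) \<le> D" for i D
    unfolding a_eq norm_minus_cancel
    by (rule norm_weighted_integral_le[OF \<psi>(2,3,4) int])
       (auto intro: order_trans[OF abs_Re_le_cmod that])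
  have sum_le: "norm (suminf a) \<le> S"
  proof -
    have "suminf a = (\<integral>p. g p * D\<phi> p \<partial>lborel)"
      using rep D\<phi> sum_a(2) unfolding represented_by_def by metis
    also have "\<dots> = - (\<integral>p. frechet_derivative g (at p) v * of_real (\<psi> p) \<partial>lborel)"
      unfolding D\<phi>_def by (rule integral_by_parts_test_function[OF g1 \<psi>(1)])
    also have "norm \<dots> \<le> S"
      unfolding norm_minus_cancel
    proof (rule norm_weighted_integral_le[OF \<psi>(2,3,4)])
      show "integrable lborel (\<lambda>p. frechet_derivative g (at p) v * complex_of_real (\<psi> p))"
        by (rule integrable_continuous_times_test_function[OF contg' \<psi>(1)])
      show "norm (frechet_derivative g (at p) v) \<le> S" if "\<psi> p \<noteq> 0" for p
        using supp1[OF that] by (intro S(2)) (simp add: dist_norm norm_minus_commute)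
    qed
    finally show ?thesis .
  qed
  \<comment> \<open>One summand for each kind of competitor: other stages, smaller scales, larger
    scales.\<close>
  define D where "D i = B i + (if i < j then C1 * packet_scale i else 0) + Kg * (1 / packet_scale i)" for i
  have D: "norm (a i) \<le> D i" if "i \<noteq> j" for i
  proof -
    have nn: "0 \<le> B i" "0 \<le> (if i < j then C1 * packet_scale i else 0)" "0 \<le> Kg * (1 / packet_scale i)"
      using B0 Kg by auto
    consider "i \<in> J" | "i < j" | "i > j" using \<open>i \<noteq> j\<close> by linarith
    then show ?thesis
    proof cases
      case 1
      have "norm (a i) \<le> B i" by (rule a_le) (rule B_J[OF 1 supp2])
      then show ?thesis using nn unfolding D_def by linarith
    next
      case 2
      have "norm (a i) \<le> C1 * packet_scale i"
      proof (rule a_le)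
        show "norm (pcomp t i [v] p) \<le> C1 * packet_scale i" for p
          using norm_pcomp_le[of t i "[v]" p] nv by (simp add: C1_def numeral_eq_Suc)
      qed
      then show ?thesis using nn 2 unfolding D_def by simp
    next
      case 3
      \<comment> \<open>For a larger scale the derivative stays on the bump, at a cost of order M^5.
        The amplitude \<open>packet_scale i\<close> to the power -4 compensates this, because
        \<open>packet_scale i\<close> is at least M^2 and so M^5 is at most its cube.\<close>
      have "norm (a i) \<le> (\<integral>p. gauss_const 0 / packet_scale i ^ 4 * norm (D\<phi> p) \<partial>lborel)"
        unfolding a_def
      proof (rule order_trans[OF integral_norm_bound integral_mono])
        show "integrable lborel (\<lambda>p. norm (complex_of_real (Re (pcomp t i [] p)) * D\<phi> p))"
          by (intro integrable_norm integrable_continuous_times_test_function[OF C_k_imp_continuous_on[OF C_k_Re_pcomp[where k = 0]] D\<phi>])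
        show "integrable lborel (\<lambda>p. gauss_const 0 / packet_scale i ^ 4 * norm (D\<phi> p))"
          by (intro integrable_mult_right integrable_norm test_functionD(4)[OF D\<phi>])
        show "norm (complex_of_real (Re (pcomp t i [] p)) * D\<phi> p) \<le> gauss_const 0 / packet_scale i ^ 4 * norm (D\<phi> p)" for p
          unfolding norm_mult norm_of_real
          by (intro mult_right_mono order_trans[OF abs_Re_le_cmod norm_pcomp_Nil_le]) auto
      qed
      also have "\<dots> \<le> gauss_const 0 / packet_scale i ^ 4 * (K * s)"
        unfolding integral_mult_right_zero D\<phi>_def by (intro mult_left_mono \<psi>(6)) auto
      also have "\<dots> = Kg * (M ^ 5 / packet_scale i ^ 4)"
        by (simp add: Kg_def s_def mult_ac)
      also have "\<dots> \<le> Kg * (1 / packet_scale i)"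
      proof (rule mult_left_mono[OF _ Kg(1)])
        have "M ^ 5 \<le> M ^ 6" using M0 by (intro power_increasing) auto
        also have "\<dots> = (M\<^sup>2) ^ 3" by (simp flip: power_mult)
        also have "\<dots> \<le> packet_scale i ^ 3" using scale_square_le[OF 3] by (intro power_mono) (auto simp: M_def)
        finally have "M ^ 5 / packet_scale i ^ 4 \<le> packet_scale i ^ 3 / packet_scale i ^ 4"
          by (intro divide_right_mono) auto
        also have "\<dots> = 1 / packet_scale i" by (simp add: field_simps numeral_eq_Suc)
        finally show "M ^ 5 / packet_scale i ^ 4 \<le> 1 / packet_scale i" .
      qed
      finally show ?thesis using nn unfolding D_def by linarith
    qed
  qed
  have D_sums: "D sums ((\<Sum>i. B i) + C1 * (\<Sum>i<j. packet_scale i) + Kg * (\<Sum>i. 1 / packet_scale i))"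
  proof -
    have "(\<lambda>i. if i < j then C1 * packet_scale i else 0) sums (\<Sum>i<j. C1 * packet_scale i)"
      using sums_If_finite_set[of "{..<j}" "\<lambda>i. C1 * packet_scale i"] by simp
    then show ?thesis
      unfolding D_def sum_distrib_left
      by (intro sums_add sums_mult summable_sums B(1) summable_inverse_scale)
  qed
  have "norm (a j) \<le> norm (suminf a) + suminf D"
  proof -
    \<comment> \<open>Removes packet \<open>j\<close> from the series, so that the rest is dominated
      termwise by \<open>D\<close>.\<close>
    have "(\<lambda>i. a i - (if i = j then a i else 0)) sums (suminf a - a j)"
      by (intro sums_diff summable_sums sum_a sums_single)
    then have eq: "suminf a - a j = (\<Sum>i. a i - (if i = j then a i else 0))" by (rule sums_unique)
    have "norm (\<Sum>i. a i - (if i = j then a i else 0)) \<le> suminf D"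
    proof (rule norm_suminf_le[OF _ sums_summable[OF D_sums]])
      have "0 \<le> D i" for i unfolding D_def using B0 Kg by (intro add_nonneg_nonneg mult_nonneg_nonneg) auto
      then show "norm (a i - (if i = j then a i else 0)) \<le> D i" for i using D[of i] by auto
    qed
    then show ?thesis
      unfolding eq[symmetric] using norm_triangle_sub[of "a j" "suminf a"] by (simp add: norm_minus_commute)
  qed
  also have "\<dots> \<le> K1 + 2 * C1 * packet_scale i0"
  proof -
    have "C1 * (\<Sum>i<j. packet_scale i) \<le> C1 * (2 * packet_scale i0)"
      unfolding i0(1) by (intro mult_left_mono sum_scale_le Kg)
    then show ?thesis
      using sum_le unfolding sums_unique[OF D_sums, symmetric] K1_def by simp
  qed
  finally have upper: "norm (a j) \<le> K1 + 2 * C1 * packet_scale i0" .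
  have lower: "M / 2 \<le> norm (a j)"
  proof -
    have i1: "integrable lborel (\<lambda>p. of_real M * complex_of_real (\<psi> p))" "(\<integral>p. of_real M * complex_of_real (\<psi> p) \<partial>lborel) = of_real M"
      using \<psi>(3,4) by auto
    \<comment> \<open>The bump is a probability density on the region where the derivative is within
      M/2 of \<open>M\<close>, so its average is within M/2 of \<open>M\<close> too.\<close>
    have "norm (\<integral>p. (of_real (Re (pcomp t j [v] p)) - of_real M) * complex_of_real (\<psi> p) \<partial>lborel) \<le> M / 2"
    proof (rule norm_weighted_integral_le[OF \<psi>(2,3,4)])
      show "integrable lborel (\<lambda>p. (of_real (Re (pcomp t j [v] p)) - of_real M) * complex_of_real (\<psi> p))"
        using Bochner_Integration.integrable_diff[OF int[of j] i1(1)] by (simp add: left_diff_distrib)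
      fix p assume "\<psi> p \<noteq> 0"
      then have "norm (p - (0, real n, 0)) \<le> \<delta> / M ^ 5" using supp s by (simp add: c_def)
      from packet_derivative_at_focus[OF M0(1) less_imp_le[OF \<delta>(1)] less_imp_le[OF pos_rat_pos[of n]] this]
      have "norm (pcomp t j [v] p - of_real M) \<le> gauss_const 3 * (5 * \<delta> * M + 5 * t + 1)"
        by (simp add: pcomp_def t j(2) M_def v_def)
      also have "\<dots> \<le> M / 2"
      proof -
        have "20 * \<delta> * gauss_const 3 * M \<le> 1 * M" using \<delta>(3) M0 by (intro mult_right_mono) auto
        then have "gauss_const 3 * (5 * \<delta> * M) \<le> M / 4" by (simp add: mult_ac)
        moreover have "gauss_const 3 * (5 * t + 1) \<le> M / 4" using N(2) MN(2) by linarith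
        ultimately show ?thesis by (simp add: algebra_simps)
      qed
      finally have "norm (pcomp t j [v] p - of_real M) \<le> M / 2" .
      then show "norm (complex_of_real (Re (pcomp t j [v] p)) - of_real M) \<le> M / 2"
        using abs_Re_le_cmod[of "pcomp t j [v] p - of_real M"] by (simp flip: of_real_diff)
    qed
    also have "(\<integral>p. (of_real (Re (pcomp t j [v] p)) - of_real M) * complex_of_real (\<psi> p) \<partial>lborel) = - a j - of_real M"
      unfolding a_eq left_diff_distrib Bochner_Integration.integral_diff[OF int i1(1)] i1(2) by simp
    finally have "norm (- a j - of_real M) \<le> M / 2" .
    then show ?thesis
      using norm_triangle_ineq2[of "of_real M" "- a j"] M0 by (simp add: norm_minus_commute)
  qed
  \<comment> \<open>The preceding scale is the square root of M, and it already exceeds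
    \<open>N\<close>; hence M beats the bound, which is linear in
    \<open>packet_scale i0\<close>.\<close>
  have Mi0: "M = packet_scale i0 * packet_scale i0" by (simp add: M_def i0(1) scale_Suc power2_eq_square)
  have "packet_scale i0 * (4 * C1 + 2 * K1 + 1) \<le> M"
    unfolding Mi0 using N(1) MN(1) by (intro mult_left_mono) auto
  moreover have "1 * (2 * K1 + 1) \<le> packet_scale i0 * (2 * K1 + 1)"
    using K1 by (intro mult_right_mono) auto
  ultimately have "4 * C1 * packet_scale i0 + 2 * K1 + 1 \<le> M" by (simp add: algebra_simps)
  with upper lower show False by simp
qed

theorem theorem1p2:
  "\<exists>(X :: real set) (u0 :: R3 \<Rightarrow> real) (U0 :: (R3 \<Rightarrow> complex) \<Rightarrow> complex).
     X \<in> null_sets lebesgue \<and> \<rat> \<subseteq> X \<and> (\<forall>\<gamma>. generic_irrational \<gamma> \<longrightarrow> \<gamma> \<in> - X) \<and>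
     C_infinity u0 \<and>
     tempered_distribution U0 \<and> represented_by U0 (\<lambda>p. complex_of_real (u0 p)) \<and>
     (\<forall>t>0. t \<notin> X \<longrightarrow> (\<exists>g. C_infinity g \<and> represented_by (W t U0) g)) \<and>
     (\<forall>t>0. t \<in> X \<longrightarrow> \<not> (\<exists>g. C_k 1 g \<and> represented_by (W t U0) g))"
proof (intro exI[of _ \<rat>] exI[of _ data] exI[of _ data_dist] conjI allI impI)
  show "(\<rat> :: real set) \<in> null_sets lebesgue"
    by (intro null_sets_completionI countable_imp_null_set_lborel countable_rat)
  show "\<rat> \<subseteq> (\<rat> :: real set)" ..
  show "\<gamma> \<in> - \<rat>" if "generic_irrational \<gamma>" for \<gamma>
    using that by (simp add: generic_irrational_def)
  show "C_infinity data" by (rule C_infinity_data)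
  show "tempered_distribution data_dist" by (rule tempered_distribution_data_dist)
  show "represented_by data_dist (\<lambda>p. complex_of_real (data p))" by (rule represented_by_data)
  show "\<exists>g. C_infinity g \<and> represented_by (W t data_dist) g" if "t > 0" "t \<notin> \<rat>" for t
  proof (intro exI conjI)
    have t: "t \<notin> range pos_rat" using that by (simp add: range_pos_rat)
    show "represented_by (W t data_dist) (\<lambda>p. of_real (Re (\<Sum>j. pcomp t j [] p)))"
      by (rule represented_by_suminf_pcomp[OF t])
    show "C_infinity (\<lambda>p. complex_of_real (Re (\<Sum>j. pcomp t j [] p)))"
      unfolding C_infinity_def
      by (intro allI C_k_compose_bounded_linear[OF bounded_linear_of_real] C_k_compose_bounded_linear[OF bounded_linear_Re]
          C_k_suminf_pcomp t)
  qed
  show "\<not> (\<exists>g. C_k 1 g \<and> represented_by (W t data_dist) g)" if "t > 0" "t \<in> \<rat>" for t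
  proof -
    have "t \<in> range pos_rat" using that by (simp add: range_pos_rat)
    then obtain n where "t = pos_rat n" by auto
    then show ?thesis using not_C1_at_rational by blast
  qed
qed

end
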